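(* (a) We have the identity of formal power series in $t$ $$1 + \sum_{n\geq 1} \frac{C_n(q)}{q^n} \, t^n = \prod_{i\geq 1} \frac{(1-t^i)^2}{1-(q+q^{-1})t^i + t^{2i}} .$$ (b) For each $n\ge 1$ the polynomials $C_n(q)$ and $P_n(q)$ are palindromic.
   Context: For a prime power $q$ and $n\geq 1$, $C_n(q)$ denotes the number of ideals of codimension $n$ of the Laurent polynomial algebra $\mathbb{F}_q[x,y,x^{-1},y^{-1}]$ over the finite field $\mathbb{F}_q$ with $q$ elements (ideals $J$ such that the quotient has dimension $n$ over $\mathbb{F}_q$). For fixed $n$, $C_n(q)$ is given, for all prime powers $q$, by a (necessarily unique) polynomial in $q$ with integer coefficients, also denoted $C_n(q)$, which is monic of degree $2n$ and divisible by $(q-1)^2$; $P_n(q)$ is the polynomial defined by $C_n(q)=(q-1)^2P_n(q)$. A polynomial $F(q)$ of degree $m$ is palindromic if $F(q)=q^{m}F(q^{-1})$. *)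

theory Defs
  imports
    "HOL-Analysis.Infinite_Products"
    "HOL-Analysis.Product_Vector"
    "HOL-Computational_Algebra.Formal_Power_Series"
    "HOL-Computational_Algebra.Polynomial_Factorial"
    "HOL-Algebra.QuotRing"
    "HOL-Algebra.Embedded_Algebras"
begin

text \<open>
  The Laurent polynomial algebra \<open>F[x, y, x\<^sup>-\<^sup>1, y\<^sup>-\<^sup>1]\<close>: a finitely supported function \<open>f\<close>
  stands for the sum of all \<open>f (i, j) x\<^sup>i y\<^sup>j\<close>; subtraction of exponents is componentwise.
\<close>

definition laurent_ring :: "('a, 'b) ring_scheme \<Rightarrow> (int \<times> int \<Rightarrow> 'a) ring" where
  "laurent_ring F =
     \<lparr> carrier = {f. range f \<subseteq> carrier F \<and> finite {m. f m \<noteq> \<zero>\<^bsub>F\<^esub>}},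
       mult = (\<lambda>f g m. \<Oplus>\<^bsub>F\<^esub>k \<in> {k. f k \<noteq> \<zero>\<^bsub>F\<^esub>}. f k \<otimes>\<^bsub>F\<^esub> g (m - k)),
       one = (\<lambda>m. if m = 0 then \<one>\<^bsub>F\<^esub> else \<zero>\<^bsub>F\<^esub>),
       zero = (\<lambda>m. \<zero>\<^bsub>F\<^esub>),
       add = (\<lambda>f g m. f m \<oplus>\<^bsub>F\<^esub> g m) \<rparr>"

definition laurent_const :: "('a, 'b) ring_scheme \<Rightarrow> 'a \<Rightarrow> int \<times> int \<Rightarrow> 'a" where
  "laurent_const F c = (\<lambda>m. if m = 0 then c else \<zero>\<^bsub>F\<^esub>)"

text \<open>
  The scalars of the \<open>F\<close>-vector space \<open>laurent_ring F Quot J\<close> are the residue classes of the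
  constants; for a proper ideal \<open>J\<close> they form a subfield isomorphic to \<open>F\<close>.
\<close>

definition has_codim :: "('a, 'b) ring_scheme \<Rightarrow> (int \<times> int \<Rightarrow> 'a) set \<Rightarrow> nat \<Rightarrow> bool" where
  "has_codim F J n \<longleftrightarrow>
     ring.dimension (laurent_ring F Quot J) n
       ((\<lambda>c. J +>\<^bsub>laurent_ring F\<^esub> laurent_const F c) ` carrier F)
       (carrier (laurent_ring F Quot J))"

definition num_ideals :: "('a, 'b) ring_scheme \<Rightarrow> nat \<Rightarrow> nat" where
  "num_ideals F n = card {J. ideal J (laurent_ring F) \<and> has_codim F J n}"

text \<open>
  Every finite field is isomorphic to one whose carrier is a set of integers, so quantifying over
  \<open>F :: int ring\<close> covers the finite fields of all prime power orders.
\<close>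

definition C_poly :: "nat \<Rightarrow> int poly" where
  "C_poly n = (THE p. \<forall>F :: int ring. field F \<and> finite (carrier F) \<longrightarrow>
                 poly p (int (card (carrier F))) = int (num_ideals F n))"

definition P_poly :: "nat \<Rightarrow> int poly" where
  "P_poly n = (THE p. C_poly n = [:-1, 1:]\<^sup>2 * p)"

text \<open>Identities in \<open>q\<close> are formal: they are stated in the field of fractions of \<open>\<int>[q]\<close>.\<close>

definition qvar :: "int poly fract" where
  "qvar = to_fract [:0, 1:]"

definition eval_at :: "int poly \<Rightarrow> 'a :: comm_ring_1 \<Rightarrow> 'a" where
  "eval_at p x = poly (map_poly of_int p) x"

definition palindromic :: "int poly \<Rightarrow> bool" where
  "palindromic p \<longleftrightarrow> eval_at p qvar = qvar ^ degree p * eval_at p (inverse qvar)"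

end

theory Submission
  imports
    "HOL-Library.Poly_Mapping"
    "HOL-Number_Theory.Residues"
    "HOL-Decision_Procs.Algebra_Aux"
    "HOL-Computational_Algebra.Formal_Laurent_Series"
    Defs
begin

text \<open>
  Write \<open>A\<close> for the polynomials over the field in \<open>x\<close>; the ideals to be counted are those
  of \<open>A[y]\<close> modulo which \<open>x\<close> and \<open>y\<close> are units. Let \<open>L\<close> be such an ideal containing a monic
  polynomial of degree \<open>d + 1\<close> in \<open>y\<close>. The coefficients of \<open>y\<^sup>d\<close> of the elements of \<open>L\<close> of
  degree at most \<open>d\<close> form a principal ideal \<open>(h)\<close> of \<open>A\<close>, and \<open>h\<close> divides all these elements.
  Hence \<open>K = (L : h)\<close> contains a monic polynomial of degree \<open>d\<close>, and \<open>L = h K + (G)\<close> for a monic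
  \<open>G\<close> in \<open>K\<close> of degree \<open>d + 1\<close>, unique modulo the elements of \<open>h K\<close> of degree at most \<open>d\<close>.
  Conversely \<open>h\<close>, \<open>K\<close> and \<open>G\<close> yield an ideal of the required kind iff \<open>x\<close> and \<open>G(0)\<close> are units
  modulo \<open>h\<close>. If \<open>h\<close> has degree \<open>m\<close>, this gives \<open>q\<^bsup>md\<^esup> \<phi>(h)\<close> ideals for each \<open>K\<close>, of
  codimension \<open>m (d + 1)\<close> larger. So every \<open>d\<close> contributes one factor to the generating function,
  a series in the numbers \<open>\<Sum> \<phi>(h)\<close> over the \<open>h\<close> of degree \<open>m\<close>, which are found by
  grouping pairs \<open>(h, c mod h)\<close> according to \<open>gcd(h, c)\<close>.

  The argument runs in rings of the type class \<open>comm_ring_1\<close> modulo an ideal: a finite field is a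
  quotient of \<open>\<int>[z]\<close>, so \<open>A\<close> and \<open>A[y]\<close> are replaced by polynomial rings over \<open>\<int>[z]\<close>.
\<close>

section \<open>Indices of additive subgroups\<close>

text \<open>Weighting an ideal of codimension n by (t/q)^n makes the factors uniform. The step with
  data m and d has weight q^(m d) (t/q)^(m (d+1)) = q^(-m) (t^(d+1))^m, so it contributes N(t^(d+1))
  for one and the same series N, whose coefficients are the numbers q^(-m) \<Sum> \<phi>(h). This is
  where the denominators q^n and the powers t^i in the product come from. Palindromicity comes out
  of the same recursion: every ingredient is symmetric under q -> 1/q up to a power of q, whose
  exponent is twice the codimension that the ingredient accounts for, and codimensions add up. The
  obstacle is that modulo an ideal neither degrees nor leading coefficients are well defined. Monic
  polynomials replace them: division by a monic polynomial works over every commutative ring, and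
  its quotient is unique modulo any ideal of coefficients. It also reduces every index to one
  between additive groups of polynomials of bounded degree. These groups are not ideals, which is
  why indices are set up for additive subgroups.\<close>

definition add_subgroup :: "'a::ab_group_add set \<Rightarrow> bool" where
  "add_subgroup V \<longleftrightarrow> 0 \<in> V \<and> (\<forall>a\<in>V. \<forall>b\<in>V. a - b \<in> V)"

definition coset_of :: "'a::ab_group_add set \<Rightarrow> 'a \<Rightarrow> 'a set" where
  "coset_of D v = {w. w - v \<in> D}"

text \<open>As for \<^const>\<open>card\<close>, an infinite index counts as 0.\<close>

definition index :: "'a::ab_group_add set \<Rightarrow> 'a set \<Rightarrow> nat" where
  "index V D = card (coset_of D ` V)"

lemma add_subgroup_0: "add_subgroup V \<Longrightarrow> 0 \<in> V"
  and add_subgroup_diff: "add_subgroup V \<Longrightarrow> a \<in> V \<Longrightarrow> b \<in> V \<Longrightarrow> a - b \<in> V"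
  by (auto simp: add_subgroup_def)

lemma add_subgroup_minus: "add_subgroup V \<Longrightarrow> a \<in> V \<Longrightarrow> - a \<in> V"
  using add_subgroup_diff[of V 0 a] add_subgroup_0[of V] by simp

lemma add_subgroup_add: "add_subgroup V \<Longrightarrow> a \<in> V \<Longrightarrow> b \<in> V \<Longrightarrow> a + b \<in> V"
  using add_subgroup_diff[of V a "-b"] add_subgroup_minus[of V b] by simp

lemma add_subgroup_UNIV [simp]: "add_subgroup UNIV"
  by (simp add: add_subgroup_def)

lemma add_subgroup_Int: "add_subgroup V \<Longrightarrow> add_subgroup W \<Longrightarrow> add_subgroup (V \<inter> W)"
  by (auto simp: add_subgroup_def)

lemma coset_of_eq_iff:
  assumes "add_subgroup D"
  shows "coset_of D v = coset_of D w \<longleftrightarrow> v - w \<in> D"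
proof
  assume "coset_of D v = coset_of D w"
  moreover have "v \<in> coset_of D v" using assms by (simp add: coset_of_def add_subgroup_0)
  ultimately show "v - w \<in> D" by (simp add: coset_of_def)
next
  assume *: "v - w \<in> D"
  show "coset_of D v = coset_of D w"
    unfolding coset_of_def
    using add_subgroup_add[OF assms _ *] add_subgroup_diff[OF assms _ *]
    by (auto simp: algebra_simps) (metis add_diff_cancel_left' add_diff_eq diff_add_cancel)+
qed

lemma self_in_coset_of: "add_subgroup D \<Longrightarrow> v \<in> coset_of D v"
  by (simp add: coset_of_def add_subgroup_0)

lemma index_self: "add_subgroup D \<Longrightarrow> index D D = 1"
proof -
  assume "add_subgroup D"
  then have "coset_of D ` D = {coset_of D 0}"
    using coset_of_eq_iff[of D _ 0] add_subgroup_0 by (auto simp: image_iff)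
  then show ?thesis by (simp add: index_def)
qed

lemma coset_of_shift: "(+) a ` coset_of D v = coset_of D (a + v)"
proof (intro equalityI subsetI)
  fix w assume "w \<in> coset_of D (a + v)"
  then have "w = a + (w - a)" "w - a \<in> coset_of D v" by (auto simp: coset_of_def algebra_simps)
  then show "w \<in> (+) a ` coset_of D v" by (rule image_eqI)
qed (auto simp: coset_of_def)

lemma bij_betw_cosets_shift: "bij_betw ((`) ((+) a)) (coset_of D ` X) (coset_of D ` (+) a ` X)"
proof -
  have "inj ((`) ((+) a))" by (auto simp: inj_def inj_image_eq_iff)
  then show ?thesis
    by (auto simp: bij_betw_def image_image coset_of_shift intro: inj_on_subset)
qed

lemma card_cosets_shift: "card (coset_of D ` (+) a ` X) = card (coset_of D ` X)"
  and finite_cosets_shift: "finite (coset_of D ` (+) a ` X) \<longleftrightarrow> finite (coset_of D ` X)"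
  using bij_betw_same_card[OF bij_betw_cosets_shift] bij_betw_finite[OF bij_betw_cosets_shift] by metis+

text \<open>All fibres of an additive map between coset spaces have the size of the kernel.\<close>

lemma card_cosets_vimage:
  assumes V: "add_subgroup V" and D: "add_subgroup D" "D \<subseteq> V" and H: "add_subgroup H"
    and f: "\<And>a b. a \<in> V \<Longrightarrow> b \<in> V \<Longrightarrow> f (a - b) = f a - f b"
    and fD: "\<And>a. a \<in> D \<Longrightarrow> f a \<in> H"
    and surj: "\<And>t. t \<in> T \<Longrightarrow> \<exists>v\<in>V. f v - t \<in> H"
  shows "card (coset_of D ` {v \<in> V. \<exists>t\<in>T. f v - t \<in> H}) =
         card (coset_of H ` T) * card (coset_of D ` {v \<in> V. f v \<in> H})"
proof -
  have fadd: "f (a + b) = f a + f b" if "a \<in> V" "b \<in> V" for a b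
    using f[OF add_subgroup_add[OF V that] that(2)] by (metis add_diff_cancel_right' diff_add_cancel)
  \<comment> \<open>A section: one preimage for each coset \<open>C\<close> in the image.
    Translating the cosets of the kernel by \<open>r C\<close> yields the cosets over
    \<open>C\<close>, so the map \<open>g\<close> below is the required bijection.\<close>
  define r where "r C = (SOME v. v \<in> V \<and> f v \<in> C)" for C
  have r: "r C \<in> V \<and> f (r C) \<in> C" if "C \<in> coset_of H ` T" for C
  proof -
    have "\<exists>v. v \<in> V \<and> f v \<in> C" using that surj by (auto simp: coset_of_def)
    then show ?thesis unfolding r_def by (rule someI_ex)
  qed
  define E where "E = {v \<in> V. f v \<in> H}"
  define g where "g = (\<lambda>(C, X). (\<lambda>w. r C + w) ` X :: 'a set)"
  have shift: "(\<lambda>w. a + w) ` coset_of D v = coset_of D (a + v)" for a v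
  proof (intro equalityI subsetI)
    fix w assume "w \<in> coset_of D (a + v)"
    then have "w = a + (w - a)" "w - a \<in> coset_of D v" by (auto simp: coset_of_def algebra_simps)
    then show "w \<in> (\<lambda>w. a + w) ` coset_of D v" by (rule image_eqI)
  qed (auto simp: coset_of_def)
  have "bij_betw g (coset_of H ` T \<times> coset_of D ` E) (coset_of D ` {v \<in> V. \<exists>t\<in>T. f v - t \<in> H})"
    unfolding bij_betw_def
  proof
    show "inj_on g (coset_of H ` T \<times> coset_of D ` E)"
    proof (rule inj_onI, clarify)
      fix s t u w assume st: "s \<in> T" "t \<in> T" and uw: "u \<in> E" "w \<in> E"
      assume eq: "g (coset_of H s, coset_of D u) = g (coset_of H t, coset_of D w)"
      let ?C = "coset_of H s" and ?C' = "coset_of H t"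
      have rC: "r ?C \<in> V" "f (r ?C) - s \<in> H" "r ?C' \<in> V" "f (r ?C') - t \<in> H"
        using r[of ?C] r[of ?C'] st by (auto simp: coset_of_def)
      have uwV: "u \<in> V" "w \<in> V" "f u \<in> H" "f w \<in> H" using uw by (auto simp: E_def)
      have "r ?C + u - (r ?C' + w) \<in> D"
        using eq D(1) by (simp add: g_def shift coset_of_eq_iff)
      from fD[OF this] have "f (r ?C) + f u - (f (r ?C') + f w) \<in> H"
        using rC uwV V by (simp add: f fadd add_subgroup_add)
      then have "(f (r ?C) + f u - (f (r ?C') + f w)) - f u + f w - (f (r ?C) - s) + (f (r ?C') - t) \<in> H"
        using add_subgroup_add[OF H add_subgroup_diff[OF H add_subgroup_add[OF H add_subgroup_diff[OF H
          _ uwV(3)] uwV(4)] rC(2)] rC(4)] by blast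
      then have "s - t \<in> H" by (simp add: algebra_simps)
      then have "?C = ?C'" using H by (simp add: coset_of_eq_iff)
      moreover from this have "coset_of D u = coset_of D w"
        using eq D(1) by (simp add: g_def shift coset_of_eq_iff)
      ultimately show "?C = ?C' \<and> coset_of D u = coset_of D w" by blast
    qed
    show "g ` (coset_of H ` T \<times> coset_of D ` E) = coset_of D ` {v \<in> V. \<exists>t\<in>T. f v - t \<in> H}"
    proof (intro equalityI subsetI)
      fix Y assume "Y \<in> g ` (coset_of H ` T \<times> coset_of D ` E)"
      then obtain t u where tu: "t \<in> T" "u \<in> E" "Y = g (coset_of H t, coset_of D u)" by auto
      let ?C = "coset_of H t"
      have rC: "r ?C \<in> V" "f (r ?C) - t \<in> H"
        using r[of ?C] tu by (auto simp: coset_of_def)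
      have "f (r ?C + u) - t \<in> H"
        using add_subgroup_add[OF H rC(2), of "f u"] tu(2) rC by (simp add: E_def fadd algebra_simps)
      then show "Y \<in> coset_of D ` {v \<in> V. \<exists>t\<in>T. f v - t \<in> H}"
        using tu rC V by (auto simp: g_def shift E_def add_subgroup_add)
    next
      fix Y assume "Y \<in> coset_of D ` {v \<in> V. \<exists>t\<in>T. f v - t \<in> H}"
      then obtain v t where v: "v \<in> V" "t \<in> T" "f v - t \<in> H" "Y = coset_of D v" by auto
      let ?C = "coset_of H t"
      have rC: "r ?C \<in> V" "f (r ?C) - t \<in> H"
        using r[of ?C] v by (auto simp: coset_of_def)
      have "f (v - r ?C) \<in> H"
        using add_subgroup_diff[OF H v(3) rC(2)] v rC by (simp add: f)
      then have "v - r ?C \<in> E" using v rC V by (simp add: E_def add_subgroup_diff)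
      moreover have "Y = g (?C, coset_of D (v - r ?C))" by (simp add: g_def shift v)
      ultimately show "Y \<in> g ` (coset_of H ` T \<times> coset_of D ` E)" using v by auto
    qed
  qed
  then have "card (coset_of D ` {v \<in> V. \<exists>t\<in>T. f v - t \<in> H}) = card (coset_of H ` T \<times> coset_of D ` E)"
    by (simp add: bij_betw_same_card)
  then show ?thesis by (simp add: card_cartesian_product E_def)
qed

text \<open>The case of the identity map. If one of the indices is infinite, both sides are
  0.\<close>

lemma index_mult:
  assumes "add_subgroup V" "add_subgroup D" "add_subgroup E" "D \<subseteq> E" "E \<subseteq> V"
  shows "index V D = index V E * index E D"
proof -
  have "card (coset_of D ` {v \<in> V. \<exists>t\<in>V. v - t \<in> E}) = 
        card (coset_of E ` V) * card (coset_of D ` {v \<in> V. v \<in> E})"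
    using assms add_subgroup_0[OF assms(3)] by (intro card_cosets_vimage[where f = "\<lambda>x. x"]) force+
  moreover have "{v \<in> V. \<exists>t\<in>V. v - t \<in> E} = V"
    using add_subgroup_0[OF assms(3)] by force
  moreover have "{v \<in> V. v \<in> E} = E" using assms by auto
  ultimately show ?thesis by (simp add: index_def)
qed

text \<open>The isomorphism theorem for the map from \<open>V / D\<close> to \<open>W / H\<close>
  induced by \<open>f\<close>. Surjectivity and kernel are meant modulo \<open>H\<close>, since in
  the applications \<open>f\<close> reaches every coset but not every element of
  \<open>W\<close>.\<close>

lemma index_eq_if_additive:
  assumes V: "add_subgroup V" and D: "add_subgroup D" "D \<subseteq> V" and H: "add_subgroup H"
    and f: "\<And>a b. a \<in> V \<Longrightarrow> b \<in> V \<Longrightarrow> f (a - b) = f a - f b"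
    and im: "\<And>v. v \<in> V \<Longrightarrow> f v \<in> W"
    and surj: "\<And>w. w \<in> W \<Longrightarrow> \<exists>v\<in>V. f v - w \<in> H"
    and ker: "\<And>v. v \<in> V \<Longrightarrow> f v \<in> H \<longleftrightarrow> v \<in> D"
  shows "index V D = index W H"
proof -
  have "card (coset_of D ` {v \<in> V. \<exists>t\<in>W. f v - t \<in> H}) =
         card (coset_of H ` W) * card (coset_of D ` {v \<in> V. f v \<in> H})"
    using assms by (intro card_cosets_vimage) auto
  moreover have "{v \<in> V. \<exists>t\<in>W. f v - t \<in> H} = V"
    using im add_subgroup_0[OF H] by (auto intro!: bexI[of _ "f _"])
  moreover have "{v \<in> V. f v \<in> H} = D" using ker D by auto
  ultimately show ?thesis using index_self[OF D(1)] by (simp add: index_def)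
qed

section \<open>Ideals\<close>

definition is_ideal :: "'a::comm_ring_1 set \<Rightarrow> bool" where
  "is_ideal I \<longleftrightarrow> 0 \<in> I \<and> (\<forall>a\<in>I. \<forall>b\<in>I. a + b \<in> I) \<and> (\<forall>r. \<forall>a\<in>I. r * a \<in> I)"

definition unit_mod :: "'a::comm_ring_1 set \<Rightarrow> 'a \<Rightarrow> bool" where
  "unit_mod I a \<longleftrightarrow> (\<exists>s. 1 - a * s \<in> I)"

definition num_units_mod :: "'a::comm_ring_1 set \<Rightarrow> nat" where
  "num_units_mod I = card (coset_of I ` {a. unit_mod I a})"

text \<open>Read as a I + J. The same form serves for the ideal generated by \<open>a\<close> over
  \<open>J\<close> (with \<open>I = UNIV\<close>), for multiples of ideals, and for multiples of
  cosets or of parts of bounded degree.\<close>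

definition scaled :: "'a::comm_ring_1 \<Rightarrow> 'a set \<Rightarrow> 'a set \<Rightarrow> 'a set" where
  "scaled a I J = {a * p + k | p k. p \<in> I \<and> k \<in> J}"

definition colon :: "'a::comm_ring_1 set \<Rightarrow> 'a \<Rightarrow> 'a set" where
  "colon I a = {p. a * p \<in> I}"

lemma is_ideal_0: "is_ideal I \<Longrightarrow> 0 \<in> I"
  and is_ideal_add: "is_ideal I \<Longrightarrow> a \<in> I \<Longrightarrow> b \<in> I \<Longrightarrow> a + b \<in> I"
  and is_ideal_mult: "is_ideal I \<Longrightarrow> a \<in> I \<Longrightarrow> r * a \<in> I"
  and is_ideal_mult': "is_ideal I \<Longrightarrow> a \<in> I \<Longrightarrow> a * r \<in> I"
  by (auto simp: is_ideal_def mult.commute[of a])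

lemma is_ideal_minus: "is_ideal I \<Longrightarrow> a \<in> I \<Longrightarrow> - a \<in> I"
  using is_ideal_mult[of I a "-1"] by simp

lemma is_ideal_diff: "is_ideal I \<Longrightarrow> a \<in> I \<Longrightarrow> b \<in> I \<Longrightarrow> a - b \<in> I"
  using is_ideal_add[of I a "-b"] is_ideal_minus[of I b] by simp

lemmas is_ideal_closed = is_ideal_0 is_ideal_add is_ideal_mult is_ideal_mult' is_ideal_minus is_ideal_diff

lemma is_ideal_sum: "is_ideal I \<Longrightarrow> (\<And>i. i \<in> A \<Longrightarrow> f i \<in> I) \<Longrightarrow> sum f A \<in> I"
  by (induction A rule: infinite_finite_induct) (auto simp: is_ideal_closed)

lemma is_ideal_diff_iff: "is_ideal I \<Longrightarrow> a - b \<in> I \<Longrightarrow> a \<in> I \<longleftrightarrow> b \<in> I"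
  using is_ideal_add[of I "a - b" b] is_ideal_diff[of I a "a - b"] by auto

lemma add_subgroup_ideal: "is_ideal I \<Longrightarrow> add_subgroup I"
  by (auto simp: add_subgroup_def is_ideal_closed)

lemma is_ideal_UNIV [simp]: "is_ideal UNIV"
  by (simp add: is_ideal_def)

lemma is_ideal_eq_UNIV: "is_ideal I \<Longrightarrow> 1 \<in> I \<Longrightarrow> I = UNIV"
  using is_ideal_mult[of I 1] by auto

lemma is_ideal_scaled:
  assumes "is_ideal I" "is_ideal J" shows "is_ideal (scaled a I J)"
  unfolding is_ideal_def
proof (intro conjI ballI allI)
  show "0 \<in> scaled a I J"
    using assms unfolding scaled_def by (auto intro!: exI[of _ 0] simp: is_ideal_closed)
next
  fix u v assume "u \<in> scaled a I J" "v \<in> scaled a I J"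
  then obtain p k p' k' where "u = a * p + k" "v = a * p' + k'" "p \<in> I" "k \<in> J" "p' \<in> I" "k' \<in> J"
    by (auto simp: scaled_def)
  moreover from this have "u + v = a * (p + p') + (k + k')" by (simp add: algebra_simps)
  ultimately show "u + v \<in> scaled a I J" using assms is_ideal_add unfolding scaled_def by blast
next
  fix r u assume "u \<in> scaled a I J"
  then obtain p k where "u = a * p + k" "p \<in> I" "k \<in> J"
    by (auto simp: scaled_def)
  moreover from this have "r * u = a * (r * p) + r * k" by (simp add: algebra_simps)
  ultimately show "r * u \<in> scaled a I J" using assms is_ideal_mult unfolding scaled_def by blast
qed

lemma scaledI: "p \<in> I \<Longrightarrow> k \<in> J \<Longrightarrow> a * p + k \<in> scaled a I J"
  by (auto simp: scaled_def)

lemma scaledE: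
  assumes "u \<in> scaled a I J" obtains p k where "u = a * p + k" "p \<in> I" "k \<in> J"
  using assms by (auto simp: scaled_def)

lemma scaled_superset: "is_ideal I \<Longrightarrow> J \<subseteq> scaled a I J"
  using scaledI[of 0 I _ J a] by (auto simp: is_ideal_0)

lemma mult_in_scaled: "is_ideal J \<Longrightarrow> p \<in> I \<Longrightarrow> a * p \<in> scaled a I J"
  using scaledI[of p I 0 J a] by (auto simp: is_ideal_0)

lemma is_ideal_colon: "is_ideal I \<Longrightarrow> is_ideal (colon I a)"
  by (auto simp: is_ideal_def colon_def algebra_simps mult.left_commute)

lemma colon_superset: "is_ideal I \<Longrightarrow> I \<subseteq> colon I a"
  by (auto simp: colon_def is_ideal_mult)

lemma unit_mod_mono: "unit_mod I a \<Longrightarrow> I \<subseteq> J \<Longrightarrow> unit_mod J a"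
  by (auto simp: unit_mod_def)

lemma unit_mod_cong:
  assumes "is_ideal I" "a - b \<in> I" "unit_mod I a" shows "unit_mod I b"
proof -
  obtain s where s: "1 - a * s \<in> I" using assms by (auto simp: unit_mod_def)
  have "(1 - a * s) + s * (a - b) \<in> I"
    using is_ideal_add[OF assms(1) s is_ideal_mult[OF assms(1,2)]] .
  moreover have "(1 - a * s) + s * (a - b) = 1 - b * s" by (simp add: algebra_simps)
  ultimately show ?thesis by (auto simp: unit_mod_def)
qed

text \<open>Modulo \<open>J\<close> one has 1 = x s + a b. If \<open>t\<close> inverts
  \<open>x\<close> modulo \<open>I\<close>, then a b and a b x t agree modulo a I, so
  \<open>s + a * b * t\<close> inverts \<open>x\<close> modulo every ideal that contains both a I
  and \<open>J\<close>.\<close>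

lemma unit_mod_scaled:
  assumes I: "is_ideal I" and ax: "unit_mod (scaled a UNIV J) x" and Ix: "unit_mod I x"
    and L: "is_ideal L" "J \<subseteq> L" "\<And>p. p \<in> I \<Longrightarrow> a * p \<in> L"
  shows "unit_mod L x"
proof -
  obtain s where "1 - x * s \<in> scaled a UNIV J" using ax by (auto simp: unit_mod_def)
  then obtain b k where b: "1 - x * s = a * b + k" "k \<in> J" by (rule scaledE)
  obtain t where t: "1 - x * t \<in> I" using Ix by (auto simp: unit_mod_def)
  have "b * (a * (1 - x * t)) + k \<in> L"
    using is_ideal_add[OF L(1) is_ideal_mult[OF L(1) L(3)[OF t]]] L(2) b(2) by blast
  also have "b * (a * (1 - x * t)) + k = (a * b + k) - x * (a * b * t)"
    by (simp add: algebra_simps)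
  also have "\<dots> = 1 - x * (s + a * b * t)"
    unfolding b(1)[symmetric] by (simp add: algebra_simps)
  finally show ?thesis by (auto simp: unit_mod_def)
qed

section \<open>Monic polynomials and ideals\<close>

definition coeffs_in :: "'a::comm_ring_1 set \<Rightarrow> 'a poly set" where
  "coeffs_in I = {p. \<forall>i. poly.coeff p i \<in> I}"

text \<open>The bound is stated through coefficients because \<open>degree 0 = 0\<close> would not
  fit \<open>below 0\<close>, whose only element is 0. Degree at most d is
  \<open>below (Suc d)\<close>.\<close>

definition below :: "nat \<Rightarrow> 'a::comm_ring_1 poly set" where
  "below d = {p. \<forall>i\<ge>d. poly.coeff p i = 0}"

definition monics :: "nat \<Rightarrow> 'a::comm_ring_1 poly set" where
  "monics d = {G. poly.coeff G d = 1 \<and> (\<forall>i>d. poly.coeff G i = 0)}"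

lemma is_ideal_coeffs_in: "is_ideal I \<Longrightarrow> is_ideal (coeffs_in I)"
  by (auto simp: is_ideal_def coeffs_in_def coeff_mult intro!: is_ideal_sum[unfolded is_ideal_def])

lemma coeffs_in_subset: "is_ideal K \<Longrightarrow> (\<And>a. a \<in> I \<Longrightarrow> [:a:] \<in> K) \<Longrightarrow> coeffs_in I \<subseteq> K"
proof
  fix p assume K: "is_ideal K" "\<And>a. a \<in> I \<Longrightarrow> [:a:] \<in> K" and "p \<in> coeffs_in I"
  then have "(\<Sum>i\<le>degree p. monom (poly.coeff p i) i) \<in> K"
    by (intro is_ideal_sum)
      (auto simp: coeffs_in_def monom_altdef[of "poly.coeff p _"] intro!: is_ideal_mult'[of K "[:_:]", simplified])
  then show "p \<in> K" by (simp add: poly_as_sum_of_monoms)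
qed

lemma add_subgroup_below: "add_subgroup (below d)"
  by (auto simp: add_subgroup_def below_def)

lemma in_below_degree: "p \<in> below (Suc (degree p))"
  by (auto simp: below_def coeff_eq_0)

lemma minus_monom_in_below:
  assumes "p \<in> below (Suc d)" shows "p - monom (poly.coeff p d) d \<in> below d"
  unfolding below_def
proof clarify
  fix i assume "d \<le> i"
  then show "poly.coeff (p - monom (poly.coeff p d) d) i = 0"
    using assms by (cases "i = d") (auto simp: below_def)
qed

lemma monics_diff: "G \<in> monics d \<Longrightarrow> G' \<in> monics d \<Longrightarrow> G - G' \<in> below d"
  by (auto simp: monics_def below_def order.order_iff_strict)

lemma monics_add: "G \<in> monics d \<Longrightarrow> v \<in> below d \<Longrightarrow> G + v \<in> monics d"
  by (auto simp: monics_def below_def)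

lemma monom_in_monics: "monom 1 d \<in> monics d"
  by (auto simp: monics_def)

lemma monics_shift:
  assumes "G \<in> monics d" shows "[:0, 1:] * G \<in> monics (Suc d)"
  using assms by (auto simp: monics_def coeff_pCons split: nat.splits)

lemma ideal_monics_mono:
  assumes "is_ideal K" "K \<inter> monics d \<noteq> {}" "d \<le> e"
  shows "K \<inter> monics e \<noteq> {}"
  using assms(3,2)
proof (induction rule: dec_induct)
  case (step n)
  then obtain G where "G \<in> K" "G \<in> monics n" by auto
  then have "[:0, 1:] * G \<in> K \<inter> monics (Suc n)"
    using monics_shift is_ideal_mult[OF assms(1)] by blast
  then show ?case by blast
qed

lemma monic_division:
  assumes "G \<in> monics d"
  obtains s r where "p = s * G + r" "r \<in> below d"
proof -
  have "\<exists>s r. p = s * G + r \<and> r \<in> below d" if "p \<in> below n" for n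
    using that
  proof (induction n arbitrary: p)
    case 0
    then have "p = 0 * G + 0" by (auto simp: below_def poly_eq_iff)
    moreover have "0 \<in> below d" by (simp add: below_def)
    ultimately show ?case by blast
  next
    case (Suc n)
    show ?case
    proof (cases "n < d")
      case True
      then have "p = 0 * G + p \<and> p \<in> below d" using Suc.prems by (auto simp: below_def)
      then show ?thesis by blast
    next
      case False
      \<comment> \<open>Cancels the coefficient at \<open>n\<close>; no inverse is involved because
        \<open>G\<close> has leading coefficient 1.\<close>
      define t where "t = monom (poly.coeff p n) (n - d)"
      have "p - t * G \<in> below n"
        unfolding below_def
      proof clarify
        fix i assume "n \<le> i"
        then show "poly.coeff (p - t * G) i = 0"
          using assms Suc.prems False
          by (cases "i = n") (auto simp: t_def coeff_monom_mult below_def monics_def)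
      qed
      from Suc.IH[OF this] obtain s r where "p - t * G = s * G + r" "r \<in> below d" by blast
      then have "p = (s + t) * G + r" by (simp add: algebra_simps)
      with \<open>r \<in> below d\<close> show ?thesis by blast
    qed
  qed
  from this[OF in_below_degree] that show ?thesis by blast
qed

text \<open>Uniqueness of division by a monic polynomial over the quotient by \<open>I\<close>. The
  coefficient of \<open>s * G\<close> at \<open>e + d\<close> is the coefficient of \<open>s\<close>
  at \<open>e\<close> plus terms with higher coefficients of \<open>s\<close>. It lies in
  \<open>I\<close>, so descending induction on \<open>e\<close> applies.\<close>

lemma monic_quotient_coeffs_in:
  assumes I: "is_ideal I" and G: "G \<in> monics d" and k: "k \<in> coeffs_in I" and r: "s * G + k \<in> below d"
  shows "s \<in> coeffs_in I"
proof -
  have "poly.coeff s e \<in> I" if "e + j = degree s" for e j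
    using that
  proof (induction j arbitrary: e rule: less_induct)
    case (less j)
    have hi: "poly.coeff s i \<in> I" if "i > e" for i
      using less.IH[of "degree s - i" i] less.prems that is_ideal_0[OF I]
      by (cases "i \<le> degree s") (auto simp: coeff_eq_0)
    have "poly.coeff (s * G) (e + d) = (\<Sum>i\<le>e+d. poly.coeff s i * poly.coeff G (e + d - i))"
      by (simp add: coeff_mult)
    also have "\<dots> = poly.coeff s e * poly.coeff G d
                  + (\<Sum>i\<in>{..e+d} - {e}. poly.coeff s i * poly.coeff G (e + d - i))"
      by (subst sum.remove[of _ e]) auto
    also have "poly.coeff G d = 1" using G by (simp add: monics_def)
    finally have eq: "poly.coeff s e = poly.coeff (s * G + k) (e + d) - poly.coeff k (e + d) 
                  - (\<Sum>i\<in>{..e+d} - {e}. poly.coeff s i * poly.coeff G (e + d - i))"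
      by simp
    have "(\<Sum>i\<in>{..e+d} - {e}. poly.coeff s i * poly.coeff G (e + d - i)) \<in> I"
    proof (rule is_ideal_sum[OF I])
      fix i assume "i \<in> {..e+d} - {e}"
      then consider "i > e" | "i < e" by force
      then show "poly.coeff s i * poly.coeff G (e + d - i) \<in> I"
      proof cases
        case 2
        then have "poly.coeff G (e + d - i) = 0" using G by (simp add: monics_def)
        then show ?thesis using is_ideal_0[OF I] by simp
      qed (use hi is_ideal_mult'[OF I] in blast)
    qed
    moreover have "poly.coeff (s * G + k) (e + d) \<in> I" 
      using r is_ideal_0[OF I] by (simp add: below_def del: coeff_add)
    moreover have "poly.coeff k (e + d) \<in> I" using k by (simp add: coeffs_in_def)
    ultimately show ?case unfolding eq using is_ideal_diff[OF I] by blast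
  qed
  then have "poly.coeff s e \<in> I" for e
    using is_ideal_0[OF I] by (cases "e \<le> degree s") (auto simp: coeff_eq_0 dest: le_Suc_ex)
  then show ?thesis by (simp add: coeffs_in_def)
qed

lemma index_below:
  assumes H: "is_ideal H"
  shows "index (below d) (coeffs_in H \<inter> below d) = index UNIV H ^ d"
proof (induction d)
  case 0
  have "coeffs_in H \<inter> below 0 = below 0" using H by (auto simp: coeffs_in_def below_def is_ideal_0)
  then show ?case using index_self[OF add_subgroup_below, of 0] by simp
next
  case (Suc d)
  let ?V = "below (Suc d) :: 'a poly set" 
  \<comment> \<open>Splits off the top coefficient: \<open>?V\<close> over \<open>?E\<close> is one
    copy of the quotient by \<open>H\<close>, and \<open>?E\<close> over \<open>?D\<close> is the
    situation for \<open>d\<close>.\<close>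
  let ?E = "{p \<in> ?V. poly.coeff p d \<in> H}" and ?D = "coeffs_in H \<inter> ?V"
  have sE: "add_subgroup ?E"
    using H by (auto simp: add_subgroup_def is_ideal_closed below_def)
  have sD: "add_subgroup (coeffs_in H \<inter> below e)" for e
    by (intro add_subgroup_Int add_subgroup_ideal is_ideal_coeffs_in H add_subgroup_below)
  have "index ?V ?D = index ?V ?E * index ?E ?D"
    by (rule index_mult[OF add_subgroup_below sD sE]) (auto simp: coeffs_in_def)
  also have "index ?V ?E = index UNIV H"
  proof (rule index_eq_if_additive[OF add_subgroup_below sE _ add_subgroup_ideal[OF H]])
    show "\<exists>v\<in>?V. poly.coeff v d - w \<in> H" for w
      using H by (intro bexI[of _ "monom w d"]) (auto simp: below_def is_ideal_0)
  qed auto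
  also have "index ?E ?D = index (below d) (coeffs_in H \<inter> below d)"
  proof (rule index_eq_if_additive[OF sE sD _ sD, where f = "\<lambda>p. p - monom (poly.coeff p d) d"])
    show "v - monom (poly.coeff v d) d \<in> below d" if "v \<in> ?E" for v
      using that minus_monom_in_below by blast
    show "\<exists>v\<in>?E. v - monom (poly.coeff v d) d - w \<in> coeffs_in H \<inter> below d" if "w \<in> below d" for w
      using that H by (intro bexI[of _ w]) (auto simp: below_def is_ideal_0 coeffs_in_def)
    show "(v - monom (poly.coeff v d) d \<in> coeffs_in H \<inter> below d) = (v \<in> ?D)" if "v \<in> ?E" for v
    proof -
      have *: "monom (poly.coeff v d) d \<in> coeffs_in H" using that H by (auto simp: coeffs_in_def is_ideal_0)
      have "v - monom (poly.coeff v d) d \<in> below d" using that minus_monom_in_below by blast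
      moreover have "v - monom (poly.coeff v d) d \<in> coeffs_in H \<longleftrightarrow> v \<in> coeffs_in H"
        using is_ideal_diff_iff[OF is_ideal_coeffs_in[OF H], of v "v - monom (poly.coeff v d) d"] * by simp
      ultimately show ?thesis using that by auto
    qed
  qed (auto simp: coeffs_in_def algebra_simps simp flip: add_monom diff_monom)
  finally show ?case using Suc.IH by simp
qed

text \<open>Every coset of \<open>K\<close> contains a remainder of division by \<open>G\<close>.
  Thus an index in the whole polynomial ring becomes one between groups of polynomials of bounded
  degree.\<close>

lemma index_ideal_below:
  assumes K: "is_ideal K" and G: "G \<in> K" "G \<in> monics d"
  shows "index UNIV K = index (below d) (K \<inter> below d)"
proof (rule sym, rule index_eq_if_additive[where f = "\<lambda>x. x"])
  show "\<exists>v\<in>below d. v - w \<in> K" for w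
  proof -
    obtain s r where "w = s * G + r" "r \<in> below d" using monic_division[OF G(2)] .
    then have "r \<in> below d" "r - w = (- s) * G" by auto
    then show ?thesis using is_ideal_mult[OF K G(1), of "- s"] by metis
  qed
qed (use K in \<open>auto intro: add_subgroup_Int add_subgroup_below add_subgroup_ideal\<close>)

text \<open>With finitely many cosets, two powers of the variable are congruent modulo
  \<open>K\<close>; the higher power minus the lower one is monic.\<close>

lemma monic_exists:
  assumes K: "is_ideal K" and "index UNIV K > 0"
  shows "\<exists>d. K \<inter> monics d \<noteq> {}"
proof -
  have "finite (range (\<lambda>i. coset_of K (monom 1 i)))"
    using assms(2) by (rule_tac finite_subset[of _ "coset_of K ` UNIV"]) (auto simp: index_def card_gt_0_iff)
  then have "\<not> inj (\<lambda>i::nat. coset_of K (monom 1 i))"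
    by (metis finite_imageD infinite_UNIV_nat)
  then obtain i j where "i \<noteq> j" "coset_of K (monom 1 i) = coset_of K (monom 1 j)"
    by (auto simp: inj_def)
  then have *: "monom 1 i - monom 1 j \<in> K" "monom 1 j - monom 1 i \<in> K" "i \<noteq> j"
    using coset_of_eq_iff[OF add_subgroup_ideal[OF K]] by metis+
  show ?thesis
  proof (cases "i < j")
    case True
    then have "monom 1 j - monom 1 i \<in> K \<inter> monics j" using * by (auto simp: monics_def)
    then show ?thesis by blast
  next
    case False
    then have "monom 1 i - monom 1 j \<in> K \<inter> monics i" using * by (auto simp: monics_def)
    then show ?thesis by blast
  qed
qed

section \<open>Ideals of a principal ring and units of its quotients\<close>

lemma card_eq_sum_fibres:
  assumes "finite A" "finite T" "f ` A \<subseteq> T"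
  shows "card A = (\<Sum>y\<in>T. card {a \<in> A. f a = y})"
  using sum.group[OF assms, of "\<lambda>_. 1::nat"] by simp

lemma add_subgroup_scaled:
  assumes "add_subgroup V" "add_subgroup Z" shows "add_subgroup (scaled a V Z)"
  unfolding add_subgroup_def
proof (intro conjI ballI)
  show "0 \<in> scaled a V Z"
    using scaledI[of 0 V 0 Z a] assms by (simp add: add_subgroup_0)
  fix u v assume "u \<in> scaled a V Z" "v \<in> scaled a V Z"
  then obtain p k p' k' where *: "u = a * p + k" "v = a * p' + k'" "p \<in> V" "k \<in> Z" "p' \<in> V" "k' \<in> Z"
    by (auto simp: scaled_def)
  then have "a * (p - p') + (k - k') \<in> scaled a V Z"
    using assms by (intro scaledI add_subgroup_diff)
  then show "u - v \<in> scaled a V Z" using * by (simp add: algebra_simps)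
qed

text \<open>Multiplication by \<open>a\<close> induces an isomorphism of the two quotients. It is
  injective because \<open>cancel\<close> makes \<open>a\<close> a non-zero-divisor modulo
  \<open>Z\<close> on \<open>V\<close>.\<close>

lemma index_scaled:
  assumes V: "add_subgroup V" and D: "add_subgroup D" and Z: "add_subgroup Z" "Z \<subseteq> D" and DV: "D \<subseteq> V"
    and cancel: "\<And>v. v \<in> V \<Longrightarrow> a * v \<in> Z \<Longrightarrow> v \<in> Z"
  shows "index (scaled a V Z) (scaled a D Z) = index V D"
proof (rule sym, rule index_eq_if_additive[OF V D DV add_subgroup_scaled[OF D Z(1)]])
  show "a * v \<in> scaled a V Z" if "v \<in> V" for v
    using scaledI[OF that add_subgroup_0[OF Z(1)], of a] by simp
  show "\<exists>v\<in>V. a * v - w \<in> scaled a D Z" if "w \<in> scaled a V Z" for w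
  proof -
    from that obtain p k where *: "w = a * p + k" "p \<in> V" "k \<in> Z" by (rule scaledE)
    then have "a * 0 + - k \<in> scaled a D Z"
      using D Z by (intro scaledI add_subgroup_minus add_subgroup_0)
    then show ?thesis using * by (intro bexI[of _ p]) auto
  qed
  show "a * v \<in> scaled a D Z \<longleftrightarrow> v \<in> D" if "v \<in> V" for v
  proof
    assume "a * v \<in> scaled a D Z"
    then obtain p k where *: "a * v = a * p + k" "p \<in> D" "k \<in> Z" by (rule scaledE)
    then have "a * (v - p) \<in> Z" by (simp add: algebra_simps)
    moreover have "v - p \<in> V" using that * DV V by (auto intro: add_subgroup_diff)
    ultimately have "v - p \<in> D" using cancel Z by blast
    from add_subgroup_add[OF D this *(2)] show "v \<in> D" by simp
  next
    assume "v \<in> D"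
    then show "a * v \<in> scaled a D Z" using scaledI[OF _ add_subgroup_0[OF Z(1)], of v D a] by simp
  qed
qed (simp add: algebra_simps)

lemma scaled_generator_cong:
  assumes "is_ideal H" "c - c' \<in> H"
  shows "scaled c UNIV H = scaled c' UNIV H"
proof -
  have "scaled c UNIV H \<subseteq> scaled c' UNIV H" if "c - c' \<in> H" for c c'
  proof
    fix u assume "u \<in> scaled c UNIV H"
    then obtain p k where *: "u = c * p + k" "k \<in> H" by (auto elim: scaledE)
    then have "u = c' * p + (k + p * (c - c'))" by (simp add: algebra_simps)
    moreover have "k + p * (c - c') \<in> H" using * that assms by (intro is_ideal_add is_ideal_mult)
    ultimately show "u \<in> scaled c' UNIV H" by (auto simp: scaled_def)
  qed
  moreover have "c' - c \<in> H" using is_ideal_minus[OF assms] by simp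
  ultimately show ?thesis using assms by blast
qed

text \<open>The ring meant is the quotient by \<open>I0\<close>, a principal domain such as the
  polynomials in \<open>x\<close> over a field with \<open>q\<close> elements; its ideals appear as
  ideals above \<open>I0\<close>. As \<open>card\<close> of an infinite set is 0,
  \<open>index_I0\<close> says that this quotient is infinite, which separates its zero ideal from
  the ideals of index \<open>q ^ m\<close>.\<close>

locale principal_mod =
  fixes I0 :: "'b::comm_ring_1 set" and x :: 'b and q :: nat
  assumes I0: "is_ideal I0"
    and prime: "\<And>a b. a * b \<in> I0 \<Longrightarrow> a \<in> I0 \<or> b \<in> I0"
    and principal: "\<And>H. is_ideal H \<Longrightarrow> I0 \<subseteq> H \<Longrightarrow> \<exists>h. H = scaled h UNIV I0"
    and index_I0: "index UNIV I0 = 0"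
    and index_power: "\<And>H. is_ideal H \<Longrightarrow> I0 \<subset> H \<Longrightarrow> \<exists>m. index UNIV H = q ^ m"
    and q: "q > 1"
    and finite_ideals: "\<And>m. finite {H. is_ideal H \<and> I0 \<subseteq> H \<and> unit_mod H x \<and> index UNIV H = q ^ m}"
begin

definition ideals_of_index :: "nat \<Rightarrow> 'b set set" where
  "ideals_of_index m = {H. is_ideal H \<and> I0 \<subseteq> H \<and> unit_mod H x \<and> index UNIV H = q ^ m}"

definition unit_count :: "nat \<Rightarrow> nat" where
  "unit_count m = (\<Sum>H\<in>ideals_of_index m. num_units_mod H)"

lemma finite_ideals_of_index: "finite (ideals_of_index m)"
  unfolding ideals_of_index_def by (rule finite_ideals)

lemma scaled_I0_eq: "a \<in> I0 \<Longrightarrow> scaled a UNIV I0 = I0"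
  using scaled_superset[of UNIV I0 a] is_ideal_add[OF I0 is_ideal_mult'[OF I0]]
  by (intro equalityI subsetI) (auto elim: scaledE)

lemma generator_notin_I0:
  assumes "scaled h UNIV I0 \<in> ideals_of_index m" shows "h \<notin> I0"
proof
  assume "h \<in> I0"
  then have "index UNIV I0 = q ^ m" using assms by (simp add: scaled_I0_eq ideals_of_index_def)
  then show False using index_I0 q by simp
qed

lemma index_scaled_ideal:
  assumes "h \<notin> I0" "is_ideal H" "I0 \<subseteq> H"
  shows "index UNIV (scaled h H I0) = index UNIV (scaled h UNIV I0) * index UNIV H"
proof -
  have "index UNIV (scaled h H I0) = index UNIV (scaled h UNIV I0) * index (scaled h UNIV I0) (scaled h H I0)"
    using assms I0 by (intro index_mult add_subgroup_ideal is_ideal_scaled) (auto simp: scaled_def)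
  also have "index (scaled h UNIV I0) (scaled h H I0) = index UNIV H"
    using assms prime by (intro index_scaled) (auto simp: add_subgroup_ideal I0)
  finally show ?thesis .
qed

text \<open>Together with \<open>scaled_colon\<close>: multiplication and division by
  \<open>g\<close> modulo \<open>I0\<close> are inverse to each other. Stability under adding
  \<open>I0\<close> is what the ideals above \<open>I0\<close> and their cosets share, and both are
  transported in the count of pairs.\<close>

lemma colon_scaled:
  assumes "g \<notin> I0" and X: "\<And>p k. p \<in> X \<Longrightarrow> k \<in> I0 \<Longrightarrow> p + k \<in> X"
  shows "colon (scaled g X I0) g = X"
proof (intro equalityI subsetI)
  fix p assume "p \<in> colon (scaled g X I0) g"
  then have "g * p \<in> scaled g X I0" by (simp add: colon_def)
  then obtain r k where r: "g * p = g * r + k" "r \<in> X" "k \<in> I0" by (rule scaledE)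
  then have "g * (p - r) \<in> I0" by (simp add: algebra_simps)
  then have "p - r \<in> I0" using prime assms(1) by blast
  from X[OF r(2) this] show "p \<in> X" by simp
next
  fix p assume "p \<in> X"
  then show "p \<in> colon (scaled g X I0) g" using mult_in_scaled[OF I0] by (simp add: colon_def)
qed

lemma scaled_colon:
  assumes "C \<subseteq> scaled g UNIV I0" and C: "\<And>p k. p \<in> C \<Longrightarrow> k \<in> I0 \<Longrightarrow> p + k \<in> C"
  shows "scaled g (colon C g) I0 = C"
proof (intro equalityI subsetI)
  fix p assume "p \<in> scaled g (colon C g) I0"
  then show "p \<in> C" using C by (auto simp: scaled_def colon_def)
next
  fix p assume p: "p \<in> C"
  with assms(1) have "p \<in> scaled g UNIV I0" by blast
  then obtain r k where r: "p = g * r + k" "k \<in> I0" by (auto elim: scaledE)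
  then have "g * r \<in> C" using C[OF p is_ideal_minus[OF I0 r(2)]] by simp
  then show "p \<in> scaled g (colon C g) I0" using r by (auto intro!: scaledI simp: colon_def)
qed

text \<open>Both sides count the pairs of an ideal \<open>H\<close> of index \<open>q ^ m\<close>
  and a coset \<open>C\<close> of it. Each \<open>H\<close> has \<open>q ^ m\<close> cosets. On the
  other hand \<open>H\<close> and \<open>C\<close> generate an ideal with generator
  \<open>g\<close>, a greatest common divisor, of some index \<open>q ^ i\<close>. Dividing by
  \<open>g\<close> gives a pair of index \<open>q ^ (m - i)\<close> whose coset consists of units,
  and each such pair arises exactly once for each of these ideals.\<close>

lemma sum_ideals_unit_count:
  "(\<Sum>i\<le>m. card (ideals_of_index i) * unit_count (m - i)) = q ^ m * card (ideals_of_index m)"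
proof -
  define P where "P = Sigma (ideals_of_index m) (\<lambda>H. range (coset_of H))"
  define A where "A j = Sigma (ideals_of_index j) (\<lambda>H. coset_of H ` {c. unit_mod H c})" for j
  \<comment> \<open>The ideal generated by \<open>H\<close> and \<open>C\<close>. The union over the
    whole coset avoids choosing a representative: all its members coincide.\<close>
  define gens where "gens = (\<lambda>(H, C). \<Union>c\<in>C. scaled c UNIV H :: 'b set)"
  have gens: "gens (H, coset_of H c) = scaled c UNIV H" if "is_ideal H" for H c
  proof -
    have "scaled c' UNIV H = scaled c UNIV H" if "c' \<in> coset_of H c" for c'
      using that \<open>is_ideal H\<close> by (intro scaled_generator_cong) (auto simp: coset_of_def)
    then have "(\<Union>c'\<in>coset_of H c. scaled c' UNIV H) = (\<Union>c'\<in>coset_of H c. scaled c UNIV H)"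
      by (intro SUP_cong) auto
    moreover have "c \<in> coset_of H c" using that by (simp add: self_in_coset_of add_subgroup_ideal)
    ultimately show ?thesis unfolding gens_def prod.case by blast
  qed
  have fin: "finite (range (coset_of H))" and card: "card (range (coset_of H)) = q ^ j"
    if "H \<in> ideals_of_index j" for H j
    using that q by (auto simp: ideals_of_index_def index_def intro!: card_ge_0_finite)
  have finP: "finite P" unfolding P_def using fin finite_ideals_of_index by (intro finite_SigmaI)
  have cardP: "card P = q ^ m * card (ideals_of_index m)"
    unfolding P_def using fin finite_ideals_of_index card by (simp add: card_SigmaI)
  have cardA: "card (A j) = unit_count j" for j
    unfolding A_def unit_count_def num_units_mod_def using finite_ideals_of_index fin
    by (subst card_SigmaI) (auto intro: finite_subset[OF _ fin])
  have image: "gens ` P \<subseteq> (\<Union>i\<le>m. ideals_of_index i)"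
  proof
    fix H2 assume "H2 \<in> gens ` P"
    then obtain H c where H: "H \<in> ideals_of_index m" and H2: "H2 = scaled c UNIV H"
      by (auto simp: P_def gens ideals_of_index_def)
    have HH: "is_ideal H" "I0 \<subseteq> H" "unit_mod H x" "index UNIV H = q ^ m"
      using H by (auto simp: ideals_of_index_def)
    have H2i: "is_ideal H2" "H \<subseteq> H2" "unit_mod H2 x"
      using HH scaled_superset[of UNIV H c] unit_mod_mono by (auto simp: H2 is_ideal_scaled)
    have "I0 \<noteq> H" using HH index_I0 q by auto
    then obtain i where i: "index UNIV H2 = q ^ i" using index_power[OF H2i(1)] HH H2i by blast
    have "q ^ m = q ^ i * index H2 H"
      using index_mult[of UNIV H H2] HH H2i i by (simp add: add_subgroup_ideal)
    then have "i \<le> m" using power_dvd_imp_le[of q i m] q by simp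
    then show "H2 \<in> (\<Union>i\<le>m. ideals_of_index i)"
      using H2i HH i by (auto simp: ideals_of_index_def)
  qed
  have fibre: "card {a \<in> P. gens a = H2} = unit_count (m - i)"
    if i: "i \<le> m" and H2: "H2 \<in> ideals_of_index i" for i H2
  proof -
    have HH2: "is_ideal H2" "I0 \<subseteq> H2" "unit_mod H2 x" "index UNIV H2 = q ^ i"
      using H2 by (auto simp: ideals_of_index_def)
    obtain g where g: "H2 = scaled g UNIV I0" using principal[of H2] HH2 by auto
    have g0: "g \<notin> I0" using generator_notin_I0 H2 g by simp
    have satH: "p + k \<in> H" if "I0 \<subseteq> H" "is_ideal H" "p \<in> H" "k \<in> I0" for H p k
      using that is_ideal_add by blast
    have satC: "p + k \<in> coset_of H c" if "I0 \<subseteq> H" "is_ideal H" "p \<in> coset_of H c" "k \<in> I0" for H p k c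
      using that is_ideal_add[of H "p - c" k] by (auto simp: coset_of_def algebra_simps)
    have "bij_betw (\<lambda>(H, C). (scaled g H I0, scaled g C I0)) (A (m - i)) {a \<in> P. gens a = H2}"
    proof (rule bij_betw_byWitness[where f' = "\<lambda>(H, C). (colon H g, colon C g)"])
      show "\<forall>a\<in>A (m - i). (\<lambda>(H, C). (colon H g, colon C g)) ((\<lambda>(H, C). (scaled g H I0, scaled g C I0)) a) = a"
        using satH satC colon_scaled[OF g0] by (auto simp: A_def ideals_of_index_def)
      have sub: "H \<subseteq> scaled g UNIV I0" "coset_of H c \<subseteq> scaled g UNIV I0" "is_ideal H" "I0 \<subseteq> H"
        if "(H, coset_of H c) \<in> P" "gens (H, coset_of H c) = H2" for H c
      proof -
        show H: "is_ideal H" "I0 \<subseteq> H" using that by (auto simp: P_def ideals_of_index_def)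
        have eq: "scaled c UNIV H = scaled g UNIV I0" using that gens[OF H(1)] g by simp
        show "H \<subseteq> scaled g UNIV I0" using scaled_superset[of UNIV H c] eq by simp
        show "coset_of H c \<subseteq> scaled g UNIV I0"
        proof
          fix p assume "p \<in> coset_of H c"
          then have "c * 1 + (p - c) \<in> scaled c UNIV H" by (intro scaledI) (auto simp: coset_of_def)
          then show "p \<in> scaled g UNIV I0" using eq by simp
        qed
      qed
      show "\<forall>a\<in>{a \<in> P. gens a = H2}. (\<lambda>(H, C). (scaled g H I0, scaled g C I0)) ((\<lambda>(H, C). (colon H g, colon C g)) a) = a"
      proof
        fix a assume a: "a \<in> {a \<in> P. gens a = H2}"
        obtain H C where HC: "a = (H, C)" by (cases a)
        with a have *: "(H, C) \<in> P" "H2 = gens (H, C)" by auto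
        then obtain c where c: "C = coset_of H c" by (auto simp: P_def)
        have "scaled g (colon H g) I0 = H"
          using sub[of H c] * c satH by (intro scaled_colon) auto
        moreover have "scaled g (colon C g) I0 = C"
          unfolding c using sub[of H c] * c satC by (intro scaled_colon) auto
        ultimately show "(\<lambda>(H, C). (scaled g H I0, scaled g C I0)) ((\<lambda>(H, C). (colon H g, colon C g)) a) = a"
          by (simp add: HC)
      qed
      show "(\<lambda>(H, C). (scaled g H I0, scaled g C I0)) ` A (m - i) \<subseteq> {a \<in> P. gens a = H2}"
      proof clarify
        fix H C assume "(H, C) \<in> A (m - i)"
        then obtain c where H: "is_ideal H" "I0 \<subseteq> H" "unit_mod H x" "index UNIV H = q ^ (m - i)"
          and c: "C = coset_of H c" "unit_mod H c"
          by (auto simp: A_def ideals_of_index_def)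
        let ?H = "scaled g H I0"
        have id: "is_ideal ?H" "I0 \<subseteq> ?H"
          using H I0 by (auto simp: is_ideal_scaled scaled_superset[THEN subsetD])
        have "unit_mod ?H x"
          using unit_mod_scaled[OF H(1) _ H(3) id] mult_in_scaled[OF I0] HH2(3) g by blast
        moreover have "index UNIV ?H = q ^ m"
          using index_scaled_ideal[OF g0 H(1,2)] HH2(4) H(4) i by (simp add: g flip: power_add)
        ultimately have mem: "?H \<in> ideals_of_index m" using id by (simp add: ideals_of_index_def)
        have coset: "scaled g C I0 = coset_of ?H (g * c)"
        proof (intro equalityI subsetI)
          fix p assume "p \<in> scaled g C I0"
          then obtain r k where "p = g * r + k" "r - c \<in> H" "k \<in> I0" by (auto simp: c coset_of_def elim: scaledE)
          then have "p - g * c = g * (r - c) + k" "r - c \<in> H" "k \<in> I0" by (auto simp: algebra_simps)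
          then show "p \<in> coset_of ?H (g * c)" using scaledI by (force simp: coset_of_def)
        next
          fix p assume "p \<in> coset_of ?H (g * c)"
          then obtain r k where "p - g * c = g * r + k" "r \<in> H" "k \<in> I0" by (auto simp: coset_of_def elim: scaledE)
          then have "p = g * (r + c) + k" "r + c \<in> C" "k \<in> I0" by (auto simp: algebra_simps c coset_of_def)
          then show "p \<in> scaled g C I0" by (auto intro: scaledI)
        qed
        \<comment> \<open>If \<open>s\<close> inverts \<open>c\<close> modulo \<open>H\<close>, then
          \<open>g * r\<close> differs from \<open>(g * c) * (s * r)\<close> by
          \<open>g * (r * (1 - c * s))\<close>, which lies in \<open>?H\<close>.\<close>
        have "scaled (g * c) UNIV ?H = H2"
        proof (intro equalityI subsetI)
          fix p assume "p \<in> scaled (g * c) UNIV ?H"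
          then obtain r s k where "p = g * c * r + (g * s + k)" "k \<in> I0" by (auto elim!: scaledE)
          then have "p = g * (c * r + s) + k" "k \<in> I0" by (auto simp: algebra_simps)
          then show "p \<in> H2" unfolding g by (auto intro: scaledI)
        next
          fix p assume "p \<in> H2"
          then obtain r k where p: "p = g * r + k" "k \<in> I0" unfolding g by (auto elim: scaledE)
          obtain s where s: "1 - c * s \<in> H" using c by (auto simp: unit_mod_def)
          have "r * (1 - c * s) \<in> H" using s H by (intro is_ideal_mult)
          then have "(g * c) * (s * r) + (g * (r * (1 - c * s)) + k) \<in> scaled (g * c) UNIV ?H"
            using p by (intro scaledI) auto
          then show "p \<in> scaled (g * c) UNIV ?H" using p by (simp add: algebra_simps)
        qed
        then show "(scaled g H I0, scaled g C I0) \<in> P \<and> gens (scaled g H I0, scaled g C I0) = H2"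
          using mem coset gens[OF id(1)] by (auto simp: P_def)
      qed
      show "(\<lambda>(H, C). (colon H g, colon C g)) ` {a \<in> P. gens a = H2} \<subseteq> A (m - i)"
      proof safe
        fix H C assume *: "(H, C) \<in> P" "H2 = gens (H, C)"
        then obtain c where c: "C = coset_of H c" by (auto simp: P_def)
        have H: "is_ideal H" "I0 \<subseteq> H" "unit_mod H x" "index UNIV H = q ^ m"
          using * by (auto simp: P_def ideals_of_index_def)
        note sub = sub[of H c, folded c, OF *(1) *(2)[symmetric]]
        let ?H = "colon H g"
        have id: "is_ideal ?H" "I0 \<subseteq> ?H" "unit_mod ?H x"
          using H colon_superset[of H g] unit_mod_mono by (auto simp: is_ideal_colon)
        have "scaled g ?H I0 = H" using sub satH by (intro scaled_colon) auto
        then have "q ^ m = q ^ i * index UNIV ?H"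
          using index_scaled_ideal[OF g0 id(1,2)] HH2(4) H(4) by (simp add: g)
        also have "q ^ m = q ^ i * q ^ (m - i)" using i by (simp flip: power_add)
        finally have "index UNIV ?H = q ^ (m - i)" using q by simp
        then have mem: "?H \<in> ideals_of_index (m - i)" using id by (simp add: ideals_of_index_def)
        have "c \<in> scaled g UNIV I0" using sub(2) c self_in_coset_of[OF add_subgroup_ideal[OF H(1)], of c] by auto
        then obtain c' k where c': "c = g * c' + k" "k \<in> I0" by (auto elim: scaledE)
        have "g * p - c \<in> H \<longleftrightarrow> g * p - g * c' \<in> H" for p
          using c' H is_ideal_diff_iff[OF H(1), of "g * p - c" "g * p - g * c'"] is_ideal_minus[OF I0 c'(2)]
          by (auto simp: algebra_simps)
        then have coset: "colon C g = coset_of ?H c'"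
          by (auto simp: colon_def coset_of_def c algebra_simps)
        \<comment> \<open>Since \<open>g\<close> lies in the ideal generated by \<open>c\<close> and
          \<open>H\<close>, it equals \<open>c * a + h\<close>. Dividing this equation by
          \<open>g\<close> shows that \<open>a\<close> inverts \<open>c'\<close> modulo
          \<open>colon H g\<close>.\<close>
        have "g * 1 + 0 \<in> H2" unfolding g using I0 by (intro scaledI) (auto simp: is_ideal_0)
        also have "H2 = scaled c UNIV H" using * gens[OF H(1)] c by simp
        finally obtain a h where a: "g = c * a + h" "h \<in> H" by (auto elim: scaledE)
        have "k * a + h \<in> H" using c' a H by (intro is_ideal_add is_ideal_mult') auto
        also have "k * a + h = g * (1 - c' * a)"
          using a(1)[unfolded c'(1)] by (simp add: algebra_simps)
        finally have "unit_mod ?H c'" by (auto simp: unit_mod_def colon_def)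
        then show "(colon H g, colon C g) \<in> A (m - i)" using mem coset by (auto simp: A_def)
      qed
    qed
    from bij_betw_same_card[OF this] show ?thesis by (simp add: cardA)
  qed
  have disj: "ideals_of_index i \<inter> ideals_of_index j = {}" if "i \<noteq> j" for i j
    using that q by (auto simp: ideals_of_index_def)
  have "card P = (\<Sum>H2\<in>(\<Union>i\<le>m. ideals_of_index i). card {a \<in> P. gens a = H2})"
    using finP image finite_ideals_of_index by (intro card_eq_sum_fibres) auto
  also have "\<dots> = (\<Sum>i\<le>m. \<Sum>H2\<in>ideals_of_index i. card {a \<in> P. gens a = H2})"
    using disj finite_ideals_of_index by (intro sum.UNION_disjoint) auto
  also have "\<dots> = (\<Sum>i\<le>m. card (ideals_of_index i) * unit_count (m - i))"
    using fibre by (intro sum.cong) auto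
  finally show ?thesis using cardP by simp
qed

end

section \<open>Ideals of a polynomial ring over a principal ring\<close>

definition top_coeffs :: "'a::comm_ring_1 poly set \<Rightarrow> nat \<Rightarrow> 'a set" where
  "top_coeffs K d = (\<lambda>p. poly.coeff p d) ` (K \<inter> below (Suc d))"

lemma is_ideal_top_coeffs:
  assumes K: "is_ideal K" shows "is_ideal (top_coeffs K d)"
  unfolding is_ideal_def
proof (intro conjI ballI allI)
  show "0 \<in> top_coeffs K d"
    using K unfolding top_coeffs_def by (auto simp: is_ideal_0 below_def image_iff intro!: bexI[of _ 0])
next
  fix a b assume "a \<in> top_coeffs K d" "b \<in> top_coeffs K d"
  then obtain p r where pr: "a = poly.coeff p d" "b = poly.coeff r d" "p \<in> K \<inter> below (Suc d)" "r \<in> K \<inter> below (Suc d)"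
    by (auto simp: top_coeffs_def)
  then have "p + r \<in> K \<inter> below (Suc d)" using K by (auto simp: is_ideal_add below_def)
  then show "a + b \<in> top_coeffs K d" unfolding top_coeffs_def by (rule image_eqI[rotated]) (simp add: pr)
next
  fix r a assume "a \<in> top_coeffs K d"
  then obtain p where p: "a = poly.coeff p d" "p \<in> K \<inter> below (Suc d)"
    by (auto simp: top_coeffs_def)
  then have "[:r:] * p \<in> K \<inter> below (Suc d)" using is_ideal_mult[OF K, of p "[:r:]"] by (auto simp: below_def)
  then show "r * a \<in> top_coeffs K d" unfolding top_coeffs_def by (rule image_eqI[rotated]) (simp add: p)
qed

lemma monic_shift_minus_in_below:
  assumes "G \<in> monics (Suc d)" "p \<in> below (Suc d)"
  shows "[:0, 1:] * p - [:poly.coeff p d:] * G \<in> below (Suc d)"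
  unfolding below_def
proof clarify
  fix i assume i: "Suc d \<le> i"
  then obtain j where j: "i = Suc j" "d \<le> j" by (cases i) auto
  show "poly.coeff ([:0, 1:] * p - [:poly.coeff p d:] * G) i = 0"
    using assms j by (cases "j = d") (auto simp: monics_def below_def)
qed

text \<open>
  Multiplication by the variable modulo the monic \<open>G\<close> moves every coefficient to the top position
  at the expense of multiples of the top coefficient.
\<close>

lemma in_coeffs_in_top_coeffs:
  assumes K: "is_ideal K" and G: "G \<in> K" "G \<in> monics (Suc d)" and p: "p \<in> K" "p \<in> below (Suc d)"
  shows "p \<in> coeffs_in (top_coeffs K d)"
proof -
  note top = is_ideal_top_coeffs[OF K, of d]
  have top0: "poly.coeff p d \<in> top_coeffs K d" if "p \<in> K" "p \<in> below (Suc d)" for p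
    using that by (auto simp: top_coeffs_def)
  have "poly.coeff p (d - j) \<in> top_coeffs K d" if "j \<le> d" for j
    using that p
  proof (induction j arbitrary: p)
    case 0
    then show ?case using top0 by simp
  next
    case (Suc j)
    define p' where "p' = [:0, 1:] * p - [:poly.coeff p d:] * G"
    have "p' \<in> K" unfolding p'_def using K G Suc.prems by (intro is_ideal_diff is_ideal_mult)
    moreover have "p' \<in> below (Suc d)"
      unfolding p'_def using Suc.prems G by (intro monic_shift_minus_in_below)
    ultimately have "poly.coeff p' (d - j) \<in> top_coeffs K d" using Suc.IH Suc.prems(1) by simp
    moreover have "d - j = Suc (d - Suc j)" using Suc.prems by simp
    then have "poly.coeff p (d - Suc j) = poly.coeff p' (d - j) + poly.coeff p d * poly.coeff G (d - j)"
      by (simp add: p'_def)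
    moreover have "poly.coeff p d * poly.coeff G (d - j) \<in> top_coeffs K d"
      using top0[OF Suc.prems(2,3)] by (rule is_ideal_mult'[OF top])
    ultimately show ?case using is_ideal_add[OF top] by simp
  qed
  note * = this
  have "poly.coeff p i \<in> top_coeffs K d" for i
    using p(2) is_ideal_0[OF top] *[of "d - i"] by (cases "i \<le> d") (auto simp: below_def)
  then show ?thesis by (simp add: coeffs_in_def)
qed

section \<open>One step in the degree in y: extending an ideal K\<close>

context principal_mod begin

definition K0 :: "'b poly set" where "K0 = coeffs_in I0"

definition good_ideal :: "'b poly set \<Rightarrow> bool" where
  "good_ideal K \<longleftrightarrow> is_ideal K \<and> K0 \<subseteq> K \<and> unit_mod K [:x:] \<and> unit_mod K [:0, 1:]"

definition good_ideals :: "nat \<Rightarrow> nat \<Rightarrow> 'b poly set set" where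
  "good_ideals n d = {K. good_ideal K \<and> index UNIV K = q ^ n \<and> K \<inter> monics d \<noteq> {}}"

text \<open>From an extension only the ideal \<open>H\<close> can be recovered, while
  \<open>extend\<close> takes an element. Fixing one generator per ideal makes
  \<open>extensions\<close> depend on \<open>H\<close> alone.\<close>

definition gen :: "'b set \<Rightarrow> 'b" where
  "gen H = (SOME h. H = scaled h UNIV I0)"

definition extend :: "'b \<Rightarrow> 'b poly set \<Rightarrow> 'b poly \<Rightarrow> 'b poly set" where
  "extend h K G = scaled G UNIV (scaled [:h:] K K0)"

definition extensions :: "nat \<Rightarrow> 'b set \<Rightarrow> 'b poly set \<Rightarrow> 'b poly set set" where
  "extensions d H K = {extend (gen H) K G | G. G \<in> K \<and> G \<in> monics (Suc d) \<and> unit_mod H (poly.coeff G 0)}"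

lemma gen: "is_ideal H \<Longrightarrow> I0 \<subseteq> H \<Longrightarrow> H = scaled (gen H) UNIV I0"
  unfolding gen_def by (rule someI_ex[OF principal])

lemma is_ideal_K0: "is_ideal K0"
  unfolding K0_def by (rule is_ideal_coeffs_in[OF I0])

lemma good_ideal_mono: "good_ideal K \<Longrightarrow> K \<subseteq> L \<Longrightarrow> is_ideal L \<Longrightarrow> good_ideal L"
  using unit_mod_mono by (auto simp: good_ideal_def)

lemma K0_cancel:
  assumes "h \<notin> I0" "[:h:] * p \<in> K0" shows "p \<in> K0"
proof -
  have "h * poly.coeff p i \<in> I0" for i using assms(2) by (auto simp: K0_def coeffs_in_def)
  then show ?thesis using prime assms(1) by (auto simp: K0_def coeffs_in_def)
qed

lemma coeffs_in_principal: "coeffs_in (scaled h UNIV I0) = scaled [:h:] UNIV K0"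
proof
  show "coeffs_in (scaled h UNIV I0) \<subseteq> scaled [:h:] UNIV K0"
  proof (rule coeffs_in_subset)
    show "is_ideal (scaled [:h:] UNIV K0)" by (intro is_ideal_scaled is_ideal_UNIV is_ideal_K0)
    fix a assume "a \<in> scaled h UNIV I0"
    then obtain r k where "a = h * r + k" "k \<in> I0" by (auto elim: scaledE)
    then have a: "[:a:] = [:h:] * [:r:] + [:k:]" and "[:k:] \<in> K0"
      using I0 by (auto simp: K0_def coeffs_in_def coeff_pCons is_ideal_0 split: nat.splits)
    then show "[:a:] \<in> scaled [:h:] UNIV K0" unfolding a by (intro scaledI UNIV_I)
  qed
  show "scaled [:h:] UNIV K0 \<subseteq> coeffs_in (scaled h UNIV I0)"
    by (force simp: coeffs_in_def K0_def elim!: scaledE intro: scaledI)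
qed

text \<open>Modulo \<open>K0\<close> a multiple of the monic \<open>G\<close> can have degree below
  \<open>e\<close> only if it vanishes, so \<open>s\<close> is in \<open>K0\<close>. The error term
  can then be taken of degree below \<open>e\<close> too, and congruences modulo \<open>K0\<close>
  can be used inside groups of polynomials of bounded degree.\<close>

lemma reduce_in_below:
  assumes G: "G \<in> monics e" and p: "p \<in> below e" "p = s * G + r + k" "r \<in> below e" "k \<in> K0"
  obtains k' where "p = r + k'" "k' \<in> K0" "k' \<in> below e"
proof
  show "p = r + (p - r)" by simp
  show *: "p - r \<in> below e" using add_subgroup_diff[OF add_subgroup_below p(1,3)] .
  have "p - r = s * G + k" using p(2) by simp
  with * have "s * G + k \<in> below e" by simp
  then have "s \<in> K0" unfolding K0_def
    by (rule monic_quotient_coeffs_in[OF I0 G p(4)[unfolded K0_def]])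
  then have "s * G + k \<in> K0" using p(4) is_ideal_K0 by (intro is_ideal_add is_ideal_mult')
  then show "p - r \<in> K0" using p(2) by simp
qed

lemma coeffs_in_principal_below:
  "coeffs_in (scaled h UNIV I0) \<inter> below e = scaled [:h:] (below e) (K0 \<inter> below e)"
proof (intro equalityI subsetI)
  fix p assume p: "p \<in> coeffs_in (scaled h UNIV I0) \<inter> below e"
  then obtain r k where rk: "p = [:h:] * r + k" "k \<in> K0" unfolding coeffs_in_principal by (auto elim: scaledE)
  \<comment> \<open>Cuts off the part of the cofactor \<open>r\<close> in degrees from
    \<open>e\<close> on; since \<open>p\<close> has degree below \<open>e\<close>, that part
    contributes only to \<open>K0\<close>.\<close>
  obtain t r' where r: "r = t * monom 1 e + r'" "r' \<in> below e" using monic_division[OF monom_in_monics] .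
  have "p = ([:h:] * t) * monom 1 e + [:h:] * r' + k" using rk r by (simp add: algebra_simps)
  moreover have "[:h:] * r' \<in> below e" using r by (auto simp: below_def)
  ultimately obtain k' where "p = [:h:] * r' + k'" "k' \<in> K0" "k' \<in> below e"
    using reduce_in_below[OF monom_in_monics, of p e] p rk(2) by blast
  then show "p \<in> scaled [:h:] (below e) (K0 \<inter> below e)" using r by (auto simp: scaled_def)
next
  fix p assume "p \<in> scaled [:h:] (below e) (K0 \<inter> below e)"
  then obtain r k where "p = [:h:] * r + k" "r \<in> below e" "k \<in> K0" "k \<in> below e" by (auto elim: scaledE)
  then show "p \<in> coeffs_in (scaled h UNIV I0) \<inter> below e"
    unfolding coeffs_in_principal by (auto simp: scaled_def below_def)
qed

lemma ideals_of_indexD: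
  assumes "H \<in> ideals_of_index m"
  shows "is_ideal H" "I0 \<subseteq> H" "unit_mod H x" "index UNIV H = q ^ m" "H = scaled (gen H) UNIV I0" "gen H \<notin> I0"
  using assms gen[of H] generator_notin_I0[of "gen H" m] by (auto simp: ideals_of_index_def)

text \<open>The chain passes through the multiples of the generator modulo \<open>K0\<close>: in
  degrees below \<open>e\<close> they have index \<open>(q ^ m) ^ e\<close>, a factor
  \<open>q ^ m\<close> for every coefficient, and multiplication by the generator preserves the
  index of \<open>K\<close>.\<close>

lemma index_below_scaled_ideal:
  assumes H: "H \<in> ideals_of_index m" and K: "is_ideal K" "K0 \<subseteq> K"
  shows "index (below e) (scaled [:gen H:] (K \<inter> below e) (K0 \<inter> below e)) =
    q ^ (m * e) * index (below e) (K \<inter> below e)"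
proof -
  note HD = ideals_of_indexD[OF H]
  have sub: "add_subgroup (K \<inter> below e)" "add_subgroup (K0 \<inter> below e)"
    by (intro add_subgroup_Int add_subgroup_below add_subgroup_ideal is_ideal_K0 K)+
  have "index (below e) (scaled [:gen H:] (K \<inter> below e) (K0 \<inter> below e)) =
    index (below e) (scaled [:gen H:] (below e) (K0 \<inter> below e)) *
    index (scaled [:gen H:] (below e) (K0 \<inter> below e)) (scaled [:gen H:] (K \<inter> below e) (K0 \<inter> below e))"
    by (intro index_mult add_subgroup_below add_subgroup_scaled sub) (auto simp: scaled_def below_def)
  also have "index (below e) (scaled [:gen H:] (below e) (K0 \<inter> below e)) = (q ^ m) ^ e"
    unfolding coeffs_in_principal_below[symmetric] HD(5)[symmetric] index_below[OF HD(1)] HD(4) ..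
  also have "index (scaled [:gen H:] (below e) (K0 \<inter> below e)) (scaled [:gen H:] (K \<inter> below e) (K0 \<inter> below e)) =
             index (below e) (K \<inter> below e)"
    using K(2) K0_cancel[OF HD(6)] by (intro index_scaled add_subgroup_below sub) auto
  finally show ?thesis by (simp add: power_mult)
qed

lemma good_idealsD:
  assumes "K \<in> good_ideals n d"
  shows "is_ideal K" "K0 \<subseteq> K" "good_ideal K" "index UNIV K = q ^ n" "K \<inter> monics d \<noteq> {}"
  using assms by (auto simp: good_ideals_def good_ideal_def)

end

locale ideal_extension = principal_mod I0 x q for I0 :: "'b::comm_ring_1 set" and x q +
  fixes m n d :: nat and H :: "'b set" and K :: "'b poly set" and h :: 'b
  assumes H: "H \<in> ideals_of_index m" and K: "K \<in> good_ideals n d"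
  defines "h \<equiv> gen H"
begin

lemmas HD = ideals_of_indexD[OF H, folded h_def]
lemmas KD = good_idealsD[OF K]

lemma add_subgroup_parts:
  "add_subgroup (K \<inter> below e)" "add_subgroup (K0 \<inter> below e)"
  "add_subgroup (scaled [:h:] (K \<inter> below e) (K0 \<inter> below e))"
  "add_subgroup (scaled [:h:] (below e) (K0 \<inter> below e))"
  by (intro add_subgroup_scaled add_subgroup_Int add_subgroup_below add_subgroup_ideal is_ideal_K0 KD(1))+

lemma is_ideal_extend: "is_ideal (extend h K G)"
  unfolding extend_def by (intro is_ideal_scaled is_ideal_UNIV KD(1) is_ideal_K0)

lemma extendI: "G * s + ([:h:] * p + k) \<in> extend h K G" if "p \<in> K" "k \<in> K0"
  unfolding extend_def using that by (intro scaledI) auto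

lemma extend_members: "G \<in> extend h K G" "k \<in> K0 \<Longrightarrow> k \<in> extend h K G" "p \<in> K \<Longrightarrow> [:h:] * p \<in> extend h K G"
  using extendI[of 0 0 G 1] extendI[of 0 k G 0] extendI[of p 0 G 0] is_ideal_0[OF KD(1)] is_ideal_0[OF is_ideal_K0]
  by auto

lemma monic_member_below:
  assumes "G \<in> K" "G \<in> monics e" "p \<in> K" obtains t r where "p = t * G + r" "r \<in> K" "r \<in> below e"
proof -
  obtain t r where tr: "p = t * G + r" "r \<in> below e" using monic_division[OF assms(2)] .
  have "p - t * G \<in> K" using assms KD(1) by (intro is_ideal_diff is_ideal_mult)
  then show ?thesis using tr that by auto
qed

text \<open>The right-hand side does not mention \<open>G\<close>, so all extensions share their
  part of degree below \<open>e\<close>. Multiples of \<open>G\<close> drop out because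
  \<open>G\<close> is monic, once the cofactor of \<open>h\<close> has been reduced modulo
  \<open>G\<close>. As \<open>G\<close> lies in \<open>K\<close>, this reduction stays inside
  \<open>K\<close>.\<close>

lemma extend_below:
  assumes G: "G \<in> K" "G \<in> monics e"
  shows "extend h K G \<inter> below e = scaled [:h:] (K \<inter> below e) (K0 \<inter> below e)"
proof (intro equalityI subsetI)
  fix p assume p: "p \<in> extend h K G \<inter> below e"
  then obtain s j k where *: "p = G * s + ([:h:] * j + k)" "j \<in> K" "k \<in> K0"
    unfolding extend_def by (auto elim!: scaledE)
  obtain t r where r: "j = t * G + r" "r \<in> K" "r \<in> below e" using monic_member_below[OF G *(2)] .
  have "p = (s + [:h:] * t) * G + [:h:] * r + k" using *(1) r(1) by (simp add: algebra_simps)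
  moreover have "[:h:] * r \<in> below e" using r by (auto simp: below_def)
  ultimately obtain k' where "p = [:h:] * r + k'" "k' \<in> K0" "k' \<in> below e"
    using reduce_in_below[OF G(2), of p] p *(3) by blast
  then show "p \<in> scaled [:h:] (K \<inter> below e) (K0 \<inter> below e)" using r by (auto simp: scaled_def)
next
  fix p assume "p \<in> scaled [:h:] (K \<inter> below e) (K0 \<inter> below e)"
  then obtain r k where *: "p = [:h:] * r + k" "r \<in> K" "r \<in> below e" "k \<in> K0" "k \<in> below e" by (auto elim: scaledE)
  then have "p \<in> extend h K G" using is_ideal_add[OF is_ideal_extend] extend_members(2,3) by simp
  then show "p \<in> extend h K G \<inter> below e" using * by (auto simp: below_def)
qed

lemma monic_d: obtains g where "g \<in> K" "g \<in> monics d"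
  using KD(5) by auto

text \<open>Recovers \<open>H\<close> from the extension. To reach \<open>h * r\<close> as a top
  coefficient, multiply a monic element of \<open>K\<close> of degree \<open>d\<close> by
  it.\<close>

lemma top_coeffs_extend:
  assumes G: "G \<in> K" "G \<in> monics (Suc d)"
  shows "top_coeffs (extend h K G) d = H"
proof (intro equalityI subsetI)
  fix a assume "a \<in> top_coeffs (extend h K G) d"
  then obtain r k where "a = h * poly.coeff r d + poly.coeff k d" "k \<in> K0"
    unfolding top_coeffs_def extend_below[OF G] by (auto elim!: scaledE)
  then show "a \<in> H" unfolding HD(5) by (auto intro: scaledI simp: K0_def coeffs_in_def)
next
  fix a assume "a \<in> H"
  then obtain r k where a: "a = h * r + k" "k \<in> I0" unfolding HD(5) by (auto elim: scaledE)
  obtain g where g: "g \<in> K" "g \<in> monics d" using monic_d .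
  have "[:r:] * g \<in> K \<inter> below (Suc d)"
    using g is_ideal_mult[OF KD(1) g(1), of "[:r:]"] by (auto simp: below_def monics_def)
  moreover have "monom k d \<in> K0 \<inter> below (Suc d)"
    using a I0 by (auto simp: K0_def coeffs_in_def below_def is_ideal_0)
  ultimately have "[:h:] * ([:r:] * g) + monom k d \<in> extend h K G \<inter> below (Suc d)"
    unfolding extend_below[OF G] by (rule scaledI)
  then show "a \<in> top_coeffs (extend h K G) d"
    unfolding top_coeffs_def using g a by (intro image_eqI) (auto simp: monics_def)
qed

text \<open>Recovers \<open>K\<close> from the extension. Reduction modulo \<open>G\<close> leads to
  degrees below \<open>e\<close>, where the elements of the extension are \<open>h\<close> times
  elements of \<open>K\<close> up to \<open>K0\<close>, and \<open>h\<close> can be cancelled modulo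
  \<open>K0\<close>.\<close>

lemma colon_extend:
  assumes G: "G \<in> K" "G \<in> monics e"
  shows "colon (extend h K G) [:h:] = K"
proof (intro equalityI subsetI)
  fix p assume "p \<in> colon (extend h K G) [:h:]"
  then have p: "[:h:] * p \<in> extend h K G" by (simp add: colon_def)
  obtain t r where r: "p = t * G + r" "r \<in> below e" using monic_division[OF G(2)] .
  have "[:h:] * p - ([:h:] * t) * G \<in> extend h K G"
    using is_ideal_diff[OF is_ideal_extend p is_ideal_mult[OF is_ideal_extend extend_members(1)]] .
  then have "[:h:] * r \<in> extend h K G \<inter> below e" using r by (auto simp: algebra_simps below_def)
  then obtain j k where jk: "[:h:] * r = [:h:] * j + k" "j \<in> K" "k \<in> K0"
    unfolding extend_below[OF G] by (auto elim: scaledE)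
  then have "[:h:] * (r - j) \<in> K0" unfolding right_diff_distrib by simp
  then have "r - j \<in> K" using K0_cancel HD(6) KD(2) by blast
  then have "r - j + j \<in> K" using jk(2) by (rule is_ideal_add[OF KD(1)])
  then show "p \<in> K" using r G KD(1) by (auto intro: is_ideal_add is_ideal_mult)
next
  fix p assume "p \<in> K"
  then show "p \<in> colon (extend h K G) [:h:]" by (simp only: colon_def mem_Collect_eq extend_members)
qed

lemma index_below_scaled:
  assumes G: "G \<in> K" "G \<in> monics e"
  shows "index (below e) (scaled [:h:] (K \<inter> below e) (K0 \<inter> below e)) = q ^ (m * e) * q ^ n"
  using index_below_scaled_ideal[OF H KD(1,2), of e] index_ideal_below[OF KD(1) G] KD(4) by (simp add: h_def)

lemma index_extend:
  assumes G: "G \<in> K" "G \<in> monics e"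
  shows "index UNIV (extend h K G) = q ^ (m * e + n)"
  using index_ideal_below[OF is_ideal_extend extend_members(1) G(2)] index_below_scaled[OF G] extend_below[OF G]
  by (simp add: power_add)

lemma good_ideal_extend:
  assumes u: "unit_mod H (poly.coeff G 0)"
  shows "good_ideal (extend h K G)"
proof -
  have sub: "scaled G UNIV K0 \<subseteq> extend h K G"
    using is_ideal_add[OF is_ideal_extend is_ideal_mult'[OF is_ideal_extend extend_members(1)] extend_members(2)]
    by (auto simp: scaled_def)
  obtain s where s: "1 - x * s \<in> H" using HD(3) by (auto simp: unit_mod_def)
  then have "1 - [:x:] * [:s:] \<in> coeffs_in H"
    using is_ideal_0[OF HD(1)] by (auto simp: coeffs_in_def coeff_pCons one_pCons mult.commute split: nat.splits)
  then have "unit_mod (scaled [:h:] UNIV K0) [:x:]"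
    unfolding unit_mod_def coeffs_in_principal[symmetric] HD(5)[symmetric] by blast
  then have x: "unit_mod (extend h K G) [:x:]"
    using KD(3) extend_members by (intro unit_mod_scaled[OF KD(1) _ _ is_ideal_extend]) (auto simp: good_ideal_def)
  obtain c where "1 - poly.coeff G 0 * c \<in> H" using u by (auto simp: unit_mod_def)
  then obtain b k where b: "1 - poly.coeff G 0 * c = h * b + k" "k \<in> I0" unfolding HD(5) by (auto elim: scaledE)
  obtain g0 g1 where G: "G = pCons g0 g1" by (cases G)
  \<comment> \<open>\<open>G\<close> is its constant term plus the variable times \<open>g1\<close>.
    As \<open>c\<close> inverts the constant term modulo \<open>H\<close>, the polynomial
    \<open>- (g1 * [:c:])\<close> inverts the variable modulo \<open>h\<close>, \<open>G\<close> and
    \<open>K0\<close>.\<close>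
  have "1 - [:0, 1:] * - (g1 * [:c:]) = [:h:] * [:b:] + (G * [:c:] + [:k:])"
    using b by (simp add: G one_pCons algebra_simps)
  moreover have "[:k:] \<in> K0" using b I0 by (auto simp: K0_def coeffs_in_def coeff_pCons is_ideal_0 split: nat.splits)
  ultimately have "1 - [:0, 1:] * - (g1 * [:c:]) \<in> scaled [:h:] UNIV (scaled G UNIV K0)"
    by (auto simp only: scaledI UNIV_I)
  then have "unit_mod (scaled [:h:] UNIV (scaled G UNIV K0)) [:0, 1:]" unfolding unit_mod_def by blast
  then have y: "unit_mod (extend h K G) [:0, 1:]"
    using KD(3) extend_members sub by (intro unit_mod_scaled[OF KD(1) _ _ is_ideal_extend]) (auto simp: good_ideal_def)
  show ?thesis using x y is_ideal_extend extend_members by (auto simp: good_ideal_def)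
qed

lemma extensions_eq:
  "extensions d H K = {extend h K G | G. G \<in> K \<and> G \<in> monics (Suc d) \<and> unit_mod H (poly.coeff G 0)}"
  by (simp add: extensions_def h_def)

lemma extensions_subset: "extensions d H K \<subseteq> good_ideals (m * Suc d + n) (Suc d)"
  using good_ideal_extend index_extend[of _ "Suc d"] extend_members(1)
  by (auto simp: extensions_eq good_ideals_def)

lemma extension_data: "L \<in> extensions d H K \<Longrightarrow> top_coeffs L d = H" "L \<in> extensions d H K \<Longrightarrow> colon L [:h:] = K"
  using top_coeffs_extend colon_extend by (auto simp: extensions_eq)

lemma extend_eqI:
  assumes "G \<in> extend h K G'" "G' \<in> extend h K G" shows "extend h K G = extend h K G'"
proof -
  have "extend h K G \<subseteq> extend h K G'" if "G \<in> extend h K G'" for G G'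
  proof
    fix p assume "p \<in> extend h K G"
    then obtain s j k where "p = G * s + ([:h:] * j + k)" "j \<in> K" "k \<in> K0"
      unfolding extend_def by (auto elim!: scaledE)
    then show "p \<in> extend h K G'"
      using is_ideal_add[OF is_ideal_extend is_ideal_mult'[OF is_ideal_extend that]
        is_ideal_add[OF is_ideal_extend extend_members(3) extend_members(2)]] by simp
  qed
  then show ?thesis using assms by blast
qed

text \<open>An extension is determined by its set of monic elements, which is a coset.\<close>

lemma card_extensions: "finite (extensions d H K)" "card (extensions d H K) = num_units_mod H * q ^ (m * d)"
proof -
  let ?V = "below (Suc d) :: 'b poly set"
  let ?D = "scaled [:h:] (K \<inter> ?V) (K0 \<inter> ?V)"
  define Gs where "Gs = {G. G \<in> K \<and> G \<in> monics (Suc d) \<and> unit_mod H (poly.coeff G 0)}"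
  have D: "add_subgroup ?D" "?D \<subseteq> ?V"
    by (rule add_subgroup_parts) (auto simp: scaled_def below_def)
  have DK: "?D \<subseteq> K \<inter> ?V"
  proof
    fix p assume "p \<in> ?D"
    then obtain r k where "p = [:h:] * r + k" "r \<in> K" "k \<in> K0" by (auto elim: scaledE)
    then have "p \<in> K" using KD(1,2) by (auto simp only: intro: is_ideal_add is_ideal_mult)
    then show "p \<in> K \<inter> ?V" using D(2) \<open>p \<in> ?D\<close> by auto
  qed
  \<comment> \<open>Two monic elements of degree \<open>d + 1\<close> in one extension differ by an
    element of degree at most \<open>d\<close>, and such elements form \<open>?D\<close>.\<close>
  have mon: "extend h K G \<inter> monics (Suc d) = coset_of ?D G" if "G \<in> Gs" for G
  proof -
    have G: "G \<in> K" "G \<in> monics (Suc d)" using that by (auto simp: Gs_def)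
    have "w \<in> extend h K G \<and> w \<in> monics (Suc d) \<longleftrightarrow> w - G \<in> extend h K G \<and> w - G \<in> ?V" for w
      using is_ideal_diff[OF is_ideal_extend _ extend_members(1)[of G], of w]
        is_ideal_add[OF is_ideal_extend _ extend_members(1)[of G], of "w - G"]
        monics_diff[OF _ G(2), of w] monics_add[OF G(2), of "w - G"] by auto
    then show ?thesis unfolding coset_of_def extend_below[OF G, symmetric] by blast
  qed
  have "bij_betw (\<lambda>L. L \<inter> monics (Suc d)) (extensions d H K) (coset_of ?D ` Gs)"
    unfolding bij_betw_def
  proof
    have ext: "extensions d H K = extend h K ` Gs" by (auto simp: extensions_eq Gs_def)
    show "(\<lambda>L. L \<inter> monics (Suc d)) ` extensions d H K = coset_of ?D ` Gs"
      using mon by (force simp: ext image_image)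
    show "inj_on (\<lambda>L. L \<inter> monics (Suc d)) (extensions d H K)"
    proof (rule inj_onI)
      fix L L' assume "L \<in> extensions d H K" "L' \<in> extensions d H K" and eq: "L \<inter> monics (Suc d) = L' \<inter> monics (Suc d)"
      then obtain G G' where G: "G \<in> Gs" "G' \<in> Gs" "L = extend h K G" "L' = extend h K G'"
        unfolding ext by auto
      have "G \<in> L \<inter> monics (Suc d)" "G' \<in> L' \<inter> monics (Suc d)"
        using G extend_members(1) by (auto simp: Gs_def)
      then show "L = L'" using eq G extend_eqI by auto
    qed
  qed
  then have card1: "card (extensions d H K) = card (coset_of ?D ` Gs)" "finite (extensions d H K) \<longleftrightarrow> finite (coset_of ?D ` Gs)"
    by (auto simp: bij_betw_same_card bij_betw_finite)
  obtain g where g: "g \<in> K" "g \<in> monics d" using monic_d .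
  \<comment> \<open>A monic element of \<open>K\<close> with constant term 0: neither adding it nor
    reducing modulo it changes constant terms.\<close>
  define G0 where "G0 = [:0, 1:] * g"
  have G0: "G0 \<in> K" "G0 \<in> monics (Suc d)" "poly.coeff G0 0 = 0"
    unfolding G0_def using is_ideal_mult[OF KD(1) g(1)] monics_shift[OF g(2)] by (blast, blast, simp)
  define T where "T = {t. unit_mod H t}"
  \<comment> \<open>If \<open>s\<close> inverts the variable modulo \<open>K\<close>, then
    \<open>[:t:] * (1 - [:0, 1:] * s)\<close> is an element of \<open>K\<close> with constant term
    \<open>t\<close>; reduction modulo \<open>G0\<close> bounds its degree.\<close>
  have surj: "\<exists>v\<in>K \<inter> ?V. poly.coeff v 0 - t \<in> H" for t
  proof -
    obtain s where "1 - [:0, 1:] * s \<in> K" using KD(3) by (auto simp: good_ideal_def unit_mod_def)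
    then have "[:t:] * (1 - [:0, 1:] * s) \<in> K" by (rule is_ideal_mult[OF KD(1)])
    then obtain a r where r: "[:t:] * (1 - [:0, 1:] * s) = a * G0 + r" "r \<in> K" "r \<in> ?V"
      using monic_member_below[OF G0(1,2)] by blast
    from arg_cong[OF r(1), of "\<lambda>p. poly.coeff p 0"] have "poly.coeff r 0 = t"
      using G0(3) by (simp add: coeff_mult)
    then show ?thesis using r is_ideal_0[OF HD(1)] by (intro bexI[of _ r]) auto
  qed
  have DH: "poly.coeff p 0 \<in> H" if "p \<in> ?D" for p
  proof -
    from that obtain r k where "p = [:h:] * r + k" "k \<in> K0" by (auto elim: scaledE)
    then show ?thesis unfolding HD(5) by (auto simp: K0_def coeffs_in_def intro: scaledI)
  qed
  have count: "card (coset_of ?D ` {v \<in> K \<inter> ?V. \<exists>t\<in>S. poly.coeff v 0 - t \<in> H}) =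
      card (coset_of H ` S) * card (coset_of ?D ` {v \<in> K \<inter> ?V. poly.coeff v 0 \<in> H})" for S
    using surj DH DK by (intro card_cosets_vimage add_subgroup_parts add_subgroup_ideal HD(1)) auto
  have "q ^ (m * Suc d) * q ^ n = index ?V (K \<inter> ?V) * index (K \<inter> ?V) ?D"
    using index_below_scaled[OF G0(1,2)] index_mult[OF add_subgroup_below D(1) add_subgroup_parts(1) DK] by auto
  also have "index ?V (K \<inter> ?V) = q ^ n" using index_ideal_below[OF KD(1) G0(1,2)] KD(4) by simp
  finally have idx: "index (K \<inter> ?V) ?D = q ^ (m * Suc d)" using q by simp
  \<comment> \<open>Admitting all residues counts the whole quotient of \<open>K \<inter> ?V\<close>
    by \<open>?D\<close>, of size \<open>q ^ (m * Suc d)\<close>. Hence each of the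
    \<open>q ^ m\<close> residues of the constant term is taken \<open>q ^ (m * d)\<close>
    times.\<close>
  have "\<exists>t. poly.coeff v 0 - t \<in> H" for v :: "'b poly"
    using is_ideal_0[OF HD(1)] by (intro exI[of _ "poly.coeff v 0"]) simp
  then have "{v \<in> K \<inter> ?V. \<exists>t\<in>UNIV. poly.coeff v 0 - t \<in> H} = K \<inter> ?V"
    by auto
  with count[of UNIV] idx have "q ^ (m * Suc d) = q ^ m * card (coset_of ?D ` {v \<in> K \<inter> ?V. poly.coeff v 0 \<in> H})"
    using HD(4) by (simp add: index_def)
  then have ker: "card (coset_of ?D ` {v \<in> K \<inter> ?V. poly.coeff v 0 \<in> H}) = q ^ (m * d)"
    using q by (simp add: power_add)
  have unit: "unit_mod H (poly.coeff v 0) \<longleftrightarrow> (\<exists>t\<in>T. poly.coeff v 0 - t \<in> H)" for v :: "'b poly"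
    using unit_mod_cong[OF HD(1)] is_ideal_minus[OF HD(1)] is_ideal_0[OF HD(1)]
    unfolding T_def by (metis diff_self mem_Collect_eq minus_diff_eq)
  have Gs: "Gs = (+) G0 ` {v \<in> K \<inter> ?V. \<exists>t\<in>T. poly.coeff v 0 - t \<in> H}"
  proof (intro equalityI subsetI)
    fix G assume "G \<in> Gs"
    then have G: "G \<in> K" "G \<in> monics (Suc d)" "unit_mod H (poly.coeff G 0)" by (auto simp: Gs_def)
    then have "G - G0 \<in> K \<inter> ?V" "unit_mod H (poly.coeff (G - G0) 0)"
      using is_ideal_diff[OF KD(1) G(1) G0(1)] monics_diff[OF G(2) G0(2)] G0 by auto
    then have "G - G0 \<in> {v \<in> K \<inter> ?V. \<exists>t\<in>T. poly.coeff v 0 - t \<in> H}" using unit by blast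
    then show "G \<in> (+) G0 ` {v \<in> K \<inter> ?V. \<exists>t\<in>T. poly.coeff v 0 - t \<in> H}"
      by (intro image_eqI[of _ _ "G - G0"]) auto
  next
    fix G assume "G \<in> (+) G0 ` {v \<in> K \<inter> ?V. \<exists>t\<in>T. poly.coeff v 0 - t \<in> H}"
    then obtain v where v: "G = G0 + v" "v \<in> K" "v \<in> ?V" "unit_mod H (poly.coeff v 0)" using unit by blast
    then show "G \<in> Gs"
      using is_ideal_add[OF KD(1) G0(1) v(2)] monics_add[OF G0(2) v(3)] G0(3) by (simp add: Gs_def)
  qed
  have "card (coset_of ?D ` Gs) = card (coset_of ?D ` {v \<in> K \<inter> ?V. \<exists>t\<in>T. poly.coeff v 0 - t \<in> H})"
    unfolding Gs by (rule card_cosets_shift)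
  also have "\<dots> = num_units_mod H * q ^ (m * d)"
    unfolding count ker num_units_mod_def T_def ..
  finally show "card (extensions d H K) = num_units_mod H * q ^ (m * d)" using card1 by simp
  have "finite (coset_of ?D ` (K \<inter> ?V))" using idx q by (intro card_ge_0_finite) (simp add: index_def)
  then have "finite (coset_of ?D ` Gs)"
    unfolding Gs finite_cosets_shift by (rule rev_finite_subset) auto
  then show "finite (extensions d H K)" using card1 by simp
qed

end

lemma index_UNIV_eq_1:
  assumes "add_subgroup H" "index UNIV H = 1" shows "H = UNIV"
proof -
  obtain C where "range (coset_of H) = {C}" using assms(2) by (auto simp: index_def card_1_singleton_iff)
  then have "coset_of H v = coset_of H 0" for v by (metis rangeI singletonD)
  then show ?thesis using coset_of_eq_iff[OF assms(1), of _ 0] by auto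
qed

section \<open>Every ideal with a monic element is an extension; the resulting count\<close>

context principal_mod begin

text \<open>The converse of the construction: \<open>H\<close> and \<open>K\<close> are read off
  from \<open>L\<close>, and any monic element of \<open>L\<close> of degree \<open>d + 1\<close>
  serves as \<open>G\<close>. The core is the fact \<open>inV\<close>: elements of \<open>L\<close>
  of degree at most \<open>d\<close> are \<open>h\<close> times elements of \<open>K\<close> up to
  \<open>K0\<close>.\<close>

lemma decompose:
  assumes L: "L \<in> good_ideals N (Suc d)"
  defines "H \<equiv> top_coeffs L d"
  defines "K \<equiv> colon L [:gen H:]"
  obtains m where "m * Suc d \<le> N" "H \<in> ideals_of_index m" "K \<in> good_ideals (N - m * Suc d) d"
    "L \<in> extensions d H K"
proof -
  note LD = good_idealsD[OF L]
  obtain G where G: "G \<in> L" "G \<in> monics (Suc d)" using LD(5) by auto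
  let ?V = "below (Suc d) :: 'b poly set"
  have H: "is_ideal H" unfolding H_def by (rule is_ideal_top_coeffs[OF LD(1)])
  have "a \<in> H" if "a \<in> I0" for a
  proof -
    have "monom a d \<in> L \<inter> ?V"
      using that LD(2) I0 by (auto simp: K0_def coeffs_in_def below_def is_ideal_0)
    then show ?thesis unfolding H_def top_coeffs_def by (rule rev_image_eqI) simp
  qed
  then have I0H: "I0 \<subseteq> H" by blast
  have coeffs: "p \<in> coeffs_in H" if "p \<in> L" "p \<in> ?V" for p
    unfolding H_def by (rule in_coeffs_in_top_coeffs[OF LD(1) G that])
  have topI: "poly.coeff p d \<in> H" if "p \<in> L" "p \<in> ?V" for p
    using that by (auto simp: H_def top_coeffs_def)
  \<comment> \<open>Otherwise the elements of \<open>L\<close> of degree at most \<open>d\<close>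
    would all vanish modulo \<open>I0\<close>, and the index of \<open>L\<close> would be
    infinite.\<close>
  have "H \<noteq> I0"
  proof
    assume "H = I0"
    then have "L \<inter> ?V = coeffs_in I0 \<inter> ?V" using coeffs LD(2) by (auto simp: K0_def)
    then have "index UNIV L = index UNIV I0 ^ Suc d"
      using index_ideal_below[OF LD(1) G] index_below[OF I0] by metis
    then show False using index_I0 LD(4) q by simp
  qed
  then obtain m where m: "index UNIV H = q ^ m" using index_power[OF H] I0H by blast
  \<comment> \<open>Multiply 1 - x s, an element of \<open>L\<close>, by y^d and reduce modulo
    \<open>G\<close>. The result has degree at most \<open>d\<close>, so its top coefficient, 1
    minus \<open>x\<close> times that of \<open>r\<close>, belongs to \<open>H\<close>.\<close>
  have "unit_mod H x"
  proof -
    obtain s where "1 - [:x:] * s \<in> L" using LD(3) by (auto simp: good_ideal_def unit_mod_def)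
    then have 1: "monom 1 d * (1 - [:x:] * s) \<in> L" by (rule is_ideal_mult[OF LD(1)])
    obtain t r where r: "monom 1 d * s = t * G + r" "r \<in> ?V" using monic_division[OF G(2)] .
    have "monom 1 d * (1 - [:x:] * s) + ([:x:] * t) * G \<in> L"
      by (rule is_ideal_add[OF LD(1) 1 is_ideal_mult[OF LD(1) G(1)]])
    also have "monom 1 d * (1 - [:x:] * s) + ([:x:] * t) * G = monom 1 d - [:x:] * (monom 1 d * s - t * G)"
      by (simp add: algebra_simps)
    also have "monom 1 d * s - t * G = r" using r(1) by simp
    finally have "monom 1 d - [:x:] * r \<in> L" .
    moreover have "monom 1 d - [:x:] * r \<in> ?V" using r(2) by (auto simp: below_def)
    ultimately have "poly.coeff (monom 1 d - [:x:] * r) d \<in> H" by (rule topI)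
    then show ?thesis by (auto simp: unit_mod_def)
  qed
  then have Hm: "H \<in> ideals_of_index m" using H I0H m by (auto simp: ideals_of_index_def)
  define h where "h = gen H"
  have h: "H = scaled h UNIV I0" "h \<notin> I0" using ideals_of_indexD[OF Hm] by (auto simp: h_def)
  have K_def: "K = colon L [:h:]" by (simp add: K_def h_def)
  have KL: "is_ideal K" "L \<subseteq> K" "good_ideal K"
    using LD is_ideal_colon colon_superset[OF LD(1)] good_ideal_mono[of L K] by (auto simp: K_def)
  have inV: "\<exists>r k. p = [:h:] * r + k \<and> r \<in> K \<and> r \<in> ?V \<and> k \<in> K0" if p: "p \<in> L" "p \<in> ?V" for p
  proof -
    have "p \<in> coeffs_in (scaled h UNIV I0) \<inter> ?V" using coeffs[OF p] p h(1) by auto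
    then obtain r k where rk: "p = [:h:] * r + k" "r \<in> ?V" "k \<in> K0"
      unfolding coeffs_in_principal_below by (auto elim: scaledE)
    have "p - k \<in> L" using LD(1) p(1) subsetD[OF LD(2) rk(3)] by (rule is_ideal_diff)
    then have "r \<in> K" using rk(1) by (simp add: K_def colon_def)
    then show ?thesis using rk by blast
  qed
  have "h * 1 + 0 \<in> H" unfolding h(1) using is_ideal_0[OF I0] by (intro scaledI UNIV_I)
  then obtain g where g: "g \<in> L" "g \<in> ?V" "poly.coeff g d = h" by (auto simp: H_def top_coeffs_def)
  then obtain r k where rk: "g = [:h:] * r + k" "r \<in> K" "r \<in> ?V" "k \<in> K0" using inV by blast
  \<comment> \<open>The element \<open>g\<close> has top coefficient \<open>h\<close> and equals
    \<open>h\<close> times \<open>r\<close> up to \<open>K0\<close>, so \<open>r\<close> has top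
    coefficient 1 up to an error \<open>e\<close> in \<open>I0\<close>. Removing this error yields a
    monic element of \<open>K\<close> of degree \<open>d\<close>.\<close>
  define e where "e = poly.coeff r d - 1"
  have "h * e = - poly.coeff k d" using g(3) rk(1) by (simp add: e_def algebra_simps)
  moreover have "- poly.coeff k d \<in> I0" using rk(4) I0 by (auto simp: K0_def coeffs_in_def is_ideal_minus)
  ultimately have "e \<in> I0" using prime h(2) by metis
  then have "monom e d \<in> K0" using I0 by (auto simp: K0_def coeffs_in_def is_ideal_0)
  then have "r - monom e d \<in> K" using KL(3) by (intro is_ideal_diff[OF KL(1) rk(2)]) (auto simp: good_ideal_def)
  moreover have "r - monom e d \<in> monics d" using rk(3) by (auto simp: monics_def below_def e_def)
  ultimately have Kd: "K \<inter> monics d \<noteq> {}" by blast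
  have hp: "[:h:] * p \<in> L" if "p \<in> K" for p using that by (simp only: K_def colon_def mem_Collect_eq)
  have "L \<subseteq> extend h K G"
  proof
    fix p assume p: "p \<in> L"
    obtain t r where r: "p = t * G + r" "r \<in> ?V" using monic_division[OF G(2)] .
    have "p - t * G \<in> L" using LD(1) p is_ideal_mult[OF LD(1) G(1)] by (rule is_ideal_diff)
    then have "r \<in> L" using r(1) by simp
    then obtain j k where "r = [:h:] * j + k" "j \<in> K" "k \<in> K0" using inV r(2) by blast
    then have p: "p = G * t + ([:h:] * j + k)" and jk: "j \<in> K" "k \<in> K0"
      using r(1) by (simp_all add: mult.commute)
    show "p \<in> extend h K G" unfolding p extend_def by (intro scaledI UNIV_I jk)
  qed
  moreover have "extend h K G \<subseteq> L"
  proof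
    fix p assume "p \<in> extend h K G"
    then obtain s j k where p: "p = G * s + ([:h:] * j + k)" "j \<in> K" "k \<in> K0"
      unfolding extend_def by (auto elim!: scaledE)
    show "p \<in> L" unfolding p(1)
      by (rule is_ideal_add[OF LD(1) is_ideal_mult'[OF LD(1) G(1)] is_ideal_add[OF LD(1) hp[OF p(2)] subsetD[OF LD(2) p(3)]]])
  qed
  ultimately have Leq: "L = extend h K G" by blast
  \<comment> \<open>Compare constant terms in an equation saying that the variable is a unit modulo
    \<open>L\<close>: the multiple of the variable contributes nothing.\<close>
  have "unit_mod H (poly.coeff G 0)"
  proof -
    obtain s where "1 - [:0, 1:] * s \<in> L" using LD(3) by (auto simp: good_ideal_def unit_mod_def)
    then obtain a j k where a: "1 - [:0, 1:] * s = G * a + ([:h:] * j + k)" "k \<in> K0"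
      unfolding Leq extend_def by (auto elim!: scaledE)
    have "1 - poly.coeff G 0 * poly.coeff a 0 = h * poly.coeff j 0 + poly.coeff k 0"
      using arg_cong[OF a(1), of "\<lambda>p. poly.coeff p 0"] by (simp add: coeff_mult algebra_simps)
    moreover have "poly.coeff k 0 \<in> I0" using a(2) by (auto simp: K0_def coeffs_in_def)
    ultimately have "1 - poly.coeff G 0 * poly.coeff a 0 \<in> H" unfolding h(1) by (auto intro: scaledI)
    then show ?thesis by (auto simp: unit_mod_def)
  qed
  then have Lext: "L \<in> extensions d H K"
    using G KL(2) Leq by (auto simp: extensions_def h_def)
  have "L \<inter> ?V = scaled [:h:] (K \<inter> ?V) (K0 \<inter> ?V)"
  proof (intro equalityI subsetI)
    fix p assume p: "p \<in> L \<inter> ?V"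
    then obtain r k where *: "p = [:h:] * r + k" "r \<in> K" "r \<in> ?V" "k \<in> K0" using inV by blast
    have "p - [:h:] * r \<in> ?V" using p *(3) by (auto simp: below_def)
    then show "p \<in> scaled [:h:] (K \<inter> ?V) (K0 \<inter> ?V)" using * by (auto simp: scaled_def)
  next
    fix p assume "p \<in> scaled [:h:] (K \<inter> ?V) (K0 \<inter> ?V)"
    then obtain r k where *: "p = [:h:] * r + k" "r \<in> K" "r \<in> ?V" "k \<in> K0" "k \<in> ?V" by (auto elim: scaledE)
    have "p \<in> L" unfolding *(1) by (rule is_ideal_add[OF LD(1) hp[OF *(2)] subsetD[OF LD(2) *(4)]])
    then show "p \<in> L \<inter> ?V" using * by (auto simp: below_def)
  qed
  then have "index UNIV L = q ^ (m * Suc d) * index ?V (K \<inter> ?V)"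
    using index_ideal_below[OF LD(1) G] index_below_scaled_ideal[OF Hm KL(1), of "Suc d"] KL(3)
    by (simp add: good_ideal_def h_def)
  also have "index ?V (K \<inter> ?V) = index UNIV K"
    using index_ideal_below[OF KL(1) subsetD[OF KL(2) G(1)] G(2)] by simp
  finally have idx: "q ^ N = q ^ (m * Suc d) * index UNIV K" using LD(4) by simp
  have "q ^ (m * Suc d) dvd q ^ N" by (simp only: idx dvd_triv_left)
  then have le: "m * Suc d \<le> N" using q by (rule power_dvd_imp_le)
  have "q ^ N = q ^ (m * Suc d) * q ^ (N - m * Suc d)" using le by (simp only: flip: power_add) simp
  then have "index UNIV K = q ^ (N - m * Suc d)" using idx q by simp
  then have "K \<in> good_ideals (N - m * Suc d) d" using KL(3) Kd by (simp add: good_ideals_def)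
  then show ?thesis using that le Hm Lext by blast
qed

lemma extensionsD:
  assumes "H \<in> ideals_of_index m" "K \<in> good_ideals n d"
  shows "extensions d H K \<subseteq> good_ideals (m * Suc d + n) (Suc d)"
    "L \<in> extensions d H K \<Longrightarrow> top_coeffs L d = H" "L \<in> extensions d H K \<Longrightarrow> colon L [:gen H:] = K"
    "finite (extensions d H K)" "card (extensions d H K) = num_units_mod H * q ^ (m * d)"
proof -
  interpret ideal_extension I0 x q m n d H K "gen H" by unfold_locales (use assms in auto)
  show "extensions d H K \<subseteq> good_ideals (m * Suc d + n) (Suc d)" by (rule extensions_subset)
  show "L \<in> extensions d H K \<Longrightarrow> top_coeffs L d = H" "L \<in> extensions d H K \<Longrightarrow> colon L [:gen H:] = K"
    by (rule extension_data; assumption)+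
  show "finite (extensions d H K)" "card (extensions d H K) = num_units_mod H * q ^ (m * d)"
    by (rule card_extensions)+
qed

lemma good_ideals_Suc:
  "good_ideals N (Suc d) = (\<Union>(m, H, K)\<in>Sigma {m. m * Suc d \<le> N}
     (\<lambda>m. ideals_of_index m \<times> good_ideals (N - m * Suc d) d). extensions d H K)"
proof (intro equalityI subsetI)
  fix L assume "L \<in> good_ideals N (Suc d)"
  then obtain m where "m * Suc d \<le> N" "top_coeffs L d \<in> ideals_of_index m"
    "colon L [:gen (top_coeffs L d):] \<in> good_ideals (N - m * Suc d) d"
    "L \<in> extensions d (top_coeffs L d) (colon L [:gen (top_coeffs L d):])"
    by (rule decompose)
  then show "L \<in> (\<Union>(m, H, K)\<in>Sigma {m. m * Suc d \<le> N}
     (\<lambda>m. ideals_of_index m \<times> good_ideals (N - m * Suc d) d). extensions d H K)" by blast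
next
  fix L assume "L \<in> (\<Union>(m, H, K)\<in>Sigma {m. m * Suc d \<le> N}
     (\<lambda>m. ideals_of_index m \<times> good_ideals (N - m * Suc d) d). extensions d H K)"
  then obtain m H K where *: "m * Suc d \<le> N" "H \<in> ideals_of_index m" "K \<in> good_ideals (N - m * Suc d) d"
    "L \<in> extensions d H K" by blast
  then have "L \<in> good_ideals (m * Suc d + (N - m * Suc d)) (Suc d)" using extensionsD(1) by blast
  then show "L \<in> good_ideals N (Suc d)" using *(1) by simp
qed

lemma good_ideals_0: "good_ideals N 0 = (if N = 0 then {UNIV} else {})"
proof -
  have "K = UNIV" if "K \<in> good_ideals N 0" for K
  proof -
    note KD = good_idealsD[OF that]
    obtain G where "G \<in> K" "G \<in> monics 0" using KD(5) by blast
    moreover from this have "G = 1" by (auto simp: monics_def poly_eq_iff)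
    ultimately show ?thesis using is_ideal_eq_UNIV[OF KD(1)] by blast
  qed
  moreover have "UNIV \<in> good_ideals N 0 \<longleftrightarrow> index (UNIV :: 'b poly set) UNIV = q ^ N"
    using monom_in_monics[of 0, where 'a = 'b] by (auto simp: good_ideals_def good_ideal_def unit_mod_def)
  moreover have "index (UNIV :: 'b poly set) UNIV = 1" by (rule index_self) simp
  moreover have "1 = q ^ N \<longleftrightarrow> N = 0" using q by (cases N) auto
  ultimately show ?thesis by (simp only:) (auto split: if_splits)
qed

lemma finite_good_ideals: "finite (good_ideals N d)"
proof (induction d arbitrary: N)
  case (Suc d)
  have "{m. m * Suc d \<le> N} \<subseteq> {..N}" by (auto intro: order_trans[rotated])
  then have "finite {m. m * Suc d \<le> N}" using finite_subset by blast
  then show ?case unfolding good_ideals_Suc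
    using Suc.IH finite_ideals_of_index extensionsD(4) by (intro finite_UN_I) auto
qed (simp add: good_ideals_0)

text \<open>The union in \<open>good_ideals_Suc\<close> is disjoint: an extension determines
  \<open>H\<close> by its top coefficients, \<open>K\<close> as a colon ideal, and \<open>m\<close>
  through the index of \<open>H\<close>. The number of extensions is the same for all
  \<open>K\<close>, so the sum over \<open>H\<close> turns into \<open>unit_count m\<close>.\<close>

lemma card_good_ideals_Suc:
  "card (good_ideals N (Suc d)) =
    (\<Sum>m | m * Suc d \<le> N. unit_count m * q ^ (m * d) * card (good_ideals (N - m * Suc d) d))"
proof -
  let ?M = "{m. m * Suc d \<le> N}"
  let ?T = "Sigma ?M (\<lambda>m. ideals_of_index m \<times> good_ideals (N - m * Suc d) d)"
  have "?M \<subseteq> {..N}" by (auto intro: order_trans[rotated])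
  then have finM: "finite ?M" using finite_subset by blast
  have finT: "finite ?T" using finM finite_ideals_of_index finite_good_ideals by auto
  have "card (good_ideals N (Suc d)) = (\<Sum>t\<in>?T. card (case t of (m, H, K) \<Rightarrow> extensions d H K))"
    unfolding good_ideals_Suc
  proof (rule card_UN_disjoint[OF finT])
    show "\<forall>t\<in>?T. finite (case t of (m, H, K) \<Rightarrow> extensions d H K)" using extensionsD(4) by auto
    show "\<forall>t\<in>?T. \<forall>u\<in>?T. t \<noteq> u \<longrightarrow> (case t of (m, H, K) \<Rightarrow> extensions d H K) \<inter> (case u of (m, H, K) \<Rightarrow> extensions d H K) = {}"
    proof (intro ballI impI)
      fix t u assume tu: "t \<in> ?T" "u \<in> ?T" "t \<noteq> u"
      obtain m H K m' H' K' where t: "t = (m, H, K)" and u: "u = (m', H', K')" by (metis prod_cases3)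
      have H: "H \<in> ideals_of_index m" "H' \<in> ideals_of_index m'"
        and K: "K \<in> good_ideals (N - m * Suc d) d" "K' \<in> good_ideals (N - m' * Suc d) d"
        and ne: "\<not> (m = m' \<and> H = H' \<and> K = K')"
        using tu by (auto simp: t u)
      have "extensions d H K \<inter> extensions d H' K' = {}"
      proof (rule ccontr)
        assume "extensions d H K \<inter> extensions d H' K' \<noteq> {}"
        then obtain L where L: "L \<in> extensions d H K" "L \<in> extensions d H' K'" by blast
        have HH: "H = H'" using extensionsD(2)[OF H(1) K(1) L(1)] extensionsD(2)[OF H(2) K(2) L(2)] by simp
        moreover have "K = K'"
          using extensionsD(3)[OF H(1) K(1) L(1)] extensionsD(3)[OF H(2) K(2) L(2)] HH by simp
        moreover have "m = m'" using ideals_of_indexD(4)[OF H(1)] ideals_of_indexD(4)[OF H(2)] HH q by simp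
        ultimately show False using ne by simp
      qed
      then show "(case t of (m, H, K) \<Rightarrow> extensions d H K) \<inter> (case u of (m, H, K) \<Rightarrow> extensions d H K) = {}"
        by (simp add: t u)
    qed
  qed
  also have "\<dots> = (\<Sum>(m, H, K)\<in>?T. num_units_mod H * q ^ (m * d))"
    using extensionsD(5) by (intro sum.cong) auto
  also have "\<dots> = (\<Sum>m\<in>?M. \<Sum>(H, K)\<in>ideals_of_index m \<times> good_ideals (N - m * Suc d) d. num_units_mod H * q ^ (m * d))"
    using finM finite_ideals_of_index finite_good_ideals by (subst sum.Sigma) auto
  also have "\<dots> = (\<Sum>m\<in>?M. unit_count m * q ^ (m * d) * card (good_ideals (N - m * Suc d) d))"
    by (intro sum.cong refl)
      (simp add: sum.cartesian_product[symmetric] unit_count_def sum_distrib_right sum_distrib_left mult_ac)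
  finally show ?thesis .
qed

lemma ideals_of_index_0: "ideals_of_index 0 = {UNIV}"
proof -
  have "H = UNIV" if "H \<in> ideals_of_index 0" for H
    using that index_UNIV_eq_1[OF add_subgroup_ideal, of H] by (simp add: ideals_of_index_def)
  moreover have "UNIV \<in> ideals_of_index 0"
    using index_self[of "UNIV :: 'b set"] by (simp add: ideals_of_index_def unit_mod_def)
  ultimately show ?thesis by blast
qed

lemma unit_count_0: "unit_count 0 = 1"
proof -
  have "{a. unit_mod (UNIV :: 'b set) a} = UNIV" by (auto simp: unit_mod_def)
  then show ?thesis
    using index_self[of "UNIV :: 'b set"] by (simp add: unit_count_def ideals_of_index_0 num_units_mod_def index_def)
qed

text \<open>For \<open>d \<ge> N\<close> the recursion keeps only \<open>m = 0\<close>, so the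
  number no longer changes with \<open>d\<close>. As the sets increase with \<open>d\<close> and are
  finite, they are equal.\<close>

lemma good_ideals_stable: "N \<le> d \<Longrightarrow> good_ideals N d = good_ideals N N"
proof (induction d rule: dec_induct)
  case (step d)
  have "{m. m * Suc d \<le> N} = {0}"
  proof -
    have "m = 0" if "m * Suc d \<le> N" for m using that step by (cases m) auto
    then show ?thesis by auto
  qed
  then have "card (good_ideals N (Suc d)) = card (good_ideals N d)"
    unfolding card_good_ideals_Suc by (simp add: unit_count_0)
  moreover have "good_ideals N d \<subseteq> good_ideals N (Suc d)"
    using ideal_monics_mono[of _ d "Suc d"] by (auto simp: good_ideals_def good_ideal_def)
  ultimately show ?case using step.IH card_subset_eq[OF finite_good_ideals] by metis
qed simp

lemma good_ideals_all: "{K. good_ideal K \<and> index UNIV K = q ^ N} = good_ideals N N"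
proof (intro equalityI subsetI)
  fix K assume "K \<in> {K. good_ideal K \<and> index UNIV K = q ^ N}"
  then have K: "good_ideal K" "is_ideal K" "index UNIV K = q ^ N" by (auto simp: good_ideal_def)
  then obtain d where "K \<inter> monics d \<noteq> {}" using monic_exists[OF K(2)] q by auto
  then have "K \<inter> monics (max d N) \<noteq> {}" using ideal_monics_mono[OF K(2)] by simp
  then have "K \<in> good_ideals N (max d N)" using K by (simp add: good_ideals_def)
  then show "K \<in> good_ideals N N" using good_ideals_stable[of N "max d N"] by simp
qed (auto simp: good_ideals_def)

end

section \<open>Polynomials over a finite field\<close>

locale finite_field_mod =
  fixes m0 :: "'c::comm_ring_1 set" and q :: nat
  assumes m0: "is_ideal m0"
    and inverse_mod: "\<And>a. a \<notin> m0 \<Longrightarrow> unit_mod m0 a"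
    and index_m0: "index UNIV m0 = q"
    and q: "q > 1"
begin

lemma one_notin: "1 \<notin> m0"
proof
  assume "1 \<in> m0"
  then have "m0 = UNIV" using m0 is_ideal_eq_UNIV by blast
  then show False using index_m0 q index_self[of "UNIV :: 'c set"] by simp
qed

lemma unit_mod_iff: "unit_mod m0 a \<longleftrightarrow> a \<notin> m0"
proof
  assume "unit_mod m0 a"
  then obtain s where s: "1 - a * s \<in> m0" by (auto simp: unit_mod_def)
  show "a \<notin> m0"
  proof
    assume "a \<in> m0"
    then have "1 - a * s + a * s \<in> m0" by (intro is_ideal_add[OF m0 s] is_ideal_mult'[OF m0])
    then show False using one_notin by simp
  qed
qed (rule inverse_mod)

text \<open>Normalise \<open>p\<close> at its highest coefficient outside \<open>m0\<close>:
  multiply by an inverse modulo \<open>m0\<close>, correct this coefficient to be exactly 1, and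
  delete the higher ones, which lie in \<open>m0\<close>.\<close>

lemma monic_in_ideal:
  assumes H: "is_ideal H" "coeffs_in m0 \<subseteq> H" and p: "p \<in> H" "p \<notin> coeffs_in m0"
  obtains e where "poly.coeff p e \<notin> m0" "H \<inter> monics e \<noteq> {}"
proof -
  let ?E = "{i. poly.coeff p i \<notin> m0}"
  have fin: "finite ?E"
    using is_ideal_0[OF m0] by (intro finite_subset[of ?E "{..degree p}"]) (auto intro: le_degree)
  define e where "e = Max ?E"
  have "?E \<noteq> {}" using p by (auto simp: coeffs_in_def)
  then have e: "poly.coeff p e \<notin> m0" using Max_in[OF fin] by (auto simp: e_def)
  have above: "poly.coeff p i \<in> m0" if "i > e" for i
    using Max_ge[OF fin, of i] that by (auto simp: e_def)
  obtain c where c: "1 - poly.coeff p e * c \<in> m0" using inverse_mod[OF e] by (auto simp: unit_mod_def)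
  define k where "k = (\<Sum>i\<in>{e<..degree p}. monom (poly.coeff p i * c) i)"
  define G where "G = p * [:c:] + monom (1 - poly.coeff p e * c) e - k"
  have k: "poly.coeff k i = (if i > e then poly.coeff p i * c else 0)" for i
  proof -
    have "poly.coeff k i = (\<Sum>j\<in>{e<..degree p}. if j = i then poly.coeff p j * c else 0)"
      by (simp add: k_def coeff_sum)
    then show ?thesis by (auto simp: coeff_eq_0 not_le)
  qed
  have "k \<in> coeffs_in m0" using above is_ideal_0[OF m0] is_ideal_mult'[OF m0] by (auto simp: coeffs_in_def k)
  moreover have "monom (1 - poly.coeff p e * c) e \<in> coeffs_in m0"
    using c is_ideal_0[OF m0] by (auto simp: coeffs_in_def)
  ultimately have "G \<in> H" unfolding G_def
    using H by (intro is_ideal_diff[OF H(1)] is_ideal_add[OF H(1)] is_ideal_mult'[OF H(1) p(1)]) auto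
  moreover have "G \<in> monics e" by (auto simp: monics_def G_def k mult.commute)
  ultimately show ?thesis using that e by blast
qed

lemma principal_below:
  assumes G: "G \<in> monics d"
  shows "scaled G UNIV (coeffs_in m0) \<inter> below d = coeffs_in m0 \<inter> below d"
proof (intro equalityI subsetI)
  fix p assume p: "p \<in> scaled G UNIV (coeffs_in m0) \<inter> below d"
  then obtain s k where sk: "p = G * s + k" "k \<in> coeffs_in m0" by (auto elim: scaledE)
  then have "s \<in> coeffs_in m0"
    using p by (intro monic_quotient_coeffs_in[OF m0 G sk(2)]) (simp add: mult.commute)
  then have "p \<in> coeffs_in m0"
    unfolding sk(1) using sk(2) is_ideal_coeffs_in[OF m0] by (intro is_ideal_add is_ideal_mult)
  then show "p \<in> coeffs_in m0 \<inter> below d" using p by blast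
qed (use scaled_superset[of UNIV "coeffs_in m0" G] in auto)

lemma index_principal:
  assumes G: "G \<in> monics d"
  shows "index UNIV (scaled G UNIV (coeffs_in m0)) = q ^ d"
proof -
  have "G * 1 + 0 \<in> scaled G UNIV (coeffs_in m0)"
    using is_ideal_0[OF is_ideal_coeffs_in[OF m0]] by (intro scaledI UNIV_I)
  then have "index UNIV (scaled G UNIV (coeffs_in m0)) = index (below d) (coeffs_in m0 \<inter> below d)"
    using index_ideal_below[OF is_ideal_scaled[OF is_ideal_UNIV is_ideal_coeffs_in[OF m0]] _ G]
    by (simp add: principal_below[OF G])
  then show ?thesis by (simp add: index_below[OF m0] index_m0)
qed

lemma ideal_cases:
  assumes H: "is_ideal H" "coeffs_in m0 \<subseteq> H"
  shows "H = coeffs_in m0 \<or> (\<exists>d. \<exists>G\<in>monics d. H = scaled G UNIV (coeffs_in m0))"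
proof (cases "H = coeffs_in m0")
  case False
  then obtain p where "p \<in> H" "p \<notin> coeffs_in m0" using H by auto
  then have ex: "\<exists>d. H \<inter> monics d \<noteq> {}" using monic_in_ideal[OF H] by metis
  define d where "d = (LEAST d. H \<inter> monics d \<noteq> {})"
  have "H \<inter> monics d \<noteq> {}" unfolding d_def using ex by (rule LeastI_ex)
  then obtain G where G: "G \<in> H" "G \<in> monics d" by blast
  have "H \<subseteq> scaled G UNIV (coeffs_in m0)"
  proof
    fix p assume p: "p \<in> H"
    obtain t r where r: "p = t * G + r" "r \<in> below d" using monic_division[OF G(2)] .
    have "p - t * G \<in> H" using H(1) p is_ideal_mult[OF H(1) G(1)] by (rule is_ideal_diff)
    then have rH: "r \<in> H" using r(1) by simp
    have "r \<in> coeffs_in m0"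
    proof (rule ccontr)
      assume "r \<notin> coeffs_in m0"
      with rH obtain e where e: "poly.coeff r e \<notin> m0" "H \<inter> monics e \<noteq> {}" using monic_in_ideal[OF H] by metis
      then have "d \<le> e" unfolding d_def by (intro Least_le)
      then show False using r(2) e(1) is_ideal_0[OF m0] by (auto simp: below_def)
    qed
    then show "p \<in> scaled G UNIV (coeffs_in m0)" unfolding r(1) mult.commute[of t] by (intro scaledI UNIV_I)
  qed
  moreover have "scaled G UNIV (coeffs_in m0) \<subseteq> H"
  proof
    fix p assume "p \<in> scaled G UNIV (coeffs_in m0)"
    then obtain s k where p: "p = G * s + k" "k \<in> coeffs_in m0" by (auto elim: scaledE)
    show "p \<in> H" unfolding p(1) using is_ideal_add[OF H(1) is_ideal_mult'[OF H(1) G(1)] subsetD[OF H(2) p(2)]] .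
  qed
  ultimately show ?thesis using G by blast
qed simp

text \<open>Comparing constant terms gives one direction. For the other, \<open>G\<close> is its
  constant term plus a multiple of the variable.\<close>

lemma unit_mod_principal:
  "unit_mod (scaled G UNIV (coeffs_in m0)) [:0, 1:] \<longleftrightarrow> unit_mod m0 (poly.coeff G 0)"
proof
  assume "unit_mod (scaled G UNIV (coeffs_in m0)) [:0, 1:]"
  then obtain s a k where a: "1 - [:0, 1:] * s = G * a + k" "k \<in> coeffs_in m0"
    unfolding unit_mod_def by (auto elim!: scaledE)
  have "1 - poly.coeff G 0 * poly.coeff a 0 = poly.coeff k 0"
    using arg_cong[OF a(1), of "\<lambda>p. poly.coeff p 0"] by (simp add: coeff_mult algebra_simps)
  also have "\<dots> \<in> m0" using a(2) by (simp add: coeffs_in_def)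
  finally show "unit_mod m0 (poly.coeff G 0)" unfolding unit_mod_def by blast
next
  assume "unit_mod m0 (poly.coeff G 0)"
  then obtain c where c: "1 - poly.coeff G 0 * c \<in> m0" by (auto simp: unit_mod_def)
  obtain g0 g1 where G: "G = pCons g0 g1" by (cases G)
  have eq: "1 - [:0, 1:] * - (g1 * [:c:]) = G * [:c:] + [:1 - poly.coeff G 0 * c:]"
    by (simp add: G one_pCons algebra_simps)
  have "[:1 - poly.coeff G 0 * c:] \<in> coeffs_in m0"
    using c is_ideal_0[OF m0] by (auto simp: coeffs_in_def coeff_pCons split: nat.splits)
  then have "1 - [:0, 1:] * - (g1 * [:c:]) \<in> scaled G UNIV (coeffs_in m0)"
    unfolding eq by (intro scaledI UNIV_I)
  then show "unit_mod (scaled G UNIV (coeffs_in m0)) [:0, 1:]" unfolding unit_mod_def by blast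
qed

lemma index_coeffs_in: "index UNIV (coeffs_in m0) = 0"
proof (rule ccontr)
  assume "index UNIV (coeffs_in m0) \<noteq> 0"
  then obtain d where "coeffs_in m0 \<inter> monics d \<noteq> {}"
    using monic_exists[OF is_ideal_coeffs_in[OF m0]] by auto
  then show False using one_notin by (auto simp: coeffs_in_def monics_def) metis
qed

text \<open>If \<open>a\<close> is not 0 modulo \<open>m0\<close>, the annihilator of
  \<open>b\<close> modulo \<open>m0\<close> contains a monic polynomial, and multiplication by a
  monic polynomial is injective modulo \<open>m0\<close>.\<close>

lemma coeffs_in_prime:
  assumes "a * b \<in> coeffs_in m0" shows "a \<in> coeffs_in m0 \<or> b \<in> coeffs_in m0"
proof (rule ccontr)
  assume ab: "\<not> ?thesis"
  note I = is_ideal_coeffs_in[OF m0]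
  have "a \<in> colon (coeffs_in m0) b" using assms by (simp add: colon_def mult.commute)
  then obtain e where "colon (coeffs_in m0) b \<inter> monics e \<noteq> {}"
    using monic_in_ideal[OF is_ideal_colon[OF I] colon_superset[OF I], of a b] ab by metis
  then obtain G where G: "b * G \<in> coeffs_in m0" "G \<in> monics e" by (auto simp: colon_def)
  have "b \<in> coeffs_in m0"
    using monic_quotient_coeffs_in[OF m0 G(2) is_ideal_minus[OF I G(1)], of b] by (simp add: below_def)
  then show False using ab by blast
qed

definition unit_monics :: "nat \<Rightarrow> 'c poly set" where
  "unit_monics m = {G \<in> monics m. unit_mod m0 (poly.coeff G 0)}"

lemma ideals_eq:
  "{H. is_ideal H \<and> coeffs_in m0 \<subseteq> H \<and> unit_mod H [:0, 1:] \<and> index UNIV H = q ^ m} =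
    (\<lambda>G. scaled G UNIV (coeffs_in m0)) ` unit_monics m"
proof (intro equalityI subsetI)
  fix H assume H: "H \<in> {H. is_ideal H \<and> coeffs_in m0 \<subseteq> H \<and> unit_mod H [:0, 1:] \<and> index UNIV H = q ^ m}"
  then have "H \<noteq> coeffs_in m0" using index_coeffs_in q by auto
  then obtain d G where G: "G \<in> monics d" "H = scaled G UNIV (coeffs_in m0)" using ideal_cases H by blast
  then have "d = m" using H index_principal[OF G(1)] q by simp
  then show "H \<in> (\<lambda>G. scaled G UNIV (coeffs_in m0)) ` unit_monics m"
    using G H unit_mod_principal by (auto simp: unit_monics_def)
next
  fix H assume "H \<in> (\<lambda>G. scaled G UNIV (coeffs_in m0)) ` unit_monics m"
  then obtain G where G: "H = scaled G UNIV (coeffs_in m0)" "G \<in> monics m" "unit_mod m0 (poly.coeff G 0)"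
    by (auto simp: unit_monics_def)
  then show "H \<in> {H. is_ideal H \<and> coeffs_in m0 \<subseteq> H \<and> unit_mod H [:0, 1:] \<and> index UNIV H = q ^ m}"
    using is_ideal_scaled[OF is_ideal_UNIV is_ideal_coeffs_in[OF m0]] scaled_superset[of UNIV "coeffs_in m0" G]
    by (simp add: unit_mod_principal index_principal)
qed

text \<open>An ideal of index \<open>q ^ m\<close> is determined by its monic elements of degree
  \<open>m\<close>. They form a single coset, since the monic generator is unique modulo
  \<open>m0\<close>.\<close>

lemma bij_ideals:
  "bij_betw (\<lambda>H. H \<inter> monics m) ((\<lambda>G. scaled G UNIV (coeffs_in m0)) ` unit_monics m)
    (coset_of (coeffs_in m0 \<inter> below m) ` unit_monics m)"
proof -
  let ?S = "\<lambda>G. scaled G UNIV (coeffs_in m0)"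
  note I = is_ideal_scaled[OF is_ideal_UNIV is_ideal_coeffs_in[OF m0]]
  have self: "G \<in> ?S G" for G
    using mult_in_scaled[OF is_ideal_coeffs_in[OF m0] UNIV_I, of G 1] by simp
  have mon: "?S G \<inter> monics m = coset_of (coeffs_in m0 \<inter> below m) G" if "G \<in> unit_monics m" for G
  proof -
    have G: "G \<in> monics m" using that by (simp add: unit_monics_def)
    have "w \<in> ?S G \<and> w \<in> monics m \<longleftrightarrow> w - G \<in> ?S G \<and> w - G \<in> below m" for w
      using is_ideal_diff[OF I _ self[of G], of w] is_ideal_add[OF I _ self[of G], of "w - G"]
        monics_diff[OF _ G, of w] monics_add[OF G, of "w - G"] by auto
    then show ?thesis unfolding coset_of_def principal_below[OF G, symmetric] by blast
  qed
  have sub: "?S G \<subseteq> ?S G'" if "G \<in> ?S G'" for G G'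
  proof
    fix p assume "p \<in> ?S G"
    then obtain s k where p: "p = G * s + k" "k \<in> coeffs_in m0" by (auto elim: scaledE)
    have "k \<in> ?S G'" using p(2) scaled_superset[of UNIV "coeffs_in m0" G'] by auto
    then show "p \<in> ?S G'" unfolding p(1) by (rule is_ideal_add[OF I is_ideal_mult'[OF I that]])
  qed
  show ?thesis
    unfolding bij_betw_def
  proof
    show "inj_on (\<lambda>H. H \<inter> monics m) (?S ` unit_monics m)"
    proof (rule inj_onI)
      fix H H' assume "H \<in> ?S ` unit_monics m" "H' \<in> ?S ` unit_monics m" and eq: "H \<inter> monics m = H' \<inter> monics m"
      then obtain G G' where G: "G \<in> unit_monics m" "G' \<in> unit_monics m" "H = ?S G" "H' = ?S G'" by auto
      have "G \<in> H \<inter> monics m" "G' \<in> H' \<inter> monics m" using G self by (auto simp: unit_monics_def)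
      then show "H = H'" using eq G sub by blast
    qed
    show "(\<lambda>H. H \<inter> monics m) ` ?S ` unit_monics m = coset_of (coeffs_in m0 \<inter> below m) ` unit_monics m"
      using mon by (force simp: image_image)
  qed
qed

text \<open>For \<open>m > 0\<close> the constant term takes \<open>q - 1\<close> classes and each
  of the other \<open>m - 1\<close> coefficients below the leading one takes \<open>q\<close>. For
  \<open>m = 0\<close> the constant term is the leading coefficient 1.\<close>

lemma card_unit_monics:
  "card (coset_of (coeffs_in m0 \<inter> below m) ` unit_monics m) = (if m = 0 then 1 else (q - 1) * q ^ (m - 1))"
proof (cases "m = 0")
  case True
  have "unit_monics 0 = {1}"
  proof -
    have "G = 1" if "G \<in> monics 0" for G :: "'c poly" using that by (auto simp: monics_def poly_eq_iff)
    moreover have "(1 :: 'c poly) \<in> monics 0" by (simp add: monics_def)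
    moreover have "unit_mod m0 1" using one_notin by (simp add: unit_mod_iff)
    ultimately show ?thesis by (auto simp: unit_monics_def)
  qed
  then show ?thesis using True by simp
next
  case False
  let ?V = "below m :: 'c poly set"
  let ?D = "coeffs_in m0 \<inter> ?V"
  have D: "add_subgroup ?D"
    by (intro add_subgroup_Int add_subgroup_below add_subgroup_ideal is_ideal_coeffs_in m0)
  define T where "T = {t. unit_mod m0 t}"
  have count: "card (coset_of ?D ` {v \<in> ?V. \<exists>t\<in>S. poly.coeff v 0 - t \<in> m0}) =
      card (coset_of m0 ` S) * card (coset_of ?D ` {v \<in> ?V. poly.coeff v 0 \<in> m0})" for S
  proof (rule card_cosets_vimage[OF add_subgroup_below D _ add_subgroup_ideal[OF m0]])
    show "\<exists>v\<in>?V. poly.coeff v 0 - t \<in> m0" for t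
      using False is_ideal_0[OF m0] by (intro bexI[of _ "[:t:]"]) (auto simp: below_def coeff_pCons split: nat.splits)
  qed (auto simp: coeffs_in_def)
  have "\<exists>t. poly.coeff v 0 - t \<in> m0" for v :: "'c poly"
    using is_ideal_0[OF m0] by (intro exI[of _ "poly.coeff v 0"]) simp
  then have "{v \<in> ?V. \<exists>t\<in>UNIV. poly.coeff v 0 - t \<in> m0} = ?V" by auto
  with count[of UNIV] have "q ^ m = q * card (coset_of ?D ` {v \<in> ?V. poly.coeff v 0 \<in> m0})"
    using index_below[OF m0, of m] index_m0 by (simp add: index_def)
  moreover have "q ^ m = q * q ^ (m - 1)" using False by (cases m) auto
  ultimately have ker: "card (coset_of ?D ` {v \<in> ?V. poly.coeff v 0 \<in> m0}) = q ^ (m - 1)"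
    using q by simp
  have unit: "unit_mod m0 (poly.coeff v 0) \<longleftrightarrow> (\<exists>t\<in>T. poly.coeff v 0 - t \<in> m0)" for v :: "'c poly"
    using unit_mod_cong[OF m0] is_ideal_minus[OF m0] is_ideal_0[OF m0]
    unfolding T_def by (metis diff_self mem_Collect_eq minus_diff_eq)
  have "unit_monics m = (+) (monom 1 m) ` {v \<in> ?V. \<exists>t\<in>T. poly.coeff v 0 - t \<in> m0}"
  proof (intro equalityI subsetI)
    fix G assume "G \<in> unit_monics m"
    then have G: "G \<in> monics m" "unit_mod m0 (poly.coeff G 0)" by (auto simp: unit_monics_def)
    then have "G - monom 1 m \<in> ?V" "unit_mod m0 (poly.coeff (G - monom 1 m) 0)"
      using monics_diff[OF G(1) monom_in_monics] False by auto
    then have "G - monom 1 m \<in> {v \<in> ?V. \<exists>t\<in>T. poly.coeff v 0 - t \<in> m0}" using unit by blast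
    then show "G \<in> (+) (monom 1 m) ` {v \<in> ?V. \<exists>t\<in>T. poly.coeff v 0 - t \<in> m0}"
      by (intro image_eqI[of _ _ "G - monom 1 m"]) auto
  next
    fix G assume "G \<in> (+) (monom 1 m) ` {v \<in> ?V. \<exists>t\<in>T. poly.coeff v 0 - t \<in> m0}"
    then obtain v where v: "G = monom 1 m + v" "v \<in> ?V" "unit_mod m0 (poly.coeff v 0)" using unit by blast
    then show "G \<in> unit_monics m"
      using monics_add[OF monom_in_monics v(2)] False by (simp add: unit_monics_def)
  qed
  then have "card (coset_of ?D ` unit_monics m) = card (coset_of m0 ` T) * q ^ (m - 1)"
    by (simp only: card_cosets_shift count ker)
  moreover have "card (coset_of m0 ` T) = q - 1"
  proof -
    have "range (coset_of m0) - {coset_of m0 0} = coset_of m0 ` T"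
    proof -
      have "coset_of m0 v = coset_of m0 0 \<longleftrightarrow> v \<in> m0" for v
        using coset_of_eq_iff[OF add_subgroup_ideal[OF m0], of v 0] by simp
      then show ?thesis unfolding T_def unit_mod_iff by blast
    qed
    moreover have "card (range (coset_of m0) - {coset_of m0 0}) = q - 1"
      using index_m0 by (simp add: index_def card_Diff_singleton)
    ultimately show ?thesis by simp
  qed
  ultimately show ?thesis using False by simp
qed

lemma finite_unit_monics: "finite (coset_of (coeffs_in m0 \<inter> below m) ` unit_monics m)"
  using card_unit_monics[of m] q by (intro card_ge_0_finite) (simp split: if_splits)

sublocale principal_mod "coeffs_in m0" "[:0, 1:]" q
proof
  show "\<exists>h. H = scaled h UNIV (coeffs_in m0)" if H: "is_ideal H" "coeffs_in m0 \<subseteq> H" for H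
  proof -
    have "coeffs_in m0 = scaled 0 UNIV (coeffs_in m0)" by (auto simp: scaled_def)
    then show ?thesis using ideal_cases[OF H] by blast
  qed
  show "\<exists>m. index UNIV H = q ^ m" if "is_ideal H" "coeffs_in m0 \<subset> H" for H
    using ideal_cases[of H] that index_principal by auto
  show "finite {H. is_ideal H \<and> coeffs_in m0 \<subseteq> H \<and> unit_mod H [:0, 1:] \<and> index UNIV H = q ^ m}" for m
    unfolding ideals_eq using bij_betw_finite[OF bij_ideals] finite_unit_monics by blast
qed (use m0 q index_coeffs_in coeffs_in_prime in \<open>auto intro: is_ideal_coeffs_in\<close>)

lemma card_ideals_of_index: "card (ideals_of_index m) = (if m = 0 then 1 else (q - 1) * q ^ (m - 1))"
  unfolding ideals_of_index_def ideals_eq using bij_betw_same_card[OF bij_ideals] card_unit_monics by simp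

text \<open>Let S(t) and N(t) be the generating functions of the numbers of ideals and of
  \<open>unit_count\<close>. The count of pairs says S(q t) = S(t) N(t), and S(t) = (1 - t) / (1 - q
  t). Hence N(t) = (1 - q t)^2 / ((1 - t) (1 - q^2 t)), with the stated coefficients. The proof
  extracts them by a recursion.\<close>

lemma unit_count_Suc: 
  "int (unit_count (Suc m)) = (int q - 1)\<^sup>2 * (\<Sum>i<Suc m. int q ^ (2 * i))"
proof -
  define s where "s i = int (card (ideals_of_index i))" for i
  define N where "N i = int (unit_count i)" for i
  define T where "T m = (\<Sum>i\<le>m. s i * N (m - i))" for m
  have T: "T m = int q ^ m * s m" for m
    using arg_cong[OF sum_ideals_unit_count[of m], of int] by (simp add: T_def s_def N_def)
  have s0: "s 0 = 1" by (simp add: s_def card_ideals_of_index)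
  have sS: "s (Suc i) = (int q - 1) * int q ^ i" for i
    using q by (simp add: s_def card_ideals_of_index of_nat_diff)
  have rec: "T (Suc m) = N (Suc m) + int q * T m - N m" for m
  proof -
    have "T (Suc m) = N (Suc m) + (\<Sum>i\<le>m. s (Suc i) * N (m - i))"
      unfolding T_def by (subst sum.atMost_Suc_shift) (simp add: s0)
    \<comment> \<open>\<open>s (Suc i)\<close> is \<open>q\<close> times \<open>s i\<close> except
      at \<open>i = 0\<close>, where 1 has to be subtracted; this exception produces the term
      \<open>N m\<close>.\<close>
    also have "(\<Sum>i\<le>m. s (Suc i) * N (m - i)) = (\<Sum>i\<le>m. int q * (s i * N (m - i)) - (if i = 0 then N m else 0))"
    proof (intro sum.cong refl)
      fix i show "s (Suc i) * N (m - i) = int q * (s i * N (m - i)) - (if i = 0 then N m else 0)"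
        by (cases i) (simp_all add: s0 sS algebra_simps)
    qed
    also have "\<dots> = int q * T m - N m" by (simp add: T_def sum_subtractf sum_distrib_left)
    finally show ?thesis by simp
  qed
  have "N (Suc m) = (int q - 1)\<^sup>2 * (\<Sum>i<Suc m. int q ^ (2 * i))" for m
  proof (induction m)
    case 0
    show ?case using rec[of 0] by (simp add: T s0 sS N_def unit_count_0 power2_eq_square algebra_simps)
  next
    case (Suc m)
    have "N (Suc (Suc m)) = N (Suc m) + (int q - 1)\<^sup>2 * int q ^ (2 * Suc m)"
      using rec[of "Suc m"] unfolding T sS power2_eq_square mult_2 power_add power_Suc
      by (simp add: algebra_simps)
    then show ?case using Suc.IH by (simp add: algebra_simps)
  qed
  then show ?thesis by (simp add: N_def)
qed

end

section \<open>The counting polynomials\<close>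

lemma eval_at_0 [simp]: "eval_at 0 z = 0"
  and eval_at_pCons: "eval_at (pCons a p) z = of_int a + z * eval_at p z"
  by (simp_all add: eval_at_def map_poly_pCons)

lemma eval_at_1 [simp]: "eval_at 1 z = 1"
  by (simp add: one_pCons eval_at_pCons)

lemma eval_at_add: "eval_at (p + r) z = eval_at p z + eval_at r z"
  by (induction p r rule: poly_induct2) (simp_all add: eval_at_pCons algebra_simps)

lemma eval_at_smult: "eval_at (smult a p) z = of_int a * eval_at p z"
  by (induction p) (simp_all add: eval_at_pCons algebra_simps)

lemma eval_at_mult: "eval_at (p * r) z = eval_at p z * eval_at r z"
  by (induction p) (simp_all add: eval_at_pCons eval_at_add eval_at_smult algebra_simps)

lemma eval_at_power: "eval_at (p ^ n) z = eval_at p z ^ n"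
  by (induction n) (simp_all add: eval_at_mult)

lemma eval_at_sum: "eval_at (sum f A) z = (\<Sum>i\<in>A. eval_at (f i) z)"
  by (induction A rule: infinite_finite_induct) (simp_all add: eval_at_add)

lemma eval_at_monom: "eval_at (monom 1 n) z = z ^ n"
  by (induction n) (simp_all add: eval_at_pCons monom_Suc monom_0)

lemma to_fract_of_int: "to_fract (of_int a) = of_int a"
proof -
  have "to_fract (of_nat n) = of_nat n" for n by (induction n) simp_all
  then show ?thesis by (cases a rule: int_cases2) simp_all
qed

lemma to_fract_power: "to_fract (a ^ n) = to_fract a ^ n"
  by (induction n) simp_all

lemma eval_at_qvar: "eval_at p qvar = to_fract p"
proof (induction p)
  case (pCons a p)
  have *: "pCons a p = of_int a + [:0, 1:] * p" by (simp add: of_int_poly)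
  have "to_fract (pCons a p) = of_int a + qvar * to_fract p"
    by (subst *) (simp only: to_fract_add to_fract_mult to_fract_of_int qvar_def)
  then show ?case using pCons.IH by (simp only: eval_at_pCons)
qed simp

lemma qvar_nonzero [simp]: "qvar \<noteq> 0"
  by (simp add: qvar_def)

lemma eval_at_altdef: "eval_at p z = (\<Sum>i\<le>degree p. of_int (poly.coeff p i) * z ^ i)"
proof -
  have monom: "eval_at (monom a i) z = of_int a * z ^ i" for a i
    by (induction i) (simp_all add: eval_at_pCons monom_Suc monom_0 mult_ac)
  have "eval_at p z = eval_at (\<Sum>i\<le>degree p. monom (poly.coeff p i) i) z"
    by (simp only: poly_as_sum_of_monoms)
  then show ?thesis by (simp add: eval_at_sum monom)
qed

text \<open>Palindromicity with a free exponent \<open>k\<close>: in this form it passes to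
  products, and to sums with common exponent, while the degrees are still unknown.\<close>

definition self_reciprocal :: "nat \<Rightarrow> int poly \<Rightarrow> bool" where
  "self_reciprocal k p \<longleftrightarrow> eval_at p qvar = qvar ^ k * eval_at p (inverse qvar)"

lemma self_reciprocal_mult:
  "self_reciprocal j p \<Longrightarrow> self_reciprocal k r \<Longrightarrow> self_reciprocal (j + k) (p * r)"
  by (simp add: self_reciprocal_def eval_at_mult power_add)

lemma self_reciprocal_sum:
  "(\<And>i. i \<in> A \<Longrightarrow> self_reciprocal k (f i)) \<Longrightarrow> self_reciprocal k (sum f A)"
  by (simp add: self_reciprocal_def eval_at_sum sum_distrib_left)

lemma self_reciprocal_monom: "self_reciprocal (2 * j) (monom 1 j)"
  by (simp add: self_reciprocal_def eval_at_monom mult_2 power_add power_inverse)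

lemma self_reciprocal_square: "self_reciprocal 2 ([:-1, 1:]\<^sup>2)"
proof -
  have "qvar * (inverse qvar - 1) = 1 - qvar" by (simp add: right_diff_distrib)
  then have "(qvar - 1)\<^sup>2 = qvar\<^sup>2 * (inverse qvar - 1)\<^sup>2"
    by (metis power2_commute power_mult_distrib)
  then show ?thesis by (simp add: self_reciprocal_def eval_at_power eval_at_pCons)
qed

text \<open>By the symmetry, q^k times the reflected polynomial equals q^(degree p) times
  \<open>p\<close>. A non-zero constant coefficient gives the reflected polynomial the degree of
  \<open>p\<close>, so comparing degrees forces \<open>k = degree p\<close>.\<close>

lemma palindromic_if_self_reciprocal:
  assumes "self_reciprocal k p" "poly.coeff p 0 \<noteq> 0"
  shows "palindromic p"
proof -
  have refl: "eval_at (reflect_poly p) qvar = qvar ^ degree p * eval_at p (inverse qvar)"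
  proof -
    let ?n = "degree p"
    have "eval_at (reflect_poly p) qvar = (\<Sum>i<Suc ?n. of_int (poly.coeff p (?n - i)) * qvar ^ i)"
      using assms(2) by (simp add: eval_at_altdef degree_reflect_poly_eq coeff_reflect_poly lessThan_Suc_atMost)
    also have "\<dots> = (\<Sum>i<Suc ?n. of_int (poly.coeff p (?n - (?n - i))) * qvar ^ (?n - i))"
      by (subst sum.nat_diff_reindex[symmetric]) simp
    also have "\<dots> = (\<Sum>i<Suc ?n. qvar ^ ?n * (of_int (poly.coeff p i) * inverse qvar ^ i))"
      by (intro sum.cong refl) (simp add: power_diff power_inverse field_simps)
    finally show ?thesis by (simp only: eval_at_altdef lessThan_Suc_atMost sum_distrib_left)
  qed
  have "qvar ^ k * eval_at (reflect_poly p) qvar = qvar ^ degree p * eval_at p qvar"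
    using assms(1) refl by (simp add: self_reciprocal_def)
  then have "[:0, 1:] ^ k * reflect_poly p = [:0, 1:] ^ degree p * p"
    unfolding eval_at_qvar unfolding qvar_def to_fract_power[symmetric] to_fract_mult[symmetric] to_fract_eq_iff .
  moreover have "degree ([:0, 1:] ^ j * r) = j + degree r" if "r \<noteq> 0" for j and r :: "int poly"
    using that by (simp add: degree_mult_eq degree_power_eq)
  moreover have "p \<noteq> 0" "reflect_poly p \<noteq> 0" using assms(2) by auto
  ultimately have "k + degree (reflect_poly p) = degree p + degree p" by metis
  then have "k = degree p" using assms(2) by (simp add: degree_reflect_poly_eq)
  then show ?thesis using assms(1) by (simp add: palindromic_def self_reciprocal_def)
qed

fun N_poly :: "nat \<Rightarrow> int poly" where
  "N_poly 0 = 1"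
| "N_poly (Suc m) = [:-1, 1:]\<^sup>2 * (\<Sum>i<Suc m. monom 1 (2 * i))"

text \<open>The recursion of \<open>card_good_ideals_Suc\<close> with an indeterminate in place of
  \<open>q\<close>: \<open>W_poly d n\<close> gives the number of ideals of codimension
  \<open>n\<close> that have a monic element of degree \<open>d\<close> in y.\<close>

fun W_poly :: "nat \<Rightarrow> nat \<Rightarrow> int poly" where
  "W_poly 0 n = (if n = 0 then 1 else 0)"
| "W_poly (Suc d) n = (\<Sum>m | m * Suc d \<le> n. N_poly m * monom 1 (m * d) * W_poly d (n - m * Suc d))"

lemma finite_multiples: "finite {m. m * Suc d \<le> n}"
proof (rule finite_subset)
  show "{m. m * Suc d \<le> n} \<subseteq> {..n}" by (auto intro: order_trans[rotated])
qed simp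

text \<open>For \<open>m = Suc k\<close> the square contributes 2 to the exponent. The sum of even
  powers is reversed by the substitution of \<open>k - i\<close> for \<open>i\<close> and
  contributes 2 k.\<close>

lemma self_reciprocal_N_poly: "self_reciprocal (2 * m) (N_poly m)"
proof (cases m)
  case (Suc k)
  have "self_reciprocal (2 * k) (\<Sum>i<Suc k. monom 1 (2 * i))"
  proof -
    have "(\<Sum>i<Suc k. qvar ^ (2 * i)) = (\<Sum>i<Suc k. qvar ^ (2 * (k - i)))"
      by (subst sum.nat_diff_reindex[symmetric]) simp
    also have "\<dots> = (\<Sum>i<Suc k. qvar ^ (2 * k) * inverse qvar ^ (2 * i))"
    proof (intro sum.cong refl)
      fix i assume "i \<in> {..<Suc k}"
      then have "2 * k = 2 * (k - i) + 2 * i" by simp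
      then have "qvar ^ (2 * k) = qvar ^ (2 * (k - i)) * qvar ^ (2 * i)" by (simp only: power_add)
      then show "qvar ^ (2 * (k - i)) = qvar ^ (2 * k) * inverse qvar ^ (2 * i)"
        by (simp add: power_inverse)
    qed
    finally show ?thesis
      by (simp add: self_reciprocal_def eval_at_sum eval_at_monom sum_distrib_left del: sum.lessThan_Suc)
  qed
  from self_reciprocal_mult[OF self_reciprocal_square this] show ?thesis using Suc by simp
qed (simp add: self_reciprocal_def)

text \<open>The exponents 2 m, 2 m d and 2 (n - m (d + 1)) of the three factors add up to 2 n for
  every \<open>m\<close>, so all summands share one exponent.\<close>

lemma self_reciprocal_W_poly: "self_reciprocal (2 * n) (W_poly d n)"
proof (induction d arbitrary: n)
  case 0
  show ?case by (simp add: self_reciprocal_def)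
next
  case (Suc d)
  show ?case unfolding W_poly.simps
  proof (rule self_reciprocal_sum)
    fix m assume "m \<in> {m. m * Suc d \<le> n}"
    then have "2 * m + 2 * (m * d) + 2 * (n - m * Suc d) = 2 * n" by simp
    then show "self_reciprocal (2 * n) (N_poly m * monom 1 (m * d) * W_poly d (n - m * Suc d))"
      using self_reciprocal_mult[OF self_reciprocal_mult[OF self_reciprocal_N_poly self_reciprocal_monom] Suc]
      by metis
  qed
qed

lemma coeff_0_mult: "poly.coeff (p * r) 0 = poly.coeff p 0 * poly.coeff r 0"
  by (simp add: coeff_mult)

lemma coeff_0_N_poly: "poly.coeff (N_poly m) 0 = 1"
proof (cases m)
  case (Suc k)
  have "(\<Sum>i<Suc k. poly.coeff (monom 1 (2 * i)) 0) = (1::int)"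
    by (subst sum.lessThan_Suc_shift) simp
  then show ?thesis using Suc by (simp add: coeff_0_mult coeff_sum power2_eq_square del: sum.lessThan_Suc)
qed simp

text \<open>In the recursion for \<open>W_poly (Suc d)\<close> with \<open>d > 0\<close>, the factor
  \<open>monom 1 (m * d)\<close> kills the constant coefficient of every summand except
  \<open>m = 0\<close>. For \<open>d = 0\<close> this factor is 1, but \<open>W_poly 0\<close>
  leaves only \<open>m = n\<close>.\<close>

lemma coeff_0_W_poly: "poly.coeff (W_poly (Suc d) n) 0 = 1"
proof (induction d arbitrary: n)
  case 0
  have "poly.coeff (W_poly (Suc 0) n) 0 = (\<Sum>m\<le>n. if m = n then 1 else 0)"
    unfolding W_poly.simps coeff_sum
    by (intro sum.cong) (auto simp: coeff_0_mult coeff_0_N_poly)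
  then show ?case by simp
next
  case (Suc d)
  have "poly.coeff (W_poly (Suc (Suc d)) n) 0 =
      (\<Sum>m | m * Suc (Suc d) \<le> n. if m = 0 then poly.coeff (W_poly (Suc d) n) 0 else 0)"
    unfolding W_poly.simps(2)[of "Suc d"] coeff_sum
    by (intro sum.cong refl) (auto simp: coeff_0_mult coeff_0_N_poly simp del: W_poly.simps)
  also have "\<dots> = 1" using finite_multiples[of "Suc d" n] Suc by (simp del: W_poly.simps)
  finally show ?case .
qed

lemma square_dvd_N_poly: "m \<noteq> 0 \<Longrightarrow> [:-1, 1:]\<^sup>2 dvd N_poly m"
  by (cases m) auto

lemma square_dvd_W_poly: "n \<noteq> 0 \<Longrightarrow> [:-1, 1:]\<^sup>2 dvd W_poly d n"
proof (induction d arbitrary: n)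
  case (Suc d)
  show ?case unfolding W_poly.simps
  proof (rule dvd_sum)
    fix m assume "m \<in> {m. m * Suc d \<le> n}"
    show "[:-1, 1:]\<^sup>2 dvd N_poly m * monom 1 (m * d) * W_poly d (n - m * Suc d)"
    proof (cases "m = 0")
      case True
      then show ?thesis using Suc by (simp add: dvd_mult)
    next
      case False
      then show ?thesis using square_dvd_N_poly[OF False] by (intro dvd_mult2)
    qed
  qed
qed simp

lemma W_poly_stable: "n \<le> d \<Longrightarrow> W_poly d n = W_poly n n"
proof (induction d rule: dec_induct)
  case (step d)
  have "{m. m * Suc d \<le> n} = {0}"
  proof -
    have "m = 0" if "m * Suc d \<le> n" for m using that step by (cases m) auto
    then show ?thesis by auto
  qed
  then show ?case using step by simp
qed simp

section \<open>The generating function\<close>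

definition N_fps :: "int poly fract fps" where
  "N_fps = Abs_fps (\<lambda>m. eval_at (N_poly m) qvar / qvar ^ m)"

definition W_fps :: "nat \<Rightarrow> int poly fract fps" where
  "W_fps d = Abs_fps (\<lambda>n. eval_at (W_poly d n) qvar / qvar ^ n)"

lemma W_fps_0: "W_fps 0 = 1"
  by (auto simp: W_fps_def fps_eq_iff)

lemma W_fps_Suc: "W_fps (Suc d) = (N_fps oo fps_X ^ Suc d) * W_fps d"
proof (rule fps_ext)
  fix n
  let ?M = "{m. m * Suc d \<le> n}"
  define h where "h = N_fps oo fps_X ^ Suc d"
  have h: "fps_nth h i = (if Suc d dvd i then fps_nth N_fps (i div Suc d) else 0)" for i
    unfolding h_def by (rule fps_nth_compose_X_power)
  have "fps_nth (h * W_fps d) n = (\<Sum>i=0..n. fps_nth h i * fps_nth (W_fps d) (n - i))"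
    by (simp add: fps_mult_nth)
  also have "\<dots> = (\<Sum>i\<in>(\<lambda>m. m * Suc d) ` ?M. fps_nth h i * fps_nth (W_fps d) (n - i))"
  proof (intro sum.mono_neutral_right ballI)
    fix i assume i: "i \<in> {0..n} - (\<lambda>m. m * Suc d) ` ?M"
    have "\<not> Suc d dvd i"
    proof
      assume "Suc d dvd i"
      then obtain m where "i = m * Suc d" by (metis dvd_def mult.commute)
      then show False using i by auto
    qed
    then show "fps_nth h i * fps_nth (W_fps d) (n - i) = 0" by (simp add: h)
  qed auto
  also have "\<dots> = (\<Sum>m\<in>?M. fps_nth h (m * Suc d) * fps_nth (W_fps d) (n - m * Suc d))"
    by (subst sum.reindex) (auto simp: inj_on_def simp del: mult_Suc_right)
  also have "\<dots> = fps_nth (W_fps (Suc d)) n"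
    unfolding W_fps_def fps_nth_Abs_fps W_poly.simps eval_at_sum sum_divide_distrib
  proof (rule sum.cong[OF refl])
    fix m assume "m \<in> ?M"
    \<comment> \<open>Along this splitting of \<open>n\<close> the power
      \<open>qvar ^ (m * d)\<close> in the denominator cancels against
      \<open>monom 1 (m * d)\<close>, and what remains are coefficients of \<open>N_fps\<close> and
      of \<open>W_fps d\<close>.\<close>
    then have n: "n = m + m * d + (n - m * Suc d)" by simp
    have "qvar ^ n = qvar ^ m * qvar ^ (m * d) * qvar ^ (n - m * Suc d)"
      by (subst n) (simp only: power_add)
    moreover have "fps_nth h (m * Suc d) = eval_at (N_poly m) qvar / qvar ^ m"
      by (simp add: h N_fps_def del: mult_Suc_right)
    ultimately show "fps_nth h (m * Suc d) * (eval_at (W_poly d (n - m * Suc d)) qvar / qvar ^ (n - m * Suc d)) =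
      eval_at (N_poly m * monom 1 (m * d) * W_poly d (n - m * Suc d)) qvar / qvar ^ n"
      by (simp add: eval_at_mult eval_at_monom)
  qed
  finally show "fps_nth (W_fps (Suc d)) n = fps_nth ((N_fps oo fps_X ^ Suc d) * W_fps d) n" by (simp only: h_def)
qed

text \<open>The quadratic factor is (1 - q t) (1 - t / q). Its two inverse roots yield a three-term
  recurrence for the coefficients from index 3 on; the coefficients at 0, 1 and 2 account for the
  numerator.\<close>

lemma N_fps_mult: "N_fps * (1 - fps_const (qvar + inverse qvar) * fps_X + fps_X\<^sup>2) = (1 - fps_X)\<^sup>2"
proof -
  define c where "c = qvar + inverse qvar"
  define S where "S m = (\<Sum>i<Suc m. qvar ^ (2 * i))" for m
  have S: "S (Suc m) = S m + qvar ^ (2 * Suc m)" for m by (simp add: S_def)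
  have N: "fps_nth N_fps (Suc m) = (qvar - 1)\<^sup>2 * S m / qvar ^ Suc m" for m
    unfolding N_fps_def S_def
    by (simp add: eval_at_mult eval_at_sum eval_at_power eval_at_monom eval_at_pCons del: sum.lessThan_Suc power_Suc)
  have N0: "fps_nth N_fps 0 = 1" by (simp add: N_fps_def)
  have N1: "fps_nth N_fps (Suc 0) = c - 2"
    by (simp add: N S_def c_def field_simps power2_eq_square)
  have N2: "fps_nth N_fps (Suc (Suc 0)) = c * fps_nth N_fps (Suc 0)"
    unfolding N S by (simp add: S_def c_def field_simps power2_eq_square)
  have Nrec: "fps_nth N_fps (Suc (Suc (Suc n))) = c * fps_nth N_fps (Suc (Suc n)) - fps_nth N_fps (Suc n)" for n
  proof -
    \<comment> \<open>The recurrence with \<open>z\<close> for \<open>qvar\<close>, \<open>Q\<close>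
      for \<open>qvar ^ n\<close>, \<open>s\<close> for \<open>S n\<close> and \<open>A\<close> for
      the square of \<open>qvar - 1\<close>: naming the powers leaves an identity of rational
      functions.\<close>
    have aux: "A * (s + Q * Q * (z * z) + Q * Q * (z * z * (z * z))) / (z * (z * (z * Q))) =
        (z + inverse z) * (A * (s + Q * Q * (z * z)) / (z * (z * Q))) - A * s / (z * Q)"
      if "z \<noteq> 0" "Q \<noteq> 0" for z Q A s :: "int poly fract"
    proof -
      let ?B = "s + Q * Q * (z * z)"
      have "(z + inverse z) * (A * ?B / (z * (z * Q))) = A * (z * z * ?B + ?B) / (z * (z * (z * Q)))"
        using that by (simp add: divide_simps) (simp add: algebra_simps)
      moreover have "A * s / (z * Q) = A * (z * z * s) / (z * (z * (z * Q)))"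
        using that by simp
      ultimately have "(z + inverse z) * (A * ?B / (z * (z * Q))) - A * s / (z * Q) =
          A * (z * z * ?B + ?B - z * z * s) / (z * (z * (z * Q)))"
        by (simp only: right_diff_distrib diff_divide_distrib)
      also have "z * z * ?B + ?B - z * z * s = ?B + Q * Q * (z * z * (z * z))"
        by (simp add: algebra_simps)
      finally show ?thesis by (simp only:)
    qed
    have "S (Suc n) = S n + qvar ^ n * qvar ^ n * (qvar * qvar)"
      "S (Suc (Suc n)) = S n + qvar ^ n * qvar ^ n * (qvar * qvar) + qvar ^ n * qvar ^ n * (qvar * qvar * (qvar * qvar))"
      unfolding S mult_2 power_add power_Suc by (simp_all add: mult_ac)
    then show ?thesis unfolding N c_def power_Suc using aux[of qvar "qvar ^ n"] by simp
  qed
  have "N_fps - fps_const c * (N_fps * fps_X) + N_fps * fps_X\<^sup>2 = (1 - fps_X)\<^sup>2"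
  proof (rule fps_ext)
    fix n
    have sq: "(1 - fps_X)\<^sup>2 = (1 - 2 * fps_X + fps_X\<^sup>2 :: int poly fract fps)"
      by (simp add: power2_eq_square algebra_simps)
    have X2: "fps_nth (N_fps * fps_X\<^sup>2) n = (if n < 2 then 0 else fps_nth N_fps (n - 2))" for n
      by (rule fps_X_power_mult_right_nth)
    consider "n = 0" | "n = 1" | "n = 2" | k where "n = Suc (Suc (Suc k))"
      by (metis One_nat_def Suc_1 not0_implies_Suc)
    then show "fps_nth (N_fps - fps_const c * (N_fps * fps_X) + N_fps * fps_X\<^sup>2) n = fps_nth ((1 - fps_X)\<^sup>2) n"
      unfolding sq
      by cases (simp_all add: N0 N1 N2[unfolded N1 numeral_2_eq_2[symmetric]] Nrec X2 fps_numeral_nth numeral_2_eq_2[symmetric] fps_X_power_nth)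
  qed
  then show ?thesis by (simp add: c_def algebra_simps)
qed

lemma N_fps_compose:
  assumes "k > 0"
  shows "N_fps oo fps_X ^ k =
    (1 - fps_X ^ k)\<^sup>2 / (1 - fps_const (qvar + inverse qvar) * fps_X ^ k + fps_X ^ (2 * k))"
proof -
  let ?u = "1 - fps_const (qvar + inverse qvar) * fps_X ^ k + fps_X ^ (2 * k) :: int poly fract fps"
  have c0: "fps_nth (fps_X ^ k :: int poly fract fps) 0 = 0" using assms by simp
  have X: "fps_X oo (fps_X ^ k :: int poly fract fps) = fps_X ^ k"
    using assms by (simp add: fps_X_fps_compose_startby0)
  have "(N_fps oo fps_X ^ k) * ((1 - fps_const (qvar + inverse qvar) * fps_X + fps_X\<^sup>2) oo fps_X ^ k) =
    ((1 - fps_X)\<^sup>2 oo fps_X ^ k)"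
    by (simp only: fps_compose_mult_distrib[OF c0, symmetric] N_fps_mult)
  moreover have "(1 - fps_const (qvar + inverse qvar) * fps_X + fps_X\<^sup>2) oo fps_X ^ k = ?u"
    using X by (simp add: fps_compose_add_distrib fps_compose_sub_distrib fps_compose_mult_distrib[OF c0]
        power2_eq_square mult_2 power_add)
  moreover have "(1 - fps_X)\<^sup>2 oo fps_X ^ k = (1 - fps_X ^ k :: int poly fract fps)\<^sup>2"
    using X by (simp add: fps_compose_sub_distrib fps_compose_mult_distrib[OF c0] power2_eq_square)
  ultimately have "(N_fps oo fps_X ^ k) * ?u = (1 - fps_X ^ k)\<^sup>2" by simp
  moreover have "?u \<noteq> 0"
  proof
    assume "?u = 0"
    from arg_cong[OF this, of "\<lambda>f. fps_nth f 0"] show False using assms by simp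
  qed
  ultimately show ?thesis by (metis nonzero_mult_div_cancel_right)
qed

text \<open>The partial products are the series \<open>W_fps\<close>. Their coefficient at
  \<open>n\<close> is constant from \<open>d = n\<close> on, and for power series such stabilisation
  is convergence. The limit has constant coefficient 1, hence is non-zero, as
  \<open>has_prod\<close> demands.\<close>

lemma W_fps_has_prod:
  "(\<lambda>i. (1 - fps_X ^ Suc i)\<^sup>2 /
        (1 - fps_const (qvar + inverse qvar) * fps_X ^ Suc i + fps_X ^ (2 * Suc i)))
     has_prod
   (1 + Abs_fps (\<lambda>n. if n \<ge> 1 then eval_at (W_poly n n) qvar / qvar ^ n else 0))"
  (is "?f has_prod ?L")
proof -
  have f: "?f i = N_fps oo fps_X ^ Suc i" for i by (rule N_fps_compose[symmetric]) simp
  have prod: "(\<Prod>i\<le>n. ?f i) = W_fps (Suc n)" for n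
    unfolding f
  proof (induction n)
    case 0
    show ?case using W_fps_Suc[of 0] by (simp add: W_fps_0)
  next
    case (Suc n)
    show ?case unfolding prod.atMost_Suc Suc W_fps_Suc[of "Suc n"] by (rule mult.commute)
  qed
  have L: "fps_nth ?L n = fps_nth (W_fps d) n" if "n \<le> d" for n d
    using W_poly_stable[OF that] by (cases n) (simp_all add: W_fps_def del: W_poly.simps(2))
  have "(\<lambda>n. \<Prod>i\<le>n. ?f i) \<longlonglongrightarrow> ?L"
    unfolding prod
  proof (rule tendsto_fpsI)
    fix n show "\<forall>\<^sub>F d in sequentially. fps_nth (W_fps (Suc d)) n = fps_nth ?L n"
      using eventually_ge_at_top[of n] by eventually_elim (rule L[symmetric], simp)
  qed
  moreover have "?L \<noteq> 0"
  proof
    assume "?L = 0"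
    from arg_cong[OF this, of "\<lambda>f. fps_nth f 0"] show False by simp
  qed
  ultimately have "raw_has_prod ?f 0 ?L" by (simp add: raw_has_prod_def)
  then show ?thesis by (simp add: has_prod_def)
qed

context finite_field_mod begin

lemma poly_N_poly: "poly (N_poly m) (int q) = int (unit_count m)"
proof (cases m)
  case 0
  then show ?thesis by (simp add: unit_count_0)
next
  case (Suc k)
  then show ?thesis
    by (simp add: unit_count_Suc poly_sum poly_monom del: sum.lessThan_Suc)
qed

lemma poly_W_poly: "poly (W_poly d n) (int q) = int (card (good_ideals n d))"
proof (induction d arbitrary: n)
  case 0
  show ?case by (simp add: good_ideals_0)
next
  case (Suc d)
  show ?case
    unfolding W_poly.simps card_good_ideals_Suc
    by (simp add: poly_sum poly_monom poly_N_poly Suc del: mult_Suc_right)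
qed

end

section \<open>Pulling ideals back along ring homomorphisms\<close>

definition is_hom :: "('a::comm_ring_1 \<Rightarrow> 'b::comm_ring_1) \<Rightarrow> bool" where
  "is_hom f \<longleftrightarrow> f 1 = 1 \<and> (\<forall>a b. f (a + b) = f a + f b) \<and> (\<forall>a b. f (a * b) = f a * f b)"

lemma is_homD:
  assumes "is_hom f"
  shows "f 1 = 1" "f (a + b) = f a + f b" "f (a * b) = f a * f b" "f 0 = 0" "f (a - b) = f a - f b" "f (a ^ n) = f a ^ n"
proof -
  show one: "f 1 = 1" and add: "\<And>a b. f (a + b) = f a + f b" and mult: "f (a * b) = f a * f b"
    using assms by (auto simp: is_hom_def)
  show "f 0 = 0" using add[of 0 0] by simp
  show "f (a - b) = f a - f b" using add[of "a - b" b] by (simp add: algebra_simps)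
  show "f (a ^ n) = f a ^ n" using assms by (induction n) (auto simp: is_hom_def)
qed

lemma is_ideal_vimage: "is_hom f \<Longrightarrow> is_ideal J \<Longrightarrow> is_ideal (f -` J)"
  by (auto simp: is_ideal_def is_homD)

lemma unit_mod_mult: 
  assumes "is_ideal K"
  shows "unit_mod K (a * b) \<longleftrightarrow> unit_mod K a \<and> unit_mod K b"
proof (intro iffI conjI)
  assume "unit_mod K (a * b)"
  then obtain s where s: "1 - a * b * s \<in> K" by (auto simp: unit_mod_def)
  show "unit_mod K a" unfolding unit_mod_def using s by (intro exI[of _ "b * s"]) (simp add: mult_ac)
  show "unit_mod K b" unfolding unit_mod_def using s by (intro exI[of _ "a * s"]) (simp add: mult_ac)
next
  assume "unit_mod K a \<and> unit_mod K b"
  then obtain s t where s: "1 - a * s \<in> K" "1 - b * t \<in> K" by (auto simp: unit_mod_def)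
  have "(1 - a * s) + (a * s) * (1 - b * t) \<in> K"
    by (rule is_ideal_add[OF assms s(1) is_ideal_mult[OF assms s(2)]])
  also have "(1 - a * s) + (a * s) * (1 - b * t) = 1 - (a * b) * (s * t)" by (simp add: algebra_simps)
  finally show "unit_mod K (a * b)" unfolding unit_mod_def by blast
qed

lemma unit_mod_cancel_power:
  assumes K: "is_ideal K" and u: "unit_mod K u" and s: "s * u ^ N \<in> K" shows "s \<in> K"
  using s
proof (induction N)
  case (Suc N)
  obtain a where a: "1 - u * a \<in> K" using u by (auto simp: unit_mod_def)
  have "(s * u ^ N) * (1 - u * a) + a * (s * u ^ Suc N) \<in> K"
    by (rule is_ideal_add[OF K is_ideal_mult[OF K a] is_ideal_mult[OF K Suc.prems]])
  also have "(s * u ^ N) * (1 - u * a) + a * (s * u ^ Suc N) = s * u ^ N" by (simp add: algebra_simps)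
  finally show ?case by (rule Suc.IH)
qed simp

text \<open>\<open>f\<close> presents its target as the localisation at the powers of
  \<open>u\<close>. In the application \<open>u\<close> is x y, which by
  \<open>unit_mod_mult\<close> takes care of both variables at once.\<close>

locale localization =
  fixes f :: "'s::comm_ring_1 \<Rightarrow> 'p::comm_ring_1" and u :: 's and v :: 'p
  assumes hom: "is_hom f" and unit: "f u * v = 1"
    and fraction: "\<And>p. \<exists>N s. p * f u ^ N = f s"
begin

lemma clear_denominator: "p * f u ^ N = f s \<Longrightarrow> p = v ^ N * f s"
proof -
  have "f u ^ N * v ^ N = 1" by (simp add: unit flip: power_mult_distrib)
  then show "p * f u ^ N = f s \<Longrightarrow> p = v ^ N * f s" by (metis mult.assoc mult.commute mult.right_neutral)
qed

text \<open>The induced map of quotients is onto: if \<open>a\<close> inverts \<open>u\<close>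
  modulo the preimage, then \<open>f a\<close> is congruent to \<open>v\<close> modulo
  \<open>J\<close>, so every denominator can be replaced by an element of the image.\<close>

lemma index_vimage:
  assumes J: "is_ideal J" and u: "unit_mod (f -` J) u"
  shows "index UNIV (f -` J) = index UNIV J"
proof (rule index_eq_if_additive[where f = f])
  note JV = is_ideal_vimage[OF hom J]
  show "add_subgroup J" "add_subgroup (f -` J)" using J JV by (simp_all add: add_subgroup_ideal)
  obtain a where a: "1 - u * a \<in> f -` J" using u by (auto simp: unit_mod_def)
  show "\<exists>s\<in>UNIV. f s - p \<in> J" for p
  proof -
    obtain N s where "p * f u ^ N = f s" using fraction by blast
    then have "\<exists>s. v ^ N * f s = p" using clear_denominator by metis
    moreover have "\<exists>t. f t - v ^ N * f s \<in> J" for s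
    proof (induction N)
      case 0
      then show ?case using is_ideal_0[OF J] by (intro exI[of _ s]) simp
    next
      case (Suc N)
      then obtain t where t: "f t - v ^ N * f s \<in> J" by blast
      have "v * (f t - v ^ N * f s) - (v * f t) * f (1 - u * a) \<in> J"
        using is_ideal_diff[OF J is_ideal_mult[OF J t] is_ideal_mult[OF J]] a by simp
      also have "v * (f t - v ^ N * f s) - (v * f t) * f (1 - u * a) = (f u * v) * f (a * t) - v ^ Suc N * f s"
        by (simp add: is_homD[OF hom] algebra_simps)
      finally show ?case unfolding unit by auto
    qed
    ultimately show ?thesis by auto
  qed
qed (auto simp: is_homD[OF hom])

text \<open>In a finite quotient two powers of the unit \<open>f u\<close> coincide. Cancelling the
  lower one shows that some power of \<open>u\<close>, an element without denominator, inverts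
  \<open>u\<close>.\<close>

lemma unit_mod_vimage:
  assumes J: "is_ideal J" "index UNIV J > 0" shows "unit_mod (f -` J) u"
proof -
  have "finite (range (\<lambda>i::nat. coset_of J (f u ^ i)))"
    using J(2) by (rule_tac finite_subset[of _ "coset_of J ` UNIV"]) (auto simp: index_def card_gt_0_iff)
  then have "\<not> inj (\<lambda>i::nat. coset_of J (f u ^ i))" by (metis finite_imageD infinite_UNIV_nat)
  then obtain i j where "i \<noteq> j" "coset_of J (f u ^ i) = coset_of J (f u ^ j)" by (auto simp: inj_def)
  then have "\<exists>i k. f u ^ i - f u ^ (i + Suc k) \<in> J"
    using coset_of_eq_iff[OF add_subgroup_ideal[OF J(1)]] 
    by (metis less_iff_Suc_add add_Suc_right linorder_neqE_nat)
  then obtain i k where "f u ^ i - f u ^ (i + Suc k) \<in> J" by blast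
  then have "v ^ i * (f u ^ i - f u ^ (i + Suc k)) \<in> J" by (rule is_ideal_mult[OF J(1)])
  also have "v ^ i * (f u ^ i - f u ^ (i + Suc k)) = (f u * v) ^ i * (1 - f u ^ Suc k)"
    by (simp only: power_add power_mult_distrib) (simp add: algebra_simps)
  also have "\<dots> = f (1 - u * u ^ k)" by (simp add: unit is_homD[OF hom])
  finally show ?thesis by (auto simp: unit_mod_def)
qed

text \<open>The inverse map sends \<open>K\<close> to the fractions with numerator in
  \<open>K\<close>. No new numerators arise, because \<open>u\<close> is a unit modulo
  \<open>K\<close> and its powers can be cancelled there.\<close>

lemma bij_betw_vimage:
  assumes Z: "is_ideal Z" and M: "M > 0"
  shows "bij_betw (\<lambda>J. f -` J) {J. is_ideal J \<and> Z \<subseteq> J \<and> index UNIV J = M}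
    {K. is_ideal K \<and> f -` Z \<subseteq> K \<and> unit_mod K u \<and> index UNIV K = M}"
proof (rule bij_betw_byWitness[where f' = "\<lambda>K. {p. \<exists>N s. p * f u ^ N = f s \<and> s \<in> K}"])
  have recover: "{p. \<exists>N s. p * f u ^ N = f s \<and> s \<in> f -` J} = J" if J: "is_ideal J" for J
  proof (intro equalityI subsetI)
    fix p assume "p \<in> {p. \<exists>N s. p * f u ^ N = f s \<and> s \<in> f -` J}"
    then obtain N s where s: "p * f u ^ N = f s" "f s \<in> J" by auto
    then show "p \<in> J" using clear_denominator[OF s(1)] is_ideal_mult[OF J s(2)] by simp
  next
    fix p assume "p \<in> J"
    moreover obtain N s where "p * f u ^ N = f s" using fraction by blast
    ultimately show "p \<in> {p. \<exists>N s. p * f u ^ N = f s \<and> s \<in> f -` J}" 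
      using is_ideal_mult'[OF J, of p "f u ^ N"] by auto
  qed
  then show "\<forall>J\<in>{J. is_ideal J \<and> Z \<subseteq> J \<and> index UNIV J = M}.
      {p. \<exists>N s. p * f u ^ N = f s \<and> s \<in> f -` J} = J" by blast
  show "(\<lambda>J. f -` J) ` {J. is_ideal J \<and> Z \<subseteq> J \<and> index UNIV J = M} \<subseteq>
      {K. is_ideal K \<and> f -` Z \<subseteq> K \<and> unit_mod K u \<and> index UNIV K = M}"
    using M by (auto simp: is_ideal_vimage[OF hom] unit_mod_vimage index_vimage)
  have main: "f -` {p. \<exists>N s. p * f u ^ N = f s \<and> s \<in> K} = K"
    "is_ideal {p. \<exists>N s. p * f u ^ N = f s \<and> s \<in> K}" "Z \<subseteq> {p. \<exists>N s. p * f u ^ N = f s \<and> s \<in> K}"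
    if K: "is_ideal K" "f -` Z \<subseteq> K" "unit_mod K u" for K
  proof -
    let ?J = "{p. \<exists>N s. p * f u ^ N = f s \<and> s \<in> K}"
    show "f -` ?J = K"
    proof (intro equalityI subsetI)
      fix s assume "s \<in> f -` ?J"
      then obtain N t where t: "f s * f u ^ N = f t" "t \<in> K" by auto
      then have "f (s * u ^ N - t) = 0" by (simp add: is_homD[OF hom])
      \<comment> \<open>The kernel of \<open>f\<close> is contained in the preimage of
        \<open>Z\<close>, hence in \<open>K\<close>.\<close>
      then have "s * u ^ N - t \<in> K" using K(2) is_ideal_0[OF Z] by auto
      then have "s * u ^ N \<in> K" using is_ideal_diff_iff[OF K(1)] t(2) by blast
      then show "s \<in> K" by (rule unit_mod_cancel_power[OF K(1,3)])
    next
      fix s assume "s \<in> K"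
      then show "s \<in> f -` ?J" by (auto intro!: exI[of _ 0] exI[of _ s])
    qed
    show "is_ideal ?J"
      unfolding is_ideal_def
    proof (intro conjI ballI allI)
      show "0 \<in> ?J" using is_ideal_0[OF K(1)] by (auto simp: is_homD[OF hom] intro!: exI[of _ 0])
    next
      fix a b assume "a \<in> ?J" "b \<in> ?J"
      then obtain N s N' s' where s: "a * f u ^ N = f s" "s \<in> K" "b * f u ^ N' = f s'" "s' \<in> K" by auto
      have "(a + b) * f u ^ (N + N') = (a * f u ^ N) * f u ^ N' + (b * f u ^ N') * f u ^ N"
        by (simp add: power_add algebra_simps)
      also have "\<dots> = f (s * u ^ N' + s' * u ^ N)" by (simp add: s is_homD[OF hom])
      finally show "a + b \<in> ?J" using is_ideal_add[OF K(1) is_ideal_mult'[OF K(1) s(2)] is_ideal_mult'[OF K(1) s(4)]] by blast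
    next
      fix r a assume "a \<in> ?J"
      then obtain N s where s: "a * f u ^ N = f s" "s \<in> K" by auto
      obtain N' t where t: "r * f u ^ N' = f t" using fraction by blast
      have "(r * a) * f u ^ (N' + N) = (r * f u ^ N') * (a * f u ^ N)"
        by (simp add: power_add algebra_simps)
      also have "\<dots> = f (t * s)" by (simp add: s t is_homD[OF hom])
      finally show "r * a \<in> ?J" using is_ideal_mult[OF K(1) s(2)] by blast
    qed
    show "Z \<subseteq> ?J"
    proof
      fix z assume z: "z \<in> Z"
      obtain N s where s: "z * f u ^ N = f s" using fraction by blast
      then have "s \<in> f -` Z" using is_ideal_mult'[OF Z z, of "f u ^ N"] by simp
      then show "z \<in> ?J" using s K(2) by blast
    qed
  qed
  then show "\<forall>K\<in>{K. is_ideal K \<and> f -` Z \<subseteq> K \<and> unit_mod K u \<and> index UNIV K = M}.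
      f -` {p. \<exists>N s. p * f u ^ N = f s \<and> s \<in> K} = K" by blast
  show "(\<lambda>K. {p. \<exists>N s. p * f u ^ N = f s \<and> s \<in> K}) `
      {K. is_ideal K \<and> f -` Z \<subseteq> K \<and> unit_mod K u \<and> index UNIV K = M} \<subseteq>
      {J. is_ideal J \<and> Z \<subseteq> J \<and> index UNIV J = M}"
  proof clarify
    fix K assume K: "is_ideal K" "f -` Z \<subseteq> K" "unit_mod K u" and M: "M = index UNIV K"
    show "is_ideal {p. \<exists>N s. p * f u ^ N = f s \<and> s \<in> K} \<and> Z \<subseteq> {p. \<exists>N s. p * f u ^ N = f s \<and> s \<in> K} \<and>
      index UNIV {p. \<exists>N s. p * f u ^ N = f s \<and> s \<in> K} = index UNIV K"
      using main[OF K] index_vimage[OF main(2)[OF K]] K(3) by simp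
  qed
qed

end

section \<open>Laurent polynomials over a commutative ring\<close>

text \<open>Under convolution these functions form the group ring of the exponent lattice, which
  provides Laurent polynomials as an instance of \<open>comm_ring_1\<close>.\<close>

type_synonym 'c laurent = "(int \<times> int) \<Rightarrow>\<^sub>0 'c"

lemma lookup_mult_keys:
  fixes p r :: "'c::comm_ring_1 laurent"
  shows "Poly_Mapping.lookup (p * r) k = (\<Sum>l\<in>Poly_Mapping.keys p. Poly_Mapping.lookup p l * Poly_Mapping.lookup r (k - l))"
proof -
  have "Sum_any (\<lambda>q. Poly_Mapping.lookup r q when k = l + q) = Poly_Mapping.lookup r (k - l)" for l
  proof -
    have "(\<lambda>q. Poly_Mapping.lookup r q when k = l + q) = (\<lambda>q. Poly_Mapping.lookup r q when q = k - l)"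
      by (intro ext) (auto simp: when_def)
    then show ?thesis by (simp only: Sum_any_when_equal)
  qed
  then have "Poly_Mapping.lookup (p * r) k = Sum_any (\<lambda>l. Poly_Mapping.lookup p l * Poly_Mapping.lookup r (k - l))"
    by (simp add: lookup_mult)
  also have "\<dots> = (\<Sum>l\<in>Poly_Mapping.keys p. Poly_Mapping.lookup p l * Poly_Mapping.lookup r (k - l))"
    by (rule Sum_any.expand_superset) (auto simp: in_keys_iff)
  finally show ?thesis .
qed

lemma lookup_single_mult:
  "Poly_Mapping.lookup (Poly_Mapping.single l c * r) k = c * Poly_Mapping.lookup r (k - l)" for r :: "'c::comm_ring_1 laurent"
  by (simp add: lookup_mult_keys)

definition horner :: "('a::comm_ring_1 \<Rightarrow> 'p::comm_ring_1) \<Rightarrow> 'p \<Rightarrow> 'a poly \<Rightarrow> 'p" where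
  "horner f z p = poly (map_poly f p) z"

lemma horner_pCons: "is_hom f \<Longrightarrow> horner f z (pCons a p) = f a + z * horner f z p"
  by (simp add: horner_def map_poly_pCons is_homD)

lemma horner_0 [simp]: "horner f z 0 = 0"
  by (simp add: horner_def)

lemma is_hom_horner:
  assumes f: "is_hom f" shows "is_hom (horner f z)"
proof -
  have add: "horner f z (p + r) = horner f z p + horner f z r" for p r
    by (induction p r rule: poly_induct2) (simp_all add: horner_pCons[OF f] is_homD[OF f] algebra_simps)
  have smult: "horner f z (smult a p) = f a * horner f z p" for a p
    by (induction p) (simp_all add: horner_pCons[OF f] is_homD[OF f] algebra_simps)
  have mult: "horner f z (p * r) = horner f z p * horner f z r" for p r
    by (induction p) (simp_all add: horner_pCons[OF f] add smult is_homD[OF f] algebra_simps)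
  have "horner f z 1 = 1" by (simp add: one_pCons horner_pCons[OF f] is_homD[OF f])
  then show ?thesis using add mult by (simp add: is_hom_def)
qed

definition laurent_x :: "'c::comm_ring_1 poly \<Rightarrow> 'c laurent" where
  "laurent_x = horner (Poly_Mapping.single 0) (Poly_Mapping.single (1, 0) 1)"

definition laurent_xy :: "'c::comm_ring_1 poly poly \<Rightarrow> 'c laurent" where
  "laurent_xy = horner laurent_x (Poly_Mapping.single (0, 1) 1)"

lemma is_hom_single: "is_hom (Poly_Mapping.single 0 :: 'c::comm_ring_1 \<Rightarrow> 'c laurent)"
  by (simp add: is_hom_def single_add mult_single)

lemma is_hom_laurent_x: "is_hom laurent_x"
  unfolding laurent_x_def by (rule is_hom_horner[OF is_hom_single])

lemma is_hom_laurent_xy: "is_hom laurent_xy"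
  unfolding laurent_xy_def by (rule is_hom_horner[OF is_hom_laurent_x])

lemma lookup_laurent_x:
  "Poly_Mapping.lookup (laurent_x p) (i, j) = (if j = 0 \<and> i \<ge> 0 then poly.coeff p (nat i) else 0)"
proof (induction p arbitrary: i)
  case 0
  show ?case by (simp add: laurent_x_def lookup_zero)
next
  case (pCons a p)
  have "laurent_x (pCons a p) = Poly_Mapping.single 0 a + Poly_Mapping.single (1, 0) 1 * laurent_x p"
    unfolding laurent_x_def by (rule horner_pCons[OF is_hom_single])
  then have "Poly_Mapping.lookup (laurent_x (pCons a p)) (i, j) = (a when (0, 0) = (i, j)) + Poly_Mapping.lookup (laurent_x p) (i - 1, j)"
    by (simp add: lookup_add lookup_single lookup_single_mult zero_prod_def)
  moreover have "nat i = Suc (nat (i - 1))" if "i > 0" using that by simp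
  ultimately show ?case unfolding pCons.IH by (auto simp: coeff_pCons when_def split: nat.splits)
qed

lemma lookup_laurent_xy:
  "Poly_Mapping.lookup (laurent_xy p) (i, j) = (if i \<ge> 0 \<and> j \<ge> 0 then poly.coeff (poly.coeff p (nat j)) (nat i) else 0)"
proof (induction p arbitrary: j)
  case 0
  show ?case by (simp add: laurent_xy_def lookup_zero)
next
  case (pCons a p)
  have "laurent_xy (pCons a p) = laurent_x a + Poly_Mapping.single (0, 1) 1 * laurent_xy p"
    unfolding laurent_xy_def by (rule horner_pCons[OF is_hom_laurent_x])
  then have "Poly_Mapping.lookup (laurent_xy (pCons a p)) (i, j) = Poly_Mapping.lookup (laurent_x a) (i, j) + Poly_Mapping.lookup (laurent_xy p) (i, j - 1)"
    by (simp add: lookup_add lookup_single_mult)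
  moreover have "nat j = Suc (nat (j - 1))" if "j > 0" using that by simp
  ultimately show ?case unfolding pCons.IH lookup_laurent_x by (auto simp: coeff_pCons split: nat.splits)
qed

lemma single_power: "Poly_Mapping.single (1, 1) 1 ^ N = (Poly_Mapping.single (int N, int N) 1 :: 'c::comm_ring_1 laurent)"
proof (induction N)
  case 0
  show ?case by (simp flip: single_one add: zero_prod_def)
qed (simp add: mult_single)

lemma laurent_xy_mult_variables:
  "laurent_xy ([:[:0, 1:]:] * [:0, 1:]) = Poly_Mapping.single (1, 1) 1"
  by (simp add: laurent_xy_def laurent_x_def horner_pCons is_hom_laurent_x[unfolded laurent_x_def]
      is_hom_single is_homD mult_single)

lemma laurent_xy_monom:
  "laurent_xy (monom (monom c i) j) = Poly_Mapping.single (int i, int j) c"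
proof (rule poly_mapping_eqI)
  fix k :: "int \<times> int"
  obtain a b where k: "k = (a, b)" by (cases k)
  show "Poly_Mapping.lookup (laurent_xy (monom (monom c i) j)) k = Poly_Mapping.lookup (Poly_Mapping.single (int i, int j) c) k"
    unfolding k lookup_laurent_xy by (auto simp: lookup_single when_def)
qed

interpretation laurent: localization laurent_xy "[:[:0, 1:]:] * [:0, 1:]" "Poly_Mapping.single (-1, -1) 1"
proof
  show "is_hom laurent_xy" by (rule is_hom_laurent_xy)
  show "laurent_xy ([:[:0, 1:]:] * [:0, 1:]) * Poly_Mapping.single (- 1, - 1) 1 = 1"
    unfolding laurent_xy_mult_variables by (simp add: mult_single zero_prod_def[symmetric])
  show "\<exists>N s. p * laurent_xy ([:[:0, 1:]:] * [:0, 1:]) ^ N = laurent_xy s" for p :: "'a laurent"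
    unfolding laurent_xy_mult_variables
  proof (induction p rule: update_induct)
    case const
    have "0 * Poly_Mapping.single (1, 1) 1 ^ 0 = laurent_xy 0" by (simp add: laurent_xy_def)
    then show ?case by blast
  next
    case (update p k c)
    then obtain N s where s: "p * Poly_Mapping.single (1, 1) 1 ^ N = laurent_xy s" by blast
    obtain i j where k: "k = (i, j)" by (cases k)
    \<comment> \<open>Large enough for both exponents of the new term to become
      non-negative.\<close>
    define M where "M = nat \<bar>i\<bar> + nat \<bar>j\<bar>"
    have "Poly_Mapping.update k c p = p + Poly_Mapping.single k c"
      using update(1) by (intro poly_mapping_eqI) (auto simp: lookup_update lookup_add lookup_single when_def in_keys_iff)
    then have "Poly_Mapping.update k c p * Poly_Mapping.single (1, 1) 1 ^ (N + M) =
      (p * Poly_Mapping.single (1, 1) 1 ^ N) * Poly_Mapping.single (1, 1) 1 ^ M +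
      Poly_Mapping.single k c * Poly_Mapping.single (1, 1) 1 ^ (N + M)"
      by (simp add: power_add algebra_simps)
    also have "Poly_Mapping.single (1, 1) 1 ^ M = laurent_xy (([:[:0, 1:]:] * [:0, 1:]) ^ M)"
      by (simp only: is_homD(6)[OF is_hom_laurent_xy] laurent_xy_mult_variables)
    also have "Poly_Mapping.single k c * Poly_Mapping.single (1, 1) 1 ^ (N + M) =
      laurent_xy (monom (monom c (nat (i + int (N + M)))) (nat (j + int (N + M))))"
    proof -
      have "int (nat (i + int (N + M))) = i + int (N + M)" "int (nat (j + int (N + M))) = j + int (N + M)"
        by (simp_all add: M_def)
      then show ?thesis unfolding single_power laurent_xy_monom mult_single k by simp
    qed
    finally have "Poly_Mapping.update k c p * Poly_Mapping.single (1, 1) 1 ^ (N + M) =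
      laurent_xy (s * ([:[:0, 1:]:] * [:0, 1:]) ^ M + monom (monom c (nat (i + int (N + M)))) (nat (j + int (N + M))))"
      by (simp only: s is_homD[OF is_hom_laurent_xy])
    then show ?case by blast
  qed
qed

section \<open>Transfer to carrier-based rings\<close>

lemma index_eq_card_range:
  assumes D: "add_subgroup D" and g: "\<And>p r. g p = g r \<longleftrightarrow> p - r \<in> D"
  shows "index UNIV D = card (range g)"
proof -
  have rep: "g (SOME p. p \<in> coset_of D r) = g r" for r
  proof -
    have "(SOME p. p \<in> coset_of D r) \<in> coset_of D r"
      using self_in_coset_of[OF D] by (rule someI)
    then show ?thesis unfolding g by (simp add: coset_of_def)
  qed
  have "inj_on (\<lambda>C. g (SOME p. p \<in> C)) (range (coset_of D))"
  proof (rule inj_onI, clarify)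
    fix r s assume "g (SOME p. p \<in> coset_of D r) = g (SOME p. p \<in> coset_of D s)"
    then show "coset_of D r = coset_of D s" by (simp only: rep g coset_of_eq_iff[OF D])
  qed
  moreover have "(\<lambda>C. g (SOME p. p \<in> C)) ` range (coset_of D) = range g" by (simp add: image_image rep)
  ultimately show ?thesis unfolding index_def by (metis card_image)
qed

text \<open>The bridge from types to carriers: a surjection of this kind makes \<open>R\<close> a
  commutative ring and identifies its ideals with the ideals above \<open>ker\<close>.\<close>

locale surjective_map = 
  fixes R :: "('x, 'y) ring_scheme" (structure) and h :: "'p::comm_ring_1 \<Rightarrow> 'x"
  assumes carrier: "carrier R = range h"
    and zero: "h 0 = \<zero>" and one: "h 1 = \<one>"
    and add: "\<And>a b. h (a + b) = h a \<oplus> h b" and mult: "\<And>a b. h (a * b) = h a \<otimes> h b"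
begin

lemma cring: "cring R"
proof (rule cringI)
  show "abelian_group R"
  proof (rule abelian_groupI)
    fix x assume "x \<in> carrier R"
    then obtain a where "x = h a" by (auto simp: carrier)
    then have "h (- a) \<oplus> x = \<zero>" by (simp flip: add zero)
    then show "\<exists>y\<in>carrier R. y \<oplus> x = \<zero>" by (auto simp: carrier)
  qed (auto simp: carrier ac_simps simp flip: add zero)
  show "comm_monoid R"
    by (rule comm_monoidI) (auto simp: carrier ac_simps simp flip: mult one)
qed (auto simp: carrier distrib_right simp flip: add mult)

sublocale cring R by (rule cring)

lemma minus: "h (a - b) = h a \<ominus> h b"
proof -
  have "h (- b) = \<ominus> h b"
    by (rule minus_equality[symmetric]) (auto simp: carrier simp flip: add zero)
  then show ?thesis using add[of a "- b"] by (simp add: minus_eq)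
qed

lemma h_closed [simp]: "h a \<in> carrier R"
  by (simp add: carrier)

definition ker :: "'p set" where "ker = {a. h a = \<zero>}"

lemma is_ideal_ker: "is_ideal ker"
  by (auto simp: is_ideal_def ker_def zero add mult)

lemma diff_in_ker: "a - b \<in> ker \<longleftrightarrow> h a = h b"
  by (simp add: ker_def minus r_right_minus_eq)

lemma is_ideal_vimage_ideal: "ideal J R \<Longrightarrow> is_ideal (h -` J)"
  using additive_subgroup.zero_closed[OF ideal.axioms(1), of J R] additive_subgroup.a_closed[OF ideal.axioms(1), of J R]
    ideal.I_l_closed[of J R]
  by (auto simp: is_ideal_def zero add mult)

lemma ideal_image:
  assumes J: "is_ideal J" shows "ideal (h ` J) R"
proof (rule idealI)
  show "ring R" by (rule ring_axioms)
  show "subgroup (h ` J) (add_monoid R)"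
  proof (rule add.subgroupI)
    show "h ` J \<noteq> {}" using is_ideal_0[OF J] by auto
    fix a assume "a \<in> h ` J"
    then obtain p where p: "p \<in> J" "a = h p" by auto
    have "\<ominus> a = h (0 - p)" using p by (simp add: minus zero minus_eq del: diff_0)
    then show "\<ominus> a \<in> h ` J" using is_ideal_diff[OF J is_ideal_0[OF J] p(1)] by blast
  qed (use J in \<open>auto simp flip: add intro!: imageI is_ideal_add\<close>)
  show "x \<otimes> a \<in> h ` J" "a \<otimes> x \<in> h ` J" if "a \<in> h ` J" "x \<in> carrier R" for a x
  proof -
    obtain p r where "p \<in> J" "a = h p" "x = h r" using \<open>a \<in> h ` J\<close> \<open>x \<in> carrier R\<close> by (auto simp: carrier)
    then show "x \<otimes> a \<in> h ` J" "a \<otimes> x \<in> h ` J"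
      using is_ideal_mult[OF J, of p r] is_ideal_mult'[OF J, of p r] by (auto simp flip: mult)
  qed
qed

lemma card_quotient:
  assumes J: "ideal J R"
  shows "card (carrier (R Quot J)) = index UNIV (h -` J)"
proof -
  have "carrier (R Quot J) = (\<lambda>p. J +> h p) ` UNIV"
    by (auto simp: FactRing_def A_RCOSETS_def' carrier)
  moreover have "J +> h p = J +> h r \<longleftrightarrow> p - r \<in> h -` J" for p r
    using quotient_eq_iff_same_a_r_cos[OF J, of "h p" "h r"] by (simp add: minus)
  ultimately show ?thesis
    using index_eq_card_range[OF add_subgroup_ideal[OF is_ideal_vimage_ideal[OF J]], of "\<lambda>p. J +> h p"] by simp
qed

lemma bij_betw_ideals:
  "bij_betw (\<lambda>J. h -` J) {J. ideal J R \<and> card (carrier (R Quot J)) = M}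
    {J. is_ideal J \<and> ker \<subseteq> J \<and> index UNIV J = M}"
proof (rule bij_betw_byWitness[where f' = "\<lambda>J. h ` J"])
  show "\<forall>J\<in>{J. ideal J R \<and> card (carrier (R Quot J)) = M}. h ` (h -` J) = J"
    using ideal.Icarr[of _ R] by (auto simp: carrier)
  have vim: "h -` h ` J = J" if "is_ideal J" "ker \<subseteq> J" for J
  proof (intro equalityI subsetI)
    fix p assume "p \<in> h -` h ` J"
    then obtain r where r: "r \<in> J" "h p = h r" by auto
    then have "p - r \<in> J" using diff_in_ker that by blast
    then show "p \<in> J" using is_ideal_diff_iff[OF that(1)] r(1) by blast
  qed auto
  then show "\<forall>J\<in>{J. is_ideal J \<and> ker \<subseteq> J \<and> index UNIV J = M}. h -` h ` J = J" by blast
  show "(\<lambda>J. h -` J) ` {J. ideal J R \<and> card (carrier (R Quot J)) = M} \<subseteq> {J. is_ideal J \<and> ker \<subseteq> J \<and> index UNIV J = M}"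
    using additive_subgroup.zero_closed[OF ideal.axioms(1)]
    by (auto simp: is_ideal_vimage_ideal card_quotient ker_def)
  show "(\<lambda>J. h ` J) ` {J. is_ideal J \<and> ker \<subseteq> J \<and> index UNIV J = M} \<subseteq> {J. ideal J R \<and> card (carrier (R Quot J)) = M}"
    by (auto simp: ideal_image card_quotient vim)
qed

end

text \<open>Each \<open>line_extension\<close> multiplies the size by that of \<open>K\<close>: if
  \<open>k \<otimes> v \<oplus> e\<close> had two representations with different scalars, a non-zero
  multiple of \<open>v\<close>, and hence \<open>v\<close> itself, would lie in
  \<open>E\<close>.\<close>

lemma (in ring) card_dimension:
  assumes "dimension n K E" "subfield K R" "finite K"
  shows "finite E \<and> card E = card K ^ n"
  using assms
proof (induction rule: dimension.induct)
  case (zero_dim K)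
  then show ?case by simp
next
  case (Suc_dim v E n K)
  note E = space_subgroup_props[OF Suc_dim.prems(1) Suc_dim.hyps(3)]
  note K = subfieldE[OF Suc_dim.prems(1)]
  have "inj_on (\<lambda>(k, e). k \<otimes> v \<oplus> e) (K \<times> E)"
  proof (rule inj_onI, clarify)
    fix k e k' e' assume ke: "k \<in> K" "e \<in> E" "k' \<in> K" "e' \<in> E" and eq: "k \<otimes> v \<oplus> e = k' \<otimes> v \<oplus> e'"
    have carr: "k \<in> carrier R" "k' \<in> carrier R" "e \<in> carrier R" "e' \<in> carrier R" "v \<in> carrier R"
      using ke K(3) E(1) Suc_dim.hyps(1) by auto
    have "k = k'"
    proof (rule ccontr)
      assume ne: "k \<noteq> k'"
      have "(k \<ominus> k') \<otimes> v = (k \<otimes> v \<oplus> e) \<ominus> k' \<otimes> v \<ominus> e"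
        using carr by (simp add: minus_eq l_distr l_minus a_ac r_neg r_neg1 r_neg2)
      also have "\<dots> = e' \<ominus> e" unfolding eq using carr by (simp add: minus_eq a_ac r_neg r_neg1 r_neg2)
      also have "\<dots> \<in> E" using E(3,4) ke by (simp add: minus_eq)
      finally have "(k \<ominus> k') \<otimes> v \<in> E" .
      moreover have "k \<ominus> k' \<in> K - {\<zero>}"
        using ne ke carr subringE(5,7)[OF K(1)] by (simp add: r_right_minus_eq) (simp add: minus_eq)
      ultimately have "v \<in> E" using E(6) carr(5) by blast
      then show False using Suc_dim.hyps(2) by blast
    qed
    then show "k = k' \<and> e = e'" using eq carr by simp
  qed
  moreover have "(\<lambda>(k, e). k \<otimes> v \<oplus> e) ` (K \<times> E) = line_extension K v E"
    by (auto simp: line_extension_mem_iff) blast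
  ultimately have "card (line_extension K v E) = card (K \<times> E)" "finite (line_extension K v E) \<longleftrightarrow> finite (K \<times> E)"
    by (metis card_image, metis finite_image_iff)
  then show ?case using Suc_dim by (simp add: card_cartesian_product)
qed

text \<open>Serves the quotient by the whole ring: in the zero ring the scalars are no subfield, so
  the dimension cannot be found by counting.\<close>

lemma (in ring) dimension_trivial:
  assumes "dimension n K E" "carrier R = {\<zero>}" shows "n = 0 \<and> E = {\<zero>}"
  using assms by (induction rule: dimension.induct) auto

text \<open>For the converse, a finite carrier is spanned by the list of its elements and so has
  some dimension, which its size determines because \<open>K\<close> has more than one
  element.\<close>

lemma (in ring) dimension_carrier_iff:
  assumes K: "subfield K R" "finite K"
  shows "dimension n K (carrier R) \<longleftrightarrow> card (carrier R) = card K ^ n"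
proof
  assume "dimension n K (carrier R)"
  then show "card (carrier R) = card K ^ n" using card_dimension K by blast
next
  assume card: "card (carrier R) = card K ^ n"
  have "{\<zero>, \<one>} \<subseteq> K" "\<zero> \<noteq> \<one>"
    using subringE(2,3)[OF subfieldE(1)[OF K(1)]] subfieldE(6)[OF K(1)] by auto
  then have K1: "card K > 1" using card_mono[OF K(2), of "{\<zero>, \<one>}"] by simp
  then have "finite (carrier R)" using card by (intro card_ge_0_finite) simp
  then obtain Us where Us: "set Us = carrier R" using finite_list by blast
  have "Span K Us = carrier R"
    using Span_base_incl[OF K(1), of Us] Span_in_carrier[of K Us] subfieldE(3)[OF K(1)] Us by auto
  then obtain m where m: "dimension m K (carrier R)"
    using Span_finite_dimension[OF K(1), of Us] Us by (auto simp: finite_dimension_def)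
  then have "card K ^ m = card K ^ n" using card_dimension[OF m K] card by simp
  then show "dimension n K (carrier R)" using m K1 by simp
qed

locale residue_map = F: field F + theta: surjective_map F \<theta>
  for F :: "('a, 'b) ring_scheme" and \<theta> :: "'c::comm_ring_1 \<Rightarrow> 'a" +
  assumes finite: "finite (carrier F)"
begin

abbreviation (input) "R \<equiv> laurent_ring F"
abbreviation (input) "q \<equiv> card (carrier F)"

lemma card_gt_1: "q > 1"
proof -
  have "card {\<zero>\<^bsub>F\<^esub>, \<one>\<^bsub>F\<^esub>} \<le> q" by (rule card_mono[OF finite]) simp
  moreover have "card {\<zero>\<^bsub>F\<^esub>, \<one>\<^bsub>F\<^esub>} = 2" using F.zero_not_one by (intro card_2_iff[THEN iffD2]) blast
  ultimately show ?thesis by linarith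
qed

definition laurent_map :: "'c laurent \<Rightarrow> int \<times> int \<Rightarrow> 'a" where
  "laurent_map p = (\<lambda>k. \<theta> (Poly_Mapping.lookup p k))"

lemma theta_sum: "\<theta> (sum g A) = (\<Oplus>\<^bsub>F\<^esub>k\<in>A. \<theta> (g k))" if "finite A" for A :: "'z set"
  using that by (induction A rule: finite_induct) (simp_all add: theta.zero theta.add)

lemma range_laurent_map: "carrier R = range laurent_map"
proof (intro equalityI subsetI)
  fix f assume "f \<in> carrier R"
  then have f: "range f \<subseteq> carrier F" "finite {m. f m \<noteq> \<zero>\<^bsub>F\<^esub>}" by (auto simp: laurent_ring_def)
  \<comment> \<open>Preimages are chosen pointwise, with 0 over the zero of \<open>F\<close> so that
    the support remains finite.\<close>
  define g where "g k = (if f k = \<zero>\<^bsub>F\<^esub> then 0 else (SOME a. \<theta> a = f k))" for k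
  have g: "\<theta> (g k) = f k" for k
  proof (cases "f k = \<zero>\<^bsub>F\<^esub>")
    case False
    have "\<exists>a. \<theta> a = f k" using f(1) theta.carrier by (metis imageE range_subsetD)
    then show ?thesis using someI_ex[of "\<lambda>a. \<theta> a = f k"] False by (simp add: g_def)
  qed (simp add: g_def theta.zero)
  have "finite {k. g k \<noteq> 0}" using f(2) by (rule rev_finite_subset) (auto simp: g_def)
  then have "laurent_map (Abs_poly_mapping g) = f"
    by (simp add: laurent_map_def g Abs_poly_mapping_inverse)
  then show "f \<in> range laurent_map" by blast
next
  fix f assume "f \<in> range laurent_map"
  then obtain p where p: "f = laurent_map p" by auto
  have "{m. f m \<noteq> \<zero>\<^bsub>F\<^esub>} \<subseteq> Poly_Mapping.keys p"
    by (auto simp: p laurent_map_def in_keys_iff theta.zero)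
  then have "finite {m. f m \<noteq> \<zero>\<^bsub>F\<^esub>}" using finite_subset finite_keys by blast
  then show "f \<in> carrier R" using p by (auto simp: laurent_ring_def laurent_map_def)
qed

lemma laurent_map_mult: "laurent_map (p * r) = laurent_map p \<otimes>\<^bsub>R\<^esub> laurent_map r"
proof
  fix k
  have "laurent_map (p * r) k = (\<Oplus>\<^bsub>F\<^esub>l\<in>Poly_Mapping.keys p. laurent_map p l \<otimes>\<^bsub>F\<^esub> laurent_map r (k - l))"
    by (simp add: laurent_map_def lookup_mult_keys theta_sum theta.mult)
  \<comment> \<open>A non-zero coefficient may lie in the kernel of \<open>\<theta>\<close>, so the
    support can shrink; the summands lost in this way are zero.\<close>
  also have "\<dots> = (\<Oplus>\<^bsub>F\<^esub>l\<in>{l. laurent_map p l \<noteq> \<zero>\<^bsub>F\<^esub>}. laurent_map p l \<otimes>\<^bsub>F\<^esub> laurent_map r (k - l))"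
    by (rule F.add.finprod_mono_neutral_cong_right)
      (auto simp: laurent_map_def in_keys_iff theta.zero)
  finally show "laurent_map (p * r) k = (laurent_map p \<otimes>\<^bsub>R\<^esub> laurent_map r) k"
    by (simp add: laurent_ring_def)
qed

sublocale L: surjective_map R laurent_map
proof
  show "laurent_map 0 = \<zero>\<^bsub>R\<^esub>" by (simp add: laurent_map_def laurent_ring_def theta.zero)
  show "laurent_map 1 = \<one>\<^bsub>R\<^esub>"
    by (auto simp: laurent_map_def laurent_ring_def theta.zero theta.one lookup_one when_def)
  show "laurent_map (a + b) = laurent_map a \<oplus>\<^bsub>R\<^esub> laurent_map b" for a b
    by (simp add: laurent_map_def laurent_ring_def theta.add lookup_add)
qed (rule range_laurent_map laurent_map_mult)+

lemma laurent_const: "laurent_const F (\<theta> a) = laurent_map (Poly_Mapping.single 0 a)"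
  by (auto simp: laurent_const_def laurent_map_def lookup_single when_def theta.zero)

lemma laurent_const_hom: "laurent_const F \<in> ring_hom F R"
proof (rule ring_hom_memI)
  show "laurent_const F x \<in> carrier R" if "x \<in> carrier F" for x
    using that by (auto simp: theta.carrier laurent_const)
  show "laurent_const F (x \<otimes>\<^bsub>F\<^esub> y) = laurent_const F x \<otimes>\<^bsub>R\<^esub> laurent_const F y"
    "laurent_const F (x \<oplus>\<^bsub>F\<^esub> y) = laurent_const F x \<oplus>\<^bsub>R\<^esub> laurent_const F y"
    if xy: "x \<in> carrier F" "y \<in> carrier F" for x y
  proof -
    obtain a b where "x = \<theta> a" "y = \<theta> b" using xy unfolding theta.carrier by blast
    then show "laurent_const F (x \<otimes>\<^bsub>F\<^esub> y) = laurent_const F x \<otimes>\<^bsub>R\<^esub> laurent_const F y"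
      "laurent_const F (x \<oplus>\<^bsub>F\<^esub> y) = laurent_const F x \<oplus>\<^bsub>R\<^esub> laurent_const F y"
      by (simp_all add: laurent_const mult_single single_add flip: theta.mult theta.add L.mult L.add)
  qed
  show "laurent_const F \<one>\<^bsub>F\<^esub> = \<one>\<^bsub>R\<^esub>"
    by (simp add: laurent_const flip: theta.one L.one)
qed

lemma has_codim_iff:
  assumes J: "ideal J R"
  shows "has_codim F J n \<longleftrightarrow> card (carrier (R Quot J)) = q ^ n"
proof -
  interpret J: ideal J R by (rule J)
  interpret Q: ring "R Quot J" by (rule J.quotient_is_ring)
  let ?K = "(\<lambda>c. J +>\<^bsub>R\<^esub> laurent_const F c) ` carrier F"
  have codim: "has_codim F J n \<longleftrightarrow> Q.dimension n ?K (carrier (R Quot J))"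
    by (rule has_codim_def)
  have q1: "q > 1" by (rule card_gt_1)
  show ?thesis
  proof (cases "\<one>\<^bsub>R Quot J\<^esub> = \<zero>\<^bsub>R Quot J\<^esub>")
    case True
    then have triv: "carrier (R Quot J) = {\<zero>\<^bsub>R Quot J\<^esub>}" by (rule Q.one_zeroD)
    have "Q.dimension n ?K (carrier (R Quot J)) \<longleftrightarrow> n = 0"
    proof
      assume "Q.dimension n ?K (carrier (R Quot J))"
      then show "n = 0" using Q.dimension_trivial[OF _ triv] by blast
    next
      assume n: "n = 0"
      show "Q.dimension n ?K (carrier (R Quot J))" unfolding n triv by (rule Q.zero_dim)
    qed
    moreover have "card (carrier (R Quot J)) = 1" unfolding triv by simp
    moreover have "1 = q ^ n \<longleftrightarrow> n = 0" using q1 by (cases n) auto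
    ultimately show ?thesis unfolding codim by simp
  next
    case False
    interpret h: ring_hom_ring F "R Quot J" "\<lambda>c. J +>\<^bsub>R\<^esub> laurent_const F c"
    proof (rule ring_hom_ringI2)
      show "(\<lambda>c. J +>\<^bsub>R\<^esub> laurent_const F c) \<in> ring_hom F (R Quot J)"
        using ring_hom_trans[OF laurent_const_hom J.rcos_ring_hom] by (simp add: comp_def)
    qed (rule F.ring_axioms Q.ring_axioms)+
    note sub = h.img_is_subfield[OF F.carrier_is_subfield False]
    have "card ?K = q" using sub(1) by (rule card_image)
    then show ?thesis using Q.dimension_carrier_iff[OF sub(2)] finite by (simp add: codim)
  qed
qed

lemma finite_field_mod_ker: "finite_field_mod theta.ker q"
proof
  show "is_ideal theta.ker" by (rule theta.is_ideal_ker)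
  show "unit_mod theta.ker a" if "a \<notin> theta.ker" for a
  proof -
    have "\<theta> a \<in> Units F" using that by (simp add: theta.ker_def F.field_Units)
    then obtain y where "y \<in> carrier F" "\<theta> a \<otimes>\<^bsub>F\<^esub> y = \<one>\<^bsub>F\<^esub>" by (auto simp: Units_def)
    then obtain b where "\<theta> (a * b) = \<theta> 1" by (auto simp: theta.carrier theta.mult theta.one)
    then have "1 - a * b \<in> theta.ker" by (simp add: theta.diff_in_ker)
    then show ?thesis by (auto simp: unit_mod_def)
  qed
  show "index UNIV theta.ker = q"
    using index_eq_card_range[OF add_subgroup_ideal[OF theta.is_ideal_ker], of \<theta>] theta.diff_in_ker
    by (simp add: theta.carrier)
  show "1 < q" by (rule card_gt_1)
qed

sublocale finite_field_mod theta.ker q by (rule finite_field_mod_ker)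

lemma laurent_xy_vimage_ker: "laurent_xy -` L.ker = K0"
proof -
  have "laurent_xy p \<in> L.ker \<longleftrightarrow> (\<forall>i j. \<theta> (poly.coeff (poly.coeff p j) i) = \<zero>\<^bsub>F\<^esub>)" for p
  proof
    assume "laurent_xy p \<in> L.ker"
    then have "laurent_map (laurent_xy p) = \<zero>\<^bsub>R\<^esub>" by (simp add: L.ker_def)
    then have "laurent_map (laurent_xy p) (int i, int j) = \<zero>\<^bsub>F\<^esub>" for i j
      by (simp add: laurent_ring_def)
    then show "\<forall>i j. \<theta> (poly.coeff (poly.coeff p j) i) = \<zero>\<^bsub>F\<^esub>"
      by (simp add: laurent_map_def lookup_laurent_xy)
  next
    assume *: "\<forall>i j. \<theta> (poly.coeff (poly.coeff p j) i) = \<zero>\<^bsub>F\<^esub>"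
    show "laurent_xy p \<in> L.ker"
    proof -
      have "laurent_map (laurent_xy p) = \<zero>\<^bsub>R\<^esub>"
        using * by (auto simp: laurent_ring_def laurent_map_def lookup_laurent_xy fun_eq_iff theta.zero)
      then show ?thesis by (simp add: L.ker_def)
    qed
  qed
  then show ?thesis unfolding K0_def by (auto simp: coeffs_in_def theta.ker_def)
qed

text \<open>The codimension is turned into the size of the quotient. Ideals of the Laurent ring over
  \<open>F\<close> then correspond to ideals above \<open>L.ker\<close>, and these to ideals of the
  polynomial ring above \<open>K0\<close> modulo which x y is a unit.\<close>

lemma num_ideals_eq: "num_ideals F n = card (good_ideals n n)"
proof -
  have "q ^ n > 0" using q by simp
  have "{J. ideal J R \<and> has_codim F J n} = {J. ideal J R \<and> card (carrier (R Quot J)) = q ^ n}"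
    using has_codim_iff by blast
  then have "num_ideals F n = card {J. ideal J R \<and> card (carrier (R Quot J)) = q ^ n}"
    unfolding num_ideals_def by (rule arg_cong)
  also have "\<dots> = card {J. is_ideal J \<and> L.ker \<subseteq> J \<and> index UNIV J = q ^ n}"
    by (rule bij_betw_same_card[OF L.bij_betw_ideals])
  also have "\<dots> = card {K. is_ideal K \<and> laurent_xy -` L.ker \<subseteq> K \<and>
      unit_mod K ([:[:0, 1:]:] * [:0, 1:]) \<and> index UNIV K = q ^ n}"
    by (rule bij_betw_same_card[OF laurent.bij_betw_vimage[OF L.is_ideal_ker \<open>q ^ n > 0\<close>]])
  also have "{K. is_ideal K \<and> laurent_xy -` L.ker \<subseteq> K \<and>
      unit_mod K ([:[:0, 1:]:] * [:0, 1:]) \<and> index UNIV K = q ^ n} = {K. good_ideal K \<and> index UNIV K = q ^ n}"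
    unfolding laurent_xy_vimage_ker good_ideal_def using unit_mod_mult by blast
  finally show ?thesis by (simp only: good_ideals_all)
qed

end

text \<open>The polynomial variable is sent to a generator of the cyclic group of units.\<close>

lemma (in field) exists_residue_map:
  assumes fin: "finite (carrier R)"
  shows "\<exists>\<theta> :: int poly \<Rightarrow> 'a. residue_map R \<theta>"
proof -
  obtain g where g: "g \<in> carrier R" "carrier R - {\<zero>} = {g [^] i | i::nat. i \<in> UNIV}"
    using finite_field_mult_group_has_gen[OF fin] by auto
  \<comment> \<open>Evaluation at the generator \<open>g\<close>, written as a Horner scheme in the
    operations of \<open>R\<close>.\<close>
  define \<theta> :: "int poly \<Rightarrow> 'a" where "\<theta> p = fold_coeffs (\<lambda>a b. of_integer R a \<oplus> g \<otimes> b) p \<zero>" for p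
  have pCons: "\<theta> (pCons a p) = of_integer R a \<oplus> g \<otimes> \<theta> p" for a p
    using g(1) by (cases "p = 0"; cases "a = 0") (auto simp: \<theta>_def)
  have zero: "\<theta> 0 = \<zero>" by (simp add: \<theta>_def)
  have closed: "\<theta> p \<in> carrier R" for p
    using g(1) by (induction p) (simp_all add: zero pCons)
  have add: "\<theta> (p + r) = \<theta> p \<oplus> \<theta> r" for p r
    using g(1) closed by (induction p r rule: poly_induct2) (simp_all add: zero pCons r_distr a_ac)
  have smult: "\<theta> (smult a p) = of_integer R a \<otimes> \<theta> p" for a p
    using g(1) closed by (induction p) (simp_all add: zero pCons r_distr m_lcomm)
  have mult: "\<theta> (p * r) = \<theta> p \<otimes> \<theta> r" for p r
    using g(1) closed by (induction p) (simp_all add: zero pCons add smult l_distr m_assoc)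
  have one: "\<theta> 1 = \<one>" using g(1) by (simp add: one_pCons zero pCons)
  \<comment> \<open>The monomials reach all powers of \<open>g\<close>, that is, all non-zero
    elements.\<close>
  have "\<theta> (monom 1 i) = g [^] i" for i
    using g(1) by (induction i) (simp_all add: monom_0 monom_Suc zero pCons m_comm)
  moreover have "x = \<zero> \<or> (\<exists>i::nat. x = g [^] i)" if "x \<in> carrier R" for x
    using that g(2) by blast
  ultimately have "x \<in> range \<theta>" if "x \<in> carrier R" for x
    using that zero by (metis rangeI)
  then have "carrier R = range \<theta>" using closed by blast
  then have "residue_map R \<theta>"
    using fin by unfold_locales (auto simp: zero one add mult)
  then show ?thesis by blast
qed

lemma poly_W_poly_num_ideals:
  assumes "field F" "finite (carrier F)"
  shows "poly (W_poly n n) (int (card (carrier F))) = int (num_ideals F n)"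
proof -
  obtain \<theta> :: "int poly \<Rightarrow> 'a" where "residue_map F \<theta>"
    using field.exists_residue_map[OF assms] by blast
  then interpret residue_map F \<theta> .
  show ?thesis by (simp add: poly_W_poly num_ideals_eq)
qed

text \<open>Uniqueness follows from prime fields: as residue rings of the integers they have the
  type over which the definition quantifies, and infinitely many primes leave no room for a non-zero
  difference.\<close>

lemma C_poly_eq: "C_poly n = W_poly n n"
  unfolding C_poly_def
proof (rule the_equality)
  show "\<forall>F :: int ring. field F \<and> finite (carrier F) \<longrightarrow>
      poly (W_poly n n) (int (card (carrier F))) = int (num_ideals F n)"
    using poly_W_poly_num_ideals by blast
next
  fix p :: "int poly"
  assume p: "\<forall>F :: int ring. field F \<and> finite (carrier F) \<longrightarrow>
      poly p (int (card (carrier F))) = int (num_ideals F n)"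
  have "poly (p - W_poly n n) (int r) = 0" if "prime r" for r
  proof -
    interpret residues_prime r "residue_ring (int r)"
      using that by unfold_locales simp_all
    have F: "field (residue_ring (int r))" "finite (carrier (residue_ring (int r)))"
      "card (carrier (residue_ring (int r))) = r"
      using is_field by (simp_all add: res_carrier_eq)
    then show ?thesis using p poly_W_poly_num_ideals[OF F(1,2), of n] by fastforce
  qed
  then have "int ` {r. prime r} \<subseteq> {x. poly (p - W_poly n n) x = 0}" by auto
  moreover have "infinite (int ` {r. prime r})"
    using primes_infinite by (simp add: finite_image_iff)
  ultimately have "infinite {x. poly (p - W_poly n n) x = 0}" by (metis finite_subset)
  then have "p - W_poly n n = 0" by (metis poly_roots_finite)
  then show "p = W_poly n n" by simp
qed

lemma palindromic_C_poly: "palindromic (C_poly n)"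
proof (cases n)
  case 0
  then show ?thesis by (simp add: C_poly_eq palindromic_def)
next
  case (Suc k)
  have "poly.coeff (W_poly n n) 0 \<noteq> 0" unfolding Suc coeff_0_W_poly by simp
  then show ?thesis
    unfolding C_poly_eq by (rule palindromic_if_self_reciprocal[OF self_reciprocal_W_poly])
qed

text \<open>The factor (q - 1)^2 is itself symmetric with exponent 2 and has constant coefficient 1.
  Cancelling it leaves a cofactor with exponent 2 n - 2 and constant coefficient 1.\<close>

lemma palindromic_P_poly:
  assumes n: "n \<ge> 1" shows "palindromic (P_poly n)"
proof -
  obtain p where p: "C_poly n = [:-1, 1:]\<^sup>2 * p"
    using square_dvd_W_poly[of n n] n by (auto simp: C_poly_eq elim: dvdE)
  have ne: "[:-1, 1:]\<^sup>2 \<noteq> (0 :: int poly)" by simp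
  have P: "P_poly n = p"
    unfolding P_poly_def p
  proof (rule the_equality)
    show "r = p" if "[:-1, 1:]\<^sup>2 * p = [:-1, 1:]\<^sup>2 * r" for r
      using that ne mult_cancel_left by metis
  qed simp
  have "poly.coeff (C_poly n) 0 = 1"
    using coeff_0_W_poly[of "n - 1" n] n by (simp add: C_poly_eq del: W_poly.simps)
  then have p0: "poly.coeff p 0 = 1" by (simp add: p coeff_0_mult power2_eq_square)
  have "self_reciprocal (2 * n) (C_poly n)" unfolding C_poly_eq by (rule self_reciprocal_W_poly)
  then have "eval_at ([:-1, 1:]\<^sup>2) qvar * eval_at p qvar =
      qvar ^ (2 * n) * (eval_at ([:-1, 1:]\<^sup>2) (inverse qvar) * eval_at p (inverse qvar))"
    by (simp add: self_reciprocal_def p eval_at_mult)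
  also have "2 * n = 2 + (2 * n - 2)" using n by simp
  also have "qvar ^ (2 + (2 * n - 2)) * (eval_at ([:-1, 1:]\<^sup>2) (inverse qvar) * eval_at p (inverse qvar)) =
      eval_at ([:-1, 1:]\<^sup>2) qvar * (qvar ^ (2 * n - 2) * eval_at p (inverse qvar))"
    using self_reciprocal_square unfolding self_reciprocal_def power_add by (simp only: mult_ac)
  finally have "self_reciprocal (2 * n - 2) p"
    using ne unfolding self_reciprocal_def
    by (simp only: mult_cancel_left eval_at_qvar to_fract_eq_0_iff simp_thms)
  then show ?thesis unfolding P using p0 by (intro palindromic_if_self_reciprocal) auto
qed

theorem corollary1p4:
  shows "(\<lambda>i. (1 - fps_X ^ Suc i)\<^sup>2 /
              (1 - fps_const (qvar + inverse qvar) * fps_X ^ Suc i + fps_X ^ (2 * Suc i)))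
           has_prod
         (1 + Abs_fps (\<lambda>n. if n \<ge> 1 then eval_at (C_poly n) qvar / qvar ^ n else 0))
         \<and>
         (\<forall>n\<ge>1. palindromic (C_poly n) \<and> palindromic (P_poly n))"
  using W_fps_has_prod palindromic_C_poly palindromic_P_poly unfolding C_poly_eq by blast

end
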